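(* Let $\gamma>p\ge1$, let $d,e\geq 1$ be integers, $T>0$, let $X:[0,T]\to G_d^{[p]}$ be a branched $p$-rough path and let $f=(f_1,\dots,f_d):\mathbb{R}^d\to L(\mathbb{R}^d,\mathbb{R}^e)$ be a $Lip(\gamma-1)$ one-form. Let $B_d^{[p]}=\{\nu_1,\dots,\nu_K\}$ be the trees of degree at most $[p]$ in a family $B_d$ of $\{1,\dots,d\}$-labelled trees freely generating the labelled Grossman–Larson algebra, and let $Z$ be the $\Pi$-rough path that is isomorphic to $X$. Define $g=(g_1,\dots,g_K):\mathbb{R}^d\to L(\mathbb{R}^K,\mathbb{R}^e)$ by $g_k:=f_{\nu_k}$, $k=1,\dots,K$. Then for any $s<t$ in $[0,T]$, the first level integral of $f$ along $X$ on $[s,t]$ is equal to the first level integral of $g$ along $Z$ on $[s,t]$.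
   Context: **Trees and forests.** Trees are finite rooted non-planar trees; a forest is a commutative monomial of trees, including the empty forest $\epsilon$. Vertices are labelled by $\{1,\dots,d\}$. $|\rho|$ is the number of vertices ($|\epsilon|=0$). The depth of a forest is the largest number of vertices on a simple path from a root to a leaf. $T_d$ ($F_d$) is the set of labelled trees (forests), $T_d^n$ ($F_d^n$) the subset of elements of degree $1,\dots,n$. $\bullet_i$ is the one-vertex tree labelled $i$; $[\rho]_i$ is obtained by grafting the roots of all trees of $\rho$ to a new root labelled $i$. Symmetry factor: $\sigma(\bullet_i)=1$, $\sigma(\tau_1^{n_1}\cdots\tau_l^{n_l})=\sigma([\tau_1^{n_1}\cdots\tau_l^{n_l}]_i)=n_1!\cdots n_l!\,\sigma(\tau_1)^{n_1}\cdots\sigma(\tau_l)^{n_l}$ for distinct labelled trees $\tau_j$. **The group $G_d^n$ and branched rough paths.** $\bigtriangleup$ is the labelled Connes–Kreimer coproduct (admissible cuts), multiplicative on forests, with $\bigtriangleup[\rho]_j=[\rho]_j\otimes1+\sum_{\bigtriangleup\rho}\rho_{(1)}\otimes[\rho_{(2)}]_j$. $G_d^n$ is the step-$n$ truncated group of characters: maps $a:F_d\to\mathbb{R}$ with $(a,\epsilon)=1$, $(a,\rho_1\rho_2)=(a,\rho_1)(a,\rho_2)$ if $|\rho_1|+|\rho_2|\le n$, $(a,\rho)=0$ if $|\rho|>n$; product $(ab,\rho)=\sum_{\bigtriangleup\rho}(a,\rho_{(1)})(b,\rho_{(2)})$ for $|\rho|\le n$; norm $\|a\|:=\max_{1\le|\rho|\le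 n}|(a,\rho)|^{1/|\rho|}$. $[p]$ is the largest integer $\le p$. For a continuous path $X$ in a group, $X_{s,t}:=X_s^{-1}X_t$ and $\|X\|_{p-var,[0,T]}:=\sup_D(\sum_k\|X_{t_k,t_{k+1}}\|^p)^{1/p}$ over finite partitions $D$ of $[0,T]$. $X:[0,T]\to G_d^{[p]}$ is a branched $p$-rough path if it is continuous with $\|X\|_{p-var,[0,T]}<\infty$; $x_t\in\mathbb{R}^d$ is the projection of $X_t$ to its degree-1 components. **Lipschitz one-forms.** For $\gamma>0$, $\lfloor\gamma\rfloor$ is the largest integer strictly less than $\gamma$; $f$ is $Lip(\gamma)$ if $\max_{k=0,\dots,\lfloor\gamma\rfloor}\|D^kf\|_\infty+\sup_{x,y}\frac{\|D^{\lfloor\gamma\rfloor}f(x)-D^{\lfloor\gamma\rfloor}f(y)\|}{|x-y|^{\gamma-\lfloor\gamma\rfloor}}<\infty$. Here $f_i:\mathbb{R}^d\to\mathbb{R}^e$ are the components of $f$. **$f_\tau$ and the first level integral along $X$.** For $\tau=\bullet_i$, $f_\tau:=f_i$; for $\tau=[\bullet_{i_1}\cdots\bullet_{i_l}]_i$, $l\in\{1,\dots,[p]-1\}$, $f_\tau:=D^l_{i_1,\dots,i_l}f_i$; $f_\tau:=0$ if $\tau\in T_d^{[p]}$ has depth greater than 2. The first level integral of $f$ along $X$ on $[s,t]$ is $$\lim_{|D|\to0}\sum_k\ \sum_{\tau\in T_d^{[p]}}f_\tau(x_{t_k})\frac{(X_{t_k,t_{k+1}},\tau)}{\sigma(\tau)},$$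 the limit over finite partitions $D=\{t_k\}$ of $[s,t]$ as the mesh tends to zero. **Grossman–Larson algebra.** This is the vector space spanned by $F_d$ with product $\rho_1*\rho_2$ = the sum, over all maps from the trees of $\rho_1$ to (vertices of $\rho_2$) $\cup$ $\{\text{extra root}\}$, of the forest obtained by grafting each tree of $\rho_1$ to its assigned vertex, a tree assigned to the extra root being left as a separate tree. It is freely generated as an associative algebra by a family of trees, and $B_d$ denotes such a ($\{1,\dots,d\}$-labelled) family; $B_d^{[p]}=\{\nu_1,\dots,\nu_K\}$ are its elements of degree at most $[p]$, numbered so that $\nu_i=\bullet_i$ for $i=1,\dots,d$. **$\Pi$-rough paths.** $W$ is the set of finite words in the letters $\{1,\dots,K\}$, including the empty word $\eta$; $|\eta|=0$ and $|i_1\cdots i_m|:=|\nu_{i_1}|+\cdots+|\nu_{i_m}|$. $G_\Pi$ is the truncated group of characters of the shuffle Hopf algebra: maps $h:\{w\in W:|w|\le[p]\}\to\mathbb{R}$ with $(h,\eta)=1$ and $(h,w_1)(h,w_2)=(h,w_1 \sqcup\!\sqcup w_2)$ for $|w_1|+|w_2|\le[p]$, where $\sqcup\!\sqcup$ is the shuffle product; product $(gh,w)=\sum_{uv=w}(g,u)(h,v)$ (concatenation); norm $\|h\|:=\max_{1\le|w|\le[p]}|(h,w)|^{1/|w|}$. A $\Pi$-rough path is a continuous $Z:[0,T]\to G_\Pi$ with $\|Z\|_{p-var,[0,T]}<\infty$. The $\Pi$-rough path isomorphic to $X$ (Boedihardjo–Chevyrev) is the one determined by $$\sum_{\rho\in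 F_d,|\rho|\le[p]}\frac{(X_t,\rho)}{\sigma(\rho)}\,\rho=\sum_{w=i_1\cdots i_m\in W,\ |w|\le[p]}(Z_t,w)\ \nu_{i_1}*\cdots*\nu_{i_m}$$ (the empty word corresponding to $\epsilon$). **First level integral along $Z$ (Gyurkó).** The first level integral of $g=(g_1,\dots,g_K)$, $g_k=f_{\nu_k}$, along $Z$ on $[s,t]$ is the limit, over finite partitions $D=\{t_j\}$ of $[s,t]$ as the mesh tends to zero, of $\sum_j\Xi_{t_j,t_{j+1}}$, where $$\Xi_{u,v}:=\sum_{k=1}^K\ \sum_{l=0}^{[p]-|\nu_k|}\ \sum_{i_1,\dots,i_l\in\{1,\dots,d\}}D^l_{i_1,\dots,i_l}g_k(x_u)\,(Z_{u,v},i_1\cdots i_lk).$$ *)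

theory Defs
  imports
    "HOL-Analysis.Analysis"
    "HOL-Library.Multiset"
    "HOL-Library.FuncSet"
    "HOL-Library.Poly_Mapping"
    "HOL-Algebra.Group"
begin

section \<open>Labelled rooted trees and forests\<close>

text \<open>The label set \<open>{1, \<dots>, d}\<close> is a finite type, which also indexes the coordinates of
  \<open>\<real>\<^sup>d\<close>. The monomial product of forests is the sum of multisets.\<close>

datatype 'l rtree = Node (tree_label: 'l) (branches: "'l rtree multiset")

type_synonym 'l forest = "'l rtree multiset"

abbreviation bullet :: "'l \<Rightarrow> 'l rtree"
  where "bullet i \<equiv> Node i {#}"

primrec tree_deg :: "'l rtree \<Rightarrow> nat"
  where "tree_deg (Node i \<rho>) = Suc (\<Sum>\<^sub># (image_mset tree_deg \<rho>))"

definition forest_deg :: "'l forest \<Rightarrow> nat"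
  where "forest_deg \<rho> = \<Sum>\<^sub># (image_mset tree_deg \<rho>)"

primrec tree_depth :: "'l rtree \<Rightarrow> nat"
  where "tree_depth (Node i \<rho>) = Suc (Max (insert 0 (set_mset (image_mset tree_depth \<rho>))))"

primrec tree_sigma :: "'l rtree \<Rightarrow> nat"
  where "tree_sigma (Node i \<rho>) =
    (\<Prod>\<tau>\<in>set_mset \<rho>. fact (count \<rho> \<tau>)) * \<Prod>\<^sub># (image_mset tree_sigma \<rho>)"

definition forest_sigma :: "'l forest \<Rightarrow> nat"
  where "forest_sigma \<rho> = (\<Prod>\<tau>\<in>set_mset \<rho>. fact (count \<rho> \<tau>) * tree_sigma \<tau> ^ count \<rho> \<tau>)"

lemma tree_sigma_Node: "tree_sigma (Node i \<rho>) = forest_sigma \<rho>"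
  by (simp add: forest_sigma_def prod.distrib image_prod_mset_multiplicity)


section \<open>The Connes--Kreimer coproduct and the group of truncated characters\<close>

text \<open>An element \<open>\<Sum> \<rho>\<^sub>1 \<otimes> \<rho>\<^sub>2\<close> with coefficients in \<open>\<nat>\<close> is the multiset of its terms
  \<open>(\<rho>\<^sub>1, \<rho>\<^sub>2)\<close>, so a Sweedler sum is a sum over this multiset.\<close>

definition tensor_mult ::
    "('l forest \<times> 'l forest) multiset \<Rightarrow> ('l forest \<times> 'l forest) multiset \<Rightarrow>
     ('l forest \<times> 'l forest) multiset"
  where "tensor_mult A B = (\<Sum>a\<in>#A. {#(fst a + fst b, snd a + snd b). b \<in># B#})"

primrec tree_coproduct :: "'l rtree \<Rightarrow> ('l forest \<times> 'l forest) multiset"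
  where "tree_coproduct (Node j \<rho>) =
    {#({#Node j \<rho>#}, {#})#} +
    image_mset (\<lambda>(\<rho>1, \<rho>2). (\<rho>1, {#Node j \<rho>2#}))
      (fold_mset tensor_mult {#({#}, {#})#} (image_mset tree_coproduct \<rho>))"

definition forest_coproduct :: "'l forest \<Rightarrow> ('l forest \<times> 'l forest) multiset"
  where "forest_coproduct \<rho> =
    fold_mset tensor_mult {#({#}, {#})#} (image_mset tree_coproduct \<rho>)"

lemma tensor_mult_altdef:
  fixes B :: "('l forest \<times> 'l forest) multiset"
  shows "tensor_mult A B = (\<Sum>a\<in>#A. image_mset ((+) a) B)"
proof -
  have "(\<lambda>b. (fst a + fst b, snd a + snd b)) = (+) a" for a :: "'l forest \<times> 'l forest"
    by (rule ext) (simp add: plus_prod_def)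
  then show ?thesis by (simp only: tensor_mult_def)
qed

lemma tensor_mult_simps:
  "tensor_mult {#} B = {#}"
  "tensor_mult (add_mset a A) B = image_mset ((+) a) B + tensor_mult A B"
  by (simp_all add: tensor_mult_altdef)

lemma tensor_mult_union: "tensor_mult (A + A') B = tensor_mult A B + tensor_mult A' B"
  by (simp add: tensor_mult_altdef)

lemma tensor_mult_image:
  "tensor_mult (image_mset ((+) a) B) C = image_mset ((+) a) (tensor_mult B C)"
proof (induction B)
  case (add b B)
  have "image_mset ((+) (a + b)) C = image_mset ((+) a) (image_mset ((+) b) C)"
    unfolding multiset.map_comp comp_def add.assoc ..
  with add show ?case
    by (simp only: image_mset_add_mset tensor_mult_simps image_mset_union)
qed (simp add: tensor_mult_simps)

lemma tensor_mult_assoc: "tensor_mult (tensor_mult A B) C = tensor_mult A (tensor_mult B C)"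
  by (induction A) (simp_all only: tensor_mult_simps tensor_mult_union tensor_mult_image)

lemma tensor_mult_empty_right: "tensor_mult A {#} = {#}"
  by (induction A) (simp_all add: tensor_mult_simps)

lemma tensor_mult_add_right:
  "tensor_mult A (add_mset b B) = image_mset ((+) b) A + tensor_mult A B"
  by (induction A)
    (simp_all only: tensor_mult_simps image_mset_empty image_mset_add_mset
      union_mset_add_mset_left union_mset_add_mset_right add_0_left ac_simps)

lemma tensor_mult_commute: "tensor_mult A B = tensor_mult B A"
proof (induction A)
  case (add a A)
  then show ?case
    by (metis tensor_mult_simps(2) tensor_mult_add_right)
qed (simp add: tensor_mult_simps tensor_mult_empty_right)

lemma tensor_mult_one: "tensor_mult {#({#}, {#})#} A = A"
  by (simp add: tensor_mult_def)

interpretation tensor_mult: comp_fun_commute tensor_mult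
proof
  show "tensor_mult B \<circ> tensor_mult A = tensor_mult A \<circ> tensor_mult B"
    for A B :: "('l forest \<times> 'l forest) multiset"
    by (rule ext)
      (simp only: comp_apply tensor_mult_commute[of B A] flip: tensor_mult_assoc)
qed

lemma forest_coproduct_empty: "forest_coproduct {#} = {#({#}, {#})#}"
  by (simp add: forest_coproduct_def)

lemma forest_coproduct_union:
  "forest_coproduct (\<rho> + \<rho>') = tensor_mult (forest_coproduct \<rho>) (forest_coproduct \<rho>')"
  by (induction \<rho>)
    (simp_all add: forest_coproduct_def tensor_mult_one tensor_mult_assoc)

lemma tree_coproduct_Node: "tree_coproduct (Node j \<rho>) =
    {#({#Node j \<rho>#}, {#})#} +
    image_mset (\<lambda>(\<rho>1, \<rho>2). (\<rho>1, {#Node j \<rho>2#})) (forest_coproduct \<rho>)"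
  by (simp add: forest_coproduct_def)

definition character_group :: "nat \<Rightarrow> ('l forest \<Rightarrow> real) monoid"
  where "character_group n =
    \<lparr> carrier = {a. a {#} = 1 \<and>
        (\<forall>\<rho>1 \<rho>2. forest_deg \<rho>1 + forest_deg \<rho>2 \<le> n \<longrightarrow> a (\<rho>1 + \<rho>2) = a \<rho>1 * a \<rho>2) \<and>
        (\<forall>\<rho>. forest_deg \<rho> > n \<longrightarrow> a \<rho> = 0)},
      mult = (\<lambda>a b \<rho>. if forest_deg \<rho> \<le> n
        then (\<Sum>(\<rho>1, \<rho>2)\<in>#forest_coproduct \<rho>. a \<rho>1 * b \<rho>2) else 0),
      one = (\<lambda>\<rho>. if \<rho> = {#} then 1 else 0) \<rparr>"


section \<open>Paths of finite \<open>p\<close>-variation in a truncated group\<close>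

definition group_incr :: "'a monoid \<Rightarrow> (real \<Rightarrow> 'a) \<Rightarrow> real \<Rightarrow> real \<Rightarrow> 'a"
  where "group_incr G X s t = inv\<^bsub>G\<^esub> (X s) \<otimes>\<^bsub>G\<^esub> X t"

definition hom_norm :: "('i \<Rightarrow> nat) \<Rightarrow> nat \<Rightarrow> ('i \<Rightarrow> real) \<Rightarrow> real"
  where "hom_norm deg n a = Max ((\<lambda>i. \<bar>a i\<bar> powr (1 / deg i)) ` {i. 1 \<le> deg i \<and> deg i \<le> n})"

definition is_partition :: "real \<Rightarrow> real \<Rightarrow> real list \<Rightarrow> bool"
  where "is_partition s t D \<longleftrightarrow> D \<noteq> [] \<and> hd D = s \<and> last D = t \<and> sorted_wrt (<) D"

definition mesh :: "real list \<Rightarrow> real"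
  where "mesh D = Max ((\<lambda>k. D ! Suc k - D ! k) ` {..<length D - 1})"

definition partition_sum :: "(real \<Rightarrow> real \<Rightarrow> 'b::comm_monoid_add) \<Rightarrow> real list \<Rightarrow> 'b"
  where "partition_sum \<Xi> D = (\<Sum>k<length D - 1. \<Xi> (D ! k) (D ! Suc k))"

definition mesh_to_0 :: "real \<Rightarrow> real \<Rightarrow> real list filter"
  where "mesh_to_0 s t = (INF \<delta>\<in>{0<..}. principal {D. is_partition s t D \<and> mesh D < \<delta>})"

text \<open>As \<open>y \<mapsto> y\<^bsup>1/p\<^esup>\<close> is continuous and increasing, the root may be taken inside the supremum.\<close>

definition p_var :: "(real \<Rightarrow> real \<Rightarrow> real) \<Rightarrow> real \<Rightarrow> real \<Rightarrow> ereal"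
  where "p_var \<omega> p T =
    (SUP D\<in>{D. is_partition 0 T D}. ereal (partition_sum (\<lambda>u v. \<omega> u v powr p) D powr (1 / p)))"

text \<open>Continuity refers to the topology of pointwise convergence; since elements of the groups below
  vanish beyond degree \<open>n\<close>, this is the topology of a finite-dimensional space.\<close>

definition rough_path_in ::
    "('i \<Rightarrow> real) monoid \<Rightarrow> ('i \<Rightarrow> nat) \<Rightarrow> nat \<Rightarrow> real \<Rightarrow> real \<Rightarrow> (real \<Rightarrow> 'i \<Rightarrow> real) \<Rightarrow> bool"
  where "rough_path_in G deg n p T X \<longleftrightarrow>
    (\<forall>t\<in>{0..T}. X t \<in> carrier G) \<and> continuous_on {0..T} X \<and>
    p_var (\<lambda>u v. hom_norm deg n (group_incr G X u v)) p T < \<infinity>"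

definition int_part :: "real \<Rightarrow> nat"
  where "int_part p = nat \<lfloor>p\<rfloor>"

definition branched_rough_path :: "real \<Rightarrow> real \<Rightarrow> (real \<Rightarrow> 'l forest \<Rightarrow> real) \<Rightarrow> bool"
  where "branched_rough_path p T X \<longleftrightarrow>
    rough_path_in (character_group (int_part p)) forest_deg (int_part p) p T X"

definition base_path :: "(real \<Rightarrow> 'd::finite forest \<Rightarrow> real) \<Rightarrow> real \<Rightarrow> real^'d"
  where "base_path X t = (\<chi> i. X t {#bullet i#})"


section \<open>Lipschitz one-forms\<close>

text \<open>\<open>nth_deriv h [v\<^sub>1, \<dots>, v\<^sub>k] x\<close> is \<open>D\<^sup>kh(x)\<close> applied to \<open>v\<^sub>1, \<dots>, v\<^sub>k\<close>.\<close>

primrec nth_deriv ::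
    "('a::real_normed_vector \<Rightarrow> 'b::real_normed_vector) \<Rightarrow> 'a list \<Rightarrow> 'a \<Rightarrow> 'b"
  where
    "nth_deriv h [] = h"
  | "nth_deriv h (v # vs) = (\<lambda>x. frechet_derivative (nth_deriv h vs) (at x) v)"

definition multi_norm ::
    "nat \<Rightarrow> ('a::real_normed_vector list \<Rightarrow> 'b::real_normed_vector) \<Rightarrow> ennreal"
  where "multi_norm k A =
    (SUP vs\<in>{vs. length vs = k \<and> (\<forall>v\<in>set vs. norm v \<le> 1)}. ennreal (norm (A vs)))"

definition strict_floor :: "real \<Rightarrow> nat"
  where "strict_floor \<gamma> = nat (\<lceil>\<gamma>\<rceil> - 1)"

definition lip_norm ::
    "real \<Rightarrow> ('a::real_normed_vector \<Rightarrow> 'b::real_normed_vector) \<Rightarrow> ennreal"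
  where "lip_norm \<gamma> h = (let n = strict_floor \<gamma> in
    (SUP k\<in>{..n}. SUP x. multi_norm k (\<lambda>vs. nth_deriv h vs x)) +
    (SUP (x, y)\<in>{(x, y). x \<noteq> y}.
      multi_norm n (\<lambda>vs. nth_deriv h vs x - nth_deriv h vs y) /
      ennreal (norm (x - y) powr (\<gamma> - n))))"

definition is_lip :: "real \<Rightarrow> ('a::real_normed_vector \<Rightarrow> 'b::real_normed_vector) \<Rightarrow> bool"
  where "is_lip \<gamma> h \<longleftrightarrow>
    (\<forall>vs x. length vs < strict_floor \<gamma> \<longrightarrow> nth_deriv h vs differentiable (at x)) \<and>
    lip_norm \<gamma> h < \<infinity>"

definition component ::
    "('a \<Rightarrow> ((real^'k::finite) \<Rightarrow>\<^sub>L 'b::real_normed_vector)) \<Rightarrow> 'k \<Rightarrow> 'a \<Rightarrow> 'b"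
  where "component f k x = blinfun_apply (f x) (axis k 1)"

definition part_deriv ::
    "(real^'d::finite \<Rightarrow> 'b::real_normed_vector) \<Rightarrow> 'd list \<Rightarrow> real^'d \<Rightarrow> 'b"
  where "part_deriv h is = nth_deriv h (map (\<lambda>i. axis i 1) is)"


section \<open>The first level integral along a branched rough path\<close>

text \<open>A tree of depth at most 2 is \<open>[\<bullet>\<^bsub>i\<^sub>1\<^esub> \<cdots> \<bullet>\<^bsub>i\<^sub>l\<^esub>]\<^sub>i\<close> with \<open>l \<ge> 0\<close>. Its leaves are unordered;
  the order chosen for them is irrelevant as mixed partial derivatives commute.\<close>

definition f_tree ::
    "(real^'d::finite \<Rightarrow> ((real^'d) \<Rightarrow>\<^sub>L (real^'e::finite))) \<Rightarrow> 'd rtree \<Rightarrow> real^'d \<Rightarrow> real^'e"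
  where "f_tree f \<tau> =
    (if tree_depth \<tau> > 2 then (\<lambda>x. 0)
     else part_deriv (component f (tree_label \<tau>))
       (SOME is. mset is = image_mset tree_label (branches \<tau>)))"

definition branched_approx ::
    "nat \<Rightarrow> (real \<Rightarrow> 'd::finite forest \<Rightarrow> real) \<Rightarrow> (real^'d \<Rightarrow> ((real^'d) \<Rightarrow>\<^sub>L (real^'e::finite))) \<Rightarrow>
     real \<Rightarrow> real \<Rightarrow> real^'e"
  where "branched_approx n X f u v =
    (\<Sum>\<tau> | tree_deg \<tau> \<le> n.
      (group_incr (character_group n) X u v {#\<tau>#} / real (tree_sigma \<tau>)) *\<^sub>R
      f_tree f \<tau> (base_path X u))"

definition has_branched_integral ::
    "real \<Rightarrow> (real \<Rightarrow> 'd::finite forest \<Rightarrow> real) \<Rightarrow> (real^'d \<Rightarrow> ((real^'d) \<Rightarrow>\<^sub>L (real^'e::finite))) \<Rightarrow>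
     real \<Rightarrow> real \<Rightarrow> real^'e \<Rightarrow> bool"
  where "has_branched_integral p X f s t I \<longleftrightarrow>
    (partition_sum (branched_approx (int_part p) X f) \<longlongrightarrow> I) (mesh_to_0 s t)"


section \<open>The Grossman--Larson algebra\<close>

text \<open>To speak of the vertices of a forest \<open>\<rho>\<close>, which is only a multiset, attach to each vertex an
  identifier such that all pairs (identifier, label) are distinct.\<close>

definition forest_vertices :: "'v rtree multiset \<Rightarrow> 'v set"
  where "forest_vertices N = (\<Union>\<tau>\<in>set_mset N. set_rtree \<tau>)"

definition distinguished :: "(nat \<times> 'l) forest \<Rightarrow> 'l forest \<Rightarrow> bool"
  where "distinguished N \<rho> \<longleftrightarrow>
    image_mset (map_rtree snd) N = \<rho> \<and> card (forest_vertices N) = forest_deg \<rho>"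

primrec attach :: "(nat \<times> 'l \<Rightarrow> 'l forest) \<Rightarrow> (nat \<times> 'l) rtree \<Rightarrow> 'l rtree"
  where "attach h (Node v N) = Node (snd v) (image_mset (attach h) N + h v)"

text \<open>\<open>\<phi>\<close> sends the position of each tree in the list \<open>\<tau>s\<close> to a vertex of \<open>N\<close>, or to
  \<open>None\<close>, the extra root.\<close>

definition graft ::
    "'l rtree list \<Rightarrow> (nat \<Rightarrow> (nat \<times> 'l) option) \<Rightarrow> (nat \<times> 'l) forest \<Rightarrow> 'l forest"
  where "graft \<tau>s \<phi> N = (let h = (\<lambda>x. {#\<tau>s ! k. k \<in># mset_set {k. k < length \<tau>s \<and> \<phi> k = x}#})
    in h None + image_mset (attach (\<lambda>v. h (Some v))) N)"

definition gl_forest :: "'l forest \<Rightarrow> 'l forest \<Rightarrow> 'l forest \<Rightarrow>\<^sub>0 real"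
  where "gl_forest \<rho>1 \<rho>2 =
    (let \<tau>s = (SOME \<tau>s. mset \<tau>s = \<rho>1); N = (SOME N. distinguished N \<rho>2)
     in \<Sum>\<phi>\<in>{..<length \<tau>s} \<rightarrow>\<^sub>E insert None (Some ` forest_vertices N).
          Poly_Mapping.single (graft \<tau>s \<phi> N) 1)"

definition pm_scale :: "real \<Rightarrow> ('a \<Rightarrow>\<^sub>0 real) \<Rightarrow> 'a \<Rightarrow>\<^sub>0 real"
  where "pm_scale c a = Poly_Mapping.map (\<lambda>r. c * r) a"

definition gl_mult :: "('l forest \<Rightarrow>\<^sub>0 real) \<Rightarrow> ('l forest \<Rightarrow>\<^sub>0 real) \<Rightarrow> 'l forest \<Rightarrow>\<^sub>0 real"
  where "gl_mult a b =
    (\<Sum>\<rho>1\<in>Poly_Mapping.keys a. \<Sum>\<rho>2\<in>Poly_Mapping.keys b.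
      pm_scale (Poly_Mapping.lookup a \<rho>1 * Poly_Mapping.lookup b \<rho>2) (gl_forest \<rho>1 \<rho>2))"

definition gl_word :: "'l rtree list \<Rightarrow> 'l forest \<Rightarrow>\<^sub>0 real"
  where "gl_word \<tau>s =
    foldr gl_mult (map (\<lambda>\<tau>. Poly_Mapping.single {#\<tau>#} 1) \<tau>s) (Poly_Mapping.single {#} 1)"

text \<open>The finitely supported functions on words over \<open>B\<close> are the free associative algebra on \<open>B\<close>;
  the map below is its canonical homomorphism to the Grossman--Larson algebra.\<close>

definition freely_generates_gl :: "'l rtree set \<Rightarrow> bool"
  where "freely_generates_gl B \<longleftrightarrow>
    bij_betw (\<lambda>c. \<Sum>w\<in>Poly_Mapping.keys c. pm_scale (Poly_Mapping.lookup c w) (gl_word w))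
      {c. Poly_Mapping.keys c \<subseteq> lists B} UNIV"


section \<open>\<open>\<Pi>\<close>-rough paths\<close>

text \<open>The letters \<open>{1, \<dots>, K}\<close> are a finite type \<open>'k\<close>, and \<open>\<nu>\<close> enumerates the generating trees.\<close>

fun shuffle_mset :: "'a list \<Rightarrow> 'a list \<Rightarrow> 'a list multiset"
  where
    "shuffle_mset [] ys = {#ys#}"
  | "shuffle_mset xs [] = {#xs#}"
  | "shuffle_mset (x # xs) (y # ys) =
       image_mset ((#) x) (shuffle_mset xs (y # ys)) + image_mset ((#) y) (shuffle_mset (x # xs) ys)"

definition word_deg :: "('k \<Rightarrow> 'l rtree) \<Rightarrow> 'k list \<Rightarrow> nat"
  where "word_deg \<nu> w = (\<Sum>k\<leftarrow>w. tree_deg (\<nu> k))"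

text \<open>Functions on words of degree at most \<open>n\<close> are extended by 0 to all words.\<close>

definition pi_group :: "('k \<Rightarrow> 'l rtree) \<Rightarrow> nat \<Rightarrow> ('k list \<Rightarrow> real) monoid"
  where "pi_group \<nu> n =
    \<lparr> carrier = {h. h [] = 1 \<and>
        (\<forall>w1 w2. word_deg \<nu> w1 + word_deg \<nu> w2 \<le> n \<longrightarrow>
           h w1 * h w2 = (\<Sum>w\<in>#shuffle_mset w1 w2. h w)) \<and>
        (\<forall>w. word_deg \<nu> w > n \<longrightarrow> h w = 0)},
      mult = (\<lambda>g h w. if word_deg \<nu> w \<le> n
        then (\<Sum>(u, v) | u @ v = w. g u * h v) else 0),
      one = (\<lambda>w. if w = [] then 1 else 0) \<rparr>"

definition pi_rough_path ::
    "('k \<Rightarrow> 'l rtree) \<Rightarrow> real \<Rightarrow> real \<Rightarrow> (real \<Rightarrow> 'k list \<Rightarrow> real) \<Rightarrow> bool"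
  where "pi_rough_path \<nu> p T Z \<longleftrightarrow>
    rough_path_in (pi_group \<nu> (int_part p)) (word_deg \<nu>) (int_part p) p T Z"

definition isomorphic_at ::
    "('k::finite \<Rightarrow> 'l::finite rtree) \<Rightarrow> nat \<Rightarrow> ('l forest \<Rightarrow> real) \<Rightarrow> ('k list \<Rightarrow> real) \<Rightarrow> bool"
  where "isomorphic_at \<nu> n a h \<longleftrightarrow>
    (\<Sum>\<rho> | forest_deg \<rho> \<le> n. Poly_Mapping.single \<rho> (a \<rho> / real (forest_sigma \<rho>))) =
    (\<Sum>w | word_deg \<nu> w \<le> n. pm_scale (h w) (gl_word (map \<nu> w)))"

definition isomorphic_pi_rough_path ::
    "('k::finite \<Rightarrow> 'l::finite rtree) \<Rightarrow> real \<Rightarrow> real \<Rightarrow> (real \<Rightarrow> 'l forest \<Rightarrow> real) \<Rightarrow>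
     (real \<Rightarrow> 'k list \<Rightarrow> real) \<Rightarrow> bool"
  where "isomorphic_pi_rough_path \<nu> p T X Z \<longleftrightarrow>
    pi_rough_path \<nu> p T Z \<and> (\<forall>t\<in>{0..T}. isomorphic_at \<nu> (int_part p) (X t) (Z t))"

text \<open>\<open>\<iota>\<close> is the inclusion of \<open>{1, \<dots>, d}\<close> in \<open>{1, \<dots>, K}\<close>, and \<open>x\<close> is the underlying path in
  \<open>\<real>\<^sup>d\<close>.\<close>

definition pi_approx ::
    "('k::finite \<Rightarrow> 'd::finite rtree) \<Rightarrow> ('d \<Rightarrow> 'k) \<Rightarrow> nat \<Rightarrow> (real \<Rightarrow> real^'d) \<Rightarrow>
     (real \<Rightarrow> 'k list \<Rightarrow> real) \<Rightarrow> (real^'d \<Rightarrow> ((real^'k) \<Rightarrow>\<^sub>L (real^'e::finite))) \<Rightarrow>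
     real \<Rightarrow> real \<Rightarrow> real^'e"
  where "pi_approx \<nu> \<iota> n x Z g u v =
    (\<Sum>k\<in>UNIV. \<Sum>l\<in>{0..n - tree_deg (\<nu> k)}. \<Sum>is | length is = l.
      group_incr (pi_group \<nu> n) Z u v (map \<iota> is @ [k]) *\<^sub>R part_deriv (component g k) is (x u))"

definition has_pi_integral ::
    "('k::finite \<Rightarrow> 'd::finite rtree) \<Rightarrow> ('d \<Rightarrow> 'k) \<Rightarrow> real \<Rightarrow> (real \<Rightarrow> real^'d) \<Rightarrow>
     (real \<Rightarrow> 'k list \<Rightarrow> real) \<Rightarrow> (real^'d \<Rightarrow> ((real^'k) \<Rightarrow>\<^sub>L (real^'e::finite))) \<Rightarrow>
     real \<Rightarrow> real \<Rightarrow> real^'e \<Rightarrow> bool"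
  where "has_pi_integral \<nu> \<iota> p x Z g s t I \<longleftrightarrow>
    (partition_sum (pi_approx \<nu> \<iota> (int_part p) x Z g) \<longlongrightarrow> I) (mesh_to_0 s t)"

end

theory Submission
  imports Defs
begin

text \<open>The two Riemann sums agree term by term. Grafting in the Grossman--Larson product never lowers the
  number of trees or the depth, so \<open>\<nu>\<^bsub>i\<^sub>1\<^esub> * \<cdots> * \<nu>\<^bsub>i\<^sub>m\<^esub>\<close> has a nonzero coefficient at a tree
  \<open>\<tau>\<close> of depth at most 2 only if all letters but the last are single vertices, which are then all
  grafted to the root of the last one. Hence the coordinates of \<open>X\<^sub>t\<close> at such \<open>\<tau>\<close> are sums of
  \<open>(Z\<^sub>t, i\<^sub>1 \<cdots> i\<^sub>l k)\<close>. Both sides satisfy the same Chen relation, because these trees are closed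
  under the coproduct, so by cancellation the increments correspond in the same way; as
  \<open>f\<^sub>\<tau>\<close> vanishes on deeper trees and partial derivatives commute, the sums coincide.

  The limit exists by the sewing lemma applied along \<open>Z\<close>: by Chen's relation the defect of additivity
  consists of Taylor remainders of the derivatives of \<open>f\<close>, since the shuffle relations turn
  \<open>\<Sum> (Z\<^bsub>s,u\<^esub>, i\<^sub>1 \<cdots> i\<^sub>q) D\<^bsub>i\<^sub>1 \<cdots> i\<^sub>q\<^esub>\<close> into the \<open>q\<close>-th Taylor term.\<close>

section \<open>Truncated characters of a graded bialgebra\<close>

text \<open>The hypothesis relates \<open>X\<close> and \<open>Z\<close> only at single times, while
  the Riemann sums contain increments. Carrying the relation through the full group law would
  require the duality between the Grossman--Larson product and the Connes--Kreimer coproduct.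
  Instead, only coordinates at forests of single vertices and at trees of depth at most 2 are
  compared, where both group laws take the same explicit form; the single-vertex forests enter as
  the left factors in the coproduct of such a tree. Cancelling the value at the left endpoint needs
  increments that are genuine group elements, so both groups are obtained as characters of a graded
  bialgebra.

  For the limit, let n be the integer part of p and \<kappa> the Hoelder exponent available at
  derivative order n - 1; then n + \<kappa> > p, and the defect of additivity has order n + \<kappa>
  in the norm of the increments. An exponent p' strictly between leaves room on both sides: p' > p
  yields a control that is small on short intervals, and p' < n + \<kappa> yields the sewing
  exponent (n + \<kappa>) / p' > 1.\<close>

lemma sum_mset_sum_mset:
  fixes f :: "'b \<Rightarrow> 'c::comm_monoid_add"
  shows "(\<Sum>z\<in>#(\<Sum>x\<in>#A. g x). f z) = (\<Sum>x\<in>#A. \<Sum>z\<in>#g x. f z)"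
  by (induction A) auto

lemma sum_mset_cong: "(\<And>x. x \<in># A \<Longrightarrow> f x = g x) \<Longrightarrow> (\<Sum>x\<in>#A. f x) = (\<Sum>x\<in>#A. g x)"
  by (simp cong: image_mset_cong)

lemma sum_mset_times_sum_mset:
  fixes f :: "'a \<Rightarrow> 'c::semiring_0"
  shows "(\<Sum>x\<in>#A. f x) * (\<Sum>y\<in>#B. g y) = (\<Sum>x\<in>#A. \<Sum>y\<in>#B. f x * g y)"
  by (simp add: sum_mset_distrib_left sum_mset_distrib_right sum_mset.swap[of _ A])

text \<open>Structure constants are natural numbers, so a product or coproduct is the multiset of
  its terms, and identities between them are tested against arbitrary real functions \<phi>. The
  counit conditions say that \<open>unit\<close> occurs in exactly one term on each side; as only
  \<open>unit\<close> has degree 0, every other term strictly lowers the degree, which drives the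
  inductions. The instances are forests under union and words under shuffle.\<close>

locale graded_bialgebra =
  fixes deg :: "'i \<Rightarrow> nat"
    and unit :: 'i
    and prod :: "'i \<Rightarrow> 'i \<Rightarrow> 'i multiset"
    and cop :: "'i \<Rightarrow> ('i \<times> 'i) multiset"
  assumes deg_eq_0: "deg x = 0 \<longleftrightarrow> x = unit"
    and deg_prod: "z \<in># prod x y \<Longrightarrow> deg z = deg x + deg y"
    and deg_cop: "q \<in># cop x \<Longrightarrow> deg (fst q) + deg (snd q) = deg x"
    and prod_unit: "prod unit unit = {#unit#}"
    and counit_left: "filter_mset (\<lambda>q. fst q = unit) (cop x) = {#(unit, x)#}"
    and counit_right: "filter_mset (\<lambda>q. snd q = unit) (cop x) = {#(x, unit)#}"
    and coassoc: "\<And>\<phi> :: 'i \<Rightarrow> 'i \<Rightarrow> 'i \<Rightarrow> real.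
      (\<Sum>q\<in>#cop x. \<Sum>r\<in>#cop (fst q). \<phi> (fst r) (snd r) (snd q)) =
      (\<Sum>q\<in>#cop x. \<Sum>r\<in>#cop (snd q). \<phi> (fst q) (fst r) (snd r))"
    and cop_prod: "\<And>\<phi> :: 'i \<Rightarrow> 'i \<Rightarrow> real.
      (\<Sum>z\<in>#prod x y. \<Sum>q\<in>#cop z. \<phi> (fst q) (snd q)) =
      (\<Sum>q\<in>#cop x. \<Sum>r\<in>#cop y.
        \<Sum>u\<in>#prod (fst q) (fst r). \<Sum>v\<in>#prod (snd q) (snd r). \<phi> u v)"
begin

definition characters :: "nat \<Rightarrow> ('i \<Rightarrow> real) monoid"
  where "characters n =
    \<lparr> carrier = {a. a unit = 1 \<and>
        (\<forall>x y. deg x + deg y \<le> n \<longrightarrow> (\<Sum>z\<in>#prod x y. a z) = a x * a y) \<and>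
        (\<forall>x. deg x > n \<longrightarrow> a x = 0)},
      mult = (\<lambda>a b x. if deg x \<le> n then (\<Sum>q\<in>#cop x. a (fst q) * b (snd q)) else 0),
      one = (\<lambda>x. if x = unit then 1 else 0) \<rparr>"

lemma cop_split_left:
  obtains R where "cop x = add_mset (unit, x) R" "\<And>q. q \<in># R \<Longrightarrow> deg (snd q) < deg x"
proof
  let ?R = "filter_mset (\<lambda>q. fst q \<noteq> unit) (cop x)"
  show "cop x = add_mset (unit, x) ?R"
    using multiset_partition[of "cop x" "\<lambda>q. fst q = unit"] counit_left[of x] by simp
  show "deg (snd q) < deg x" if "q \<in># ?R" for q
    using that deg_cop[of q x] deg_eq_0[of "fst q"] by auto
qed

lemma cop_split_right:
  obtains R where "cop x = add_mset (x, unit) R" "\<And>q. q \<in># R \<Longrightarrow> deg (fst q) < deg x"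
proof
  let ?R = "filter_mset (\<lambda>q. snd q \<noteq> unit) (cop x)"
  show "cop x = add_mset (x, unit) ?R"
    using multiset_partition[of "cop x" "\<lambda>q. snd q = unit"] counit_right[of x] by simp
  show "deg (fst q) < deg x" if "q \<in># ?R" for q
    using that deg_cop[of q x] deg_eq_0[of "snd q"] by auto
qed

lemma deg_unit [simp]: "deg unit = 0"
  by (simp add: deg_eq_0)

lemma deg_cop_le: "q \<in># cop x \<Longrightarrow> deg (fst q) \<le> deg x" "q \<in># cop x \<Longrightarrow> deg (snd q) \<le> deg x"
  by (metis deg_cop le_add1) (metis deg_cop le_add2)

lemma cop_unit: "cop unit = {#(unit, unit)#}"
proof -
  obtain R where R: "cop unit = add_mset (unit, unit) R" "\<And>q. q \<in># R \<Longrightarrow> deg (snd q) < deg unit"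
    by (rule cop_split_left) blast
  then have "R = {#}"
    using multiset_nonemptyE by fastforce
  with R show ?thesis by simp
qed

text \<open>The equation at \<open>x\<close> contains \<open>b x\<close> only in the term
  \<open>(x, unit)\<close>, with coefficient \<open>a unit\<close> = 1; all other left factors have
  smaller degree. So \<open>b\<close> is found degree by degree, and it is cut off above
  \<open>k\<close> to fit the truncation.\<close>

lemma left_inverse_upto:
  fixes a :: "'i \<Rightarrow> real"
  assumes "a unit = 1"
  shows "\<exists>b. (\<forall>x. k < deg x \<longrightarrow> b x = 0) \<and>
    (\<forall>x. deg x \<le> k \<longrightarrow> (\<Sum>q\<in>#cop x. b (fst q) * a (snd q)) = (if x = unit then 1 else 0))"
proof (induction k)
  case 0
  show ?case
    by (rule exI[of _ "\<lambda>x. if x = unit then 1 else 0"])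
      (auto simp: deg_eq_0 cop_unit assms)
next
  case (Suc k)
  then obtain b where b: "\<And>x. k < deg x \<Longrightarrow> b x = 0"
    "\<And>x. deg x \<le> k \<Longrightarrow> (\<Sum>q\<in>#cop x. b (fst q) * a (snd q)) = (if x = unit then 1 else 0)"
    by blast
  \<comment> \<open>Since \<open>b\<close> vanishes in degree \<open>Suc k\<close>, the sum is the
    left side of the equation at \<open>x\<close> without the contribution of the unknown value; its
    negative is that value.\<close>
  define c where "c x = (if deg x = Suc k then - (\<Sum>q\<in>#cop x. b (fst q) * a (snd q)) else b x)" for x
  have "(\<Sum>q\<in>#cop x. c (fst q) * a (snd q)) = (if x = unit then 1 else 0)" if le: "deg x \<le> Suc k" for x
  proof -
    obtain R where R: "cop x = add_mset (x, unit) R" "\<And>q. q \<in># R \<Longrightarrow> deg (fst q) < deg x"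
      by (rule cop_split_right) blast
    have eq: "(\<Sum>q\<in>#R. c (fst q) * a (snd q)) = (\<Sum>q\<in>#R. b (fst q) * a (snd q))"
      by (intro sum_mset_cong)
        (use R(2) le in \<open>fastforce simp: c_def\<close>)
    show ?thesis
    proof (cases "deg x = Suc k")
      case True
      then have "x \<noteq> unit" by auto
      moreover have "b x = 0" using True b(1) by simp
      ultimately show ?thesis
        using True assms by (simp add: R(1) eq) (simp add: c_def R(1))
    next
      case False
      then have "deg x \<le> k" using le by simp
      then show ?thesis
        using b(2)[of x] False by (simp add: R(1) eq) (auto simp: c_def)
    qed
  qed
  moreover have "c x = 0" if "Suc k < deg x" for x
    using that b(1) by (simp add: c_def)
  ultimately show ?case by blast
qed

text \<open>On pairs, both \<open>b\<close> composed with the product and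
  \<open>b \<otimes> b\<close> are left convolution inverses of \<open>a \<otimes> a\<close>, so
  their difference convolved with \<open>a \<otimes> a\<close> is zero. By induction on the total
  degree only the difference at \<open>(x, y)\<close> itself survives in that convolution.\<close>

lemma left_inverse_multiplicative:
  assumes a: "a \<in> carrier (characters n)"
    and b: "\<And>x. deg x \<le> n \<Longrightarrow> (\<Sum>q\<in>#cop x. b (fst q) * a (snd q)) = (if x = unit then 1 else (0::real))"
  shows "deg x + deg y \<le> n \<Longrightarrow> (\<Sum>z\<in>#prod x y. b z) = b x * b y"
proof (induction "deg x + deg y" arbitrary: x y rule: less_induct)
  case less
  have a1: "a unit = 1" and am: "\<And>x y. deg x + deg y \<le> n \<Longrightarrow> (\<Sum>z\<in>#prod x y. a z) = a x * a y"
    using a by (auto simp: characters_def)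
  have b1: "b unit = 1"
    using b[of unit] by (simp add: cop_unit a1)
  show ?case
  proof (cases "x = unit \<and> y = unit")
    case True
    then show ?thesis by (simp add: prod_unit b1)
  next
    case False
    then have nz: "deg x + deg y \<noteq> 0" by (auto simp: deg_eq_0)
    define D where "D u v = (\<Sum>z\<in>#prod u v. b z) - b u * b v" for u v
    have "(\<Sum>z\<in>#prod x y. \<Sum>q\<in>#cop z. b (fst q) * a (snd q)) = (\<Sum>z\<in>#prod x y. 0)"
    proof (intro sum_mset_cong)
      fix z assume "z \<in># prod x y"
      then show "(\<Sum>q\<in>#cop z. b (fst q) * a (snd q)) = 0"
        using b[of z] deg_prod[of z x y] less.prems nz by auto
    qed
    then have "0 = (\<Sum>q\<in>#cop x. \<Sum>r\<in>#cop y.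
        \<Sum>u\<in>#prod (fst q) (fst r). \<Sum>v\<in>#prod (snd q) (snd r). b u * a v)"
      by (simp add: cop_prod[where \<phi> = "\<lambda>u v. b u * a v"])
    also have "\<dots> = (\<Sum>q\<in>#cop x. \<Sum>r\<in>#cop y. (\<Sum>u\<in>#prod (fst q) (fst r). b u) * (a (snd q) * a (snd r)))"
    proof (intro sum_mset_cong)
      fix q r assume "q \<in># cop x" "r \<in># cop y"
      then have "(\<Sum>v\<in>#prod (snd q) (snd r). a v) = a (snd q) * a (snd r)"
        using deg_cop less.prems by (intro am) (metis add_le_mono le_add2 order_trans)
      then show "(\<Sum>u\<in>#prod (fst q) (fst r). \<Sum>v\<in>#prod (snd q) (snd r). b u * a v) =
          (\<Sum>u\<in>#prod (fst q) (fst r). b u) * (a (snd q) * a (snd r))"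
        by (simp only: sum_mset_times_sum_mset[symmetric])
    qed
    \<comment> \<open>The part with \<open>b (fst q) * b (fst r)\<close> factors into the inverse
      equations at \<open>x\<close> and at \<open>y\<close>, and one of them is 0 because
      \<open>x\<close> and \<open>y\<close> are not both \<open>unit\<close>.\<close>
    also have "\<dots> = (\<Sum>q\<in>#cop x. \<Sum>r\<in>#cop y. D (fst q) (fst r) * (a (snd q) * a (snd r))) +
        (\<Sum>q\<in>#cop x. b (fst q) * a (snd q)) * (\<Sum>r\<in>#cop y. b (fst r) * a (snd r))"
      unfolding sum_mset_times_sum_mset
      by (simp add: D_def algebra_simps flip: sum_mset.distrib)
    also have "(\<Sum>q\<in>#cop x. b (fst q) * a (snd q)) * (\<Sum>r\<in>#cop y. b (fst r) * a (snd r)) = 0"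
      using b[of x] b[of y] False less.prems by auto
    finally have sum0: "(\<Sum>q\<in>#cop x. \<Sum>r\<in>#cop y. D (fst q) (fst r) * (a (snd q) * a (snd r))) = 0"
      by simp
    obtain R where R: "cop x = add_mset (x, unit) R" "\<And>q. q \<in># R \<Longrightarrow> deg (fst q) < deg x"
      by (rule cop_split_right) blast
    obtain S where S: "cop y = add_mset (y, unit) S" "\<And>q. q \<in># S \<Longrightarrow> deg (fst q) < deg y"
      by (rule cop_split_right) blast
    have D0: "D u v = 0" if "deg u \<le> deg x" "deg v \<le> deg y" "deg u < deg x \<or> deg v < deg y" for u v
      using less.hyps[of u v] that less.prems by (auto simp: D_def)
    have "(\<Sum>r\<in>#S. D x (fst r) * a (snd r)) = (\<Sum>r\<in>#S. 0)"
      by (intro sum_mset_cong)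
        (use D0 S(2) in \<open>simp add: less_imp_le\<close>)
    moreover have "(\<Sum>q\<in>#R. \<Sum>r\<in>#cop y. D (fst q) (fst r) * (a (snd q) * a (snd r))) = (\<Sum>q\<in>#R. \<Sum>r\<in>#cop y. 0)"
    proof (intro sum_mset_cong)
      fix q r assume "q \<in># R" "r \<in># cop y"
      then have "deg (fst q) < deg x" "deg (fst r) \<le> deg y"
        using R(2) deg_cop by (auto simp: S(1)) (metis S(2) less_imp_le fst_conv snd_conv prod.collapse)
      then show "D (fst q) (fst r) * (a (snd q) * a (snd r)) = 0"
        using D0 by simp
    qed
    ultimately have "D x y = 0"
      using sum0 by (simp add: R(1) a1) (simp add: S(1) a1)
    then show ?thesis by (simp add: D_def)
  qed
qed

text \<open>Compatibility of coproduct and product gives closure, coassociativity gives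
  associativity, and left inverses suffice. Truncation does no harm, since both factors of a term of
  \<open>cop x\<close> have degree at most \<open>deg x\<close>.\<close>

theorem group_characters: "group (characters n)"
proof (rule groupI)
  show "\<one>\<^bsub>characters n\<^esub> \<in> carrier (characters n)"
  proof -
    have "(\<Sum>z\<in>#prod x y. if z = unit then 1 else 0::real) =
        (if x = unit then 1 else 0) * (if y = unit then 1 else 0)" for x y
    proof (cases "x = unit \<and> y = unit")
      case True
      then show ?thesis by (simp add: prod_unit)
    next
      case False
      have "(\<Sum>z\<in>#prod x y. if z = unit then 1 else 0::real) = (\<Sum>z\<in>#prod x y. 0)"
      proof (intro sum_mset_cong)
        fix z assume "z \<in># prod x y"
        then have "deg z \<noteq> 0"
          using False deg_prod[of z x y] by (auto simp: deg_eq_0)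
        then show "(if z = unit then 1 else 0) = (0::real)" by auto
      qed
      then show ?thesis using False by auto
    qed
    then show ?thesis by (auto simp: characters_def)
  qed
next
  fix a b assume "a \<in> carrier (characters n)" "b \<in> carrier (characters n)"
  then have a: "a unit = 1" "\<And>x y. deg x + deg y \<le> n \<Longrightarrow> (\<Sum>z\<in>#prod x y. a z) = a x * a y"
    and b: "b unit = 1" "\<And>x y. deg x + deg y \<le> n \<Longrightarrow> (\<Sum>z\<in>#prod x y. b z) = b x * b y"
    by (auto simp: characters_def)
  have "(\<Sum>z\<in>#prod x y. if deg z \<le> n then \<Sum>q\<in>#cop z. a (fst q) * b (snd q) else 0) =
      (\<Sum>q\<in>#cop x. a (fst q) * b (snd q)) * (\<Sum>q\<in>#cop y. a (fst q) * b (snd q))"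
    if le: "deg x + deg y \<le> n" for x y
  proof -
    have "(\<Sum>z\<in>#prod x y. if deg z \<le> n then \<Sum>q\<in>#cop z. a (fst q) * b (snd q) else 0) =
        (\<Sum>z\<in>#prod x y. \<Sum>q\<in>#cop z. a (fst q) * b (snd q))"
      by (intro sum_mset_cong) (use le deg_prod in auto)
    also have "\<dots> = (\<Sum>q\<in>#cop x. \<Sum>r\<in>#cop y. (a (fst q) * b (snd q)) * (a (fst r) * b (snd r)))"
      unfolding cop_prod[where \<phi> = "\<lambda>u v. a u * b v"]
    proof (intro sum_mset_cong)
      fix q r assume "q \<in># cop x" "r \<in># cop y"
      then have "(\<Sum>u\<in>#prod (fst q) (fst r). a u) = a (fst q) * a (fst r)"
        "(\<Sum>v\<in>#prod (snd q) (snd r). b v) = b (snd q) * b (snd r)"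
        using deg_cop[of q x] deg_cop[of r y] le by (intro a(2) b(2); linarith)+
      then show "(\<Sum>u\<in>#prod (fst q) (fst r). \<Sum>v\<in>#prod (snd q) (snd r). a u * b v) =
          (a (fst q) * b (snd q)) * (a (fst r) * b (snd r))"
        by (simp only: sum_mset_times_sum_mset[symmetric]) (simp add: mult_ac)
    qed
    finally show ?thesis by (simp add: sum_mset_times_sum_mset)
  qed
  then show "a \<otimes>\<^bsub>characters n\<^esub> b \<in> carrier (characters n)"
    using a(1) b(1) by (auto simp: characters_def cop_unit)
next
  fix a b c :: "'i \<Rightarrow> real"
  have "(\<Sum>q\<in>#cop x. (if deg (fst q) \<le> n then \<Sum>r\<in>#cop (fst q). a (fst r) * b (snd r) else 0) * c (snd q)) =
      (\<Sum>q\<in>#cop x. a (fst q) * (if deg (snd q) \<le> n then \<Sum>r\<in>#cop (snd q). b (fst r) * c (snd r) else 0))"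
    (is "?L = ?R") if "deg x \<le> n" for x
  proof -
    have "?L = (\<Sum>q\<in>#cop x. \<Sum>r\<in>#cop (fst q). a (fst r) * b (snd r) * c (snd q))"
      by (intro sum_mset_cong)
        (use that deg_cop_le(1)[of _ x] in \<open>auto simp: sum_mset_distrib_right dest: order_trans\<close>)
    also have "\<dots> = (\<Sum>q\<in>#cop x. \<Sum>r\<in>#cop (snd q). a (fst q) * b (fst r) * c (snd r))"
      by (rule coassoc[where \<phi> = "\<lambda>u v w. a u * b v * c w"])
    also have "\<dots> = ?R"
      by (intro sum_mset_cong)
        (use that deg_cop_le(2)[of _ x] in \<open>auto simp: sum_mset_distrib_left mult.assoc dest: order_trans\<close>)
    finally show ?thesis .
  qed
  then show "a \<otimes>\<^bsub>characters n\<^esub> b \<otimes>\<^bsub>characters n\<^esub> c = a \<otimes>\<^bsub>characters n\<^esub> (b \<otimes>\<^bsub>characters n\<^esub> c)"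
    by (auto simp: characters_def)
next
  fix a assume a: "a \<in> carrier (characters n)"
  have "(\<Sum>q\<in>#cop x. (if fst q = unit then 1 else 0) * a (snd q)) = a x" for x
  proof -
    obtain R where R: "cop x = add_mset (unit, x) R" "\<And>q. q \<in># R \<Longrightarrow> deg (snd q) < deg x"
      by (rule cop_split_left) blast
    have "fst q \<noteq> unit" if "q \<in># R" for q
      using R(2)[OF that] deg_cop[of q x] that deg_unit by (cases "fst q = unit") (simp_all add: R(1))
    then have "(\<Sum>q\<in>#R. (if fst q = unit then 1 else 0) * a (snd q)) = (\<Sum>q\<in>#R. 0)"
      by (intro sum_mset_cong) auto
    then show ?thesis by (simp add: R(1))
  qed
  with a show "\<one>\<^bsub>characters n\<^esub> \<otimes>\<^bsub>characters n\<^esub> a = a"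
    by (auto simp: characters_def)
  obtain b where b: "\<And>x. n < deg x \<Longrightarrow> b x = 0"
    "\<And>x. deg x \<le> n \<Longrightarrow> (\<Sum>q\<in>#cop x. b (fst q) * a (snd q)) = (if x = unit then 1 else (0::real))"
    using left_inverse_upto[of a n] a by (auto simp: characters_def)
  have "b unit = 1"
    using b(2)[of unit] a by (simp add: characters_def cop_unit)
  then have "b \<in> carrier (characters n)"
    using b(1) left_inverse_multiplicative[OF a b(2)] by (simp add: characters_def)
  moreover have "b \<otimes>\<^bsub>characters n\<^esub> a = \<one>\<^bsub>characters n\<^esub>"
    using b(2) by (auto simp: characters_def)
  ultimately show "\<exists>b\<in>carrier (characters n). b \<otimes>\<^bsub>characters n\<^esub> a = \<one>\<^bsub>characters n\<^esub>"
    by blast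
qed

end

section \<open>Forests and words\<close>

text \<open>Condenses the nested recursion of trees and forests into one induction on forests:
  \<open>tree\<close> passes from \<rho> to [\<rho>]_i, as the recursion of the coproduct does, and
  \<open>union\<close> suits statements that are multiplicative in the forest.\<close>

lemma forest_induct [case_names empty tree union]:
  assumes "P {#}" and "\<And>i \<rho>. P \<rho> \<Longrightarrow> P {#Node i \<rho>#}" and "\<And>\<rho> \<rho>'. P \<rho> \<Longrightarrow> P \<rho>' \<Longrightarrow> P (\<rho> + \<rho>')"
  shows "P \<rho>"
proof -
  have step: "P \<rho>" if "\<And>\<tau>. \<tau> \<in># \<rho> \<Longrightarrow> P {#\<tau>#}" for \<rho>
    using that
  proof (induction \<rho>)
    case (add \<tau> \<rho>)
    then have "P ({#\<tau>#} + \<rho>)"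
      by (intro assms(3)) auto
    then show ?case by simp
  qed (rule assms(1))
  have "P {#\<tau>#}" for \<tau>
    by (induction \<tau>) (use assms(2) step in blast)
  then show ?thesis
    using step by blast
qed

lemma forest_deg_simps [simp]:
  "forest_deg {#} = 0"
  "forest_deg {#\<tau>#} = tree_deg \<tau>"
  "forest_deg (\<rho> + \<rho>') = forest_deg \<rho> + forest_deg \<rho>'"
  "forest_deg (add_mset \<tau> \<rho>) = tree_deg \<tau> + forest_deg \<rho>"
  by (simp_all add: forest_deg_def)

lemma tree_deg_Node: "tree_deg (Node i \<rho>) = Suc (forest_deg \<rho>)"
  by (simp add: forest_deg_def)

lemma tree_deg_pos [simp]: "0 < tree_deg \<tau>"
  by (cases \<tau>) simp

lemma forest_deg_eq_0: "forest_deg \<rho> = 0 \<longleftrightarrow> \<rho> = {#}"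
  by (cases \<rho>) simp_all

section \<open>The Connes--Kreimer coproduct as a graded bialgebra\<close>

lemma sum_tensor_mult:
  fixes \<phi> :: "'l forest \<times> 'l forest \<Rightarrow> 'b::comm_monoid_add"
  shows "(\<Sum>q\<in>#tensor_mult A B. \<phi> q) = (\<Sum>q\<in>#A. \<Sum>r\<in>#B. \<phi> (fst q + fst r, snd q + snd r))"
  by (simp add: tensor_mult_def sum_mset_sum_mset multiset.map_comp comp_def)

lemma forest_coproduct_tree:
  "forest_coproduct {#Node i \<rho>#} =
    add_mset ({#Node i \<rho>#}, {#}) (image_mset (\<lambda>q. (fst q, {#Node i (snd q)#})) (forest_coproduct \<rho>))"
proof -
  have "forest_coproduct {#Node i \<rho>#} = tensor_mult (tree_coproduct (Node i \<rho>)) {#({#}, {#})#}"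
    by (simp add: forest_coproduct_def)
  also have "\<dots> = tree_coproduct (Node i \<rho>)"
    by (metis tensor_mult_commute tensor_mult_one)
  finally show ?thesis
    by (simp add: tree_coproduct_Node case_prod_unfold del: tree_coproduct.simps)
qed

text \<open>Each case changes \<phi>, hence its generality: a new root is absorbed into the last
  slot, and for a union the variables of one factor are parameters in the identity for the
  other.\<close>

lemma forest_coproduct_coassoc:
  fixes \<phi> :: "'l forest \<Rightarrow> 'l forest \<Rightarrow> 'l forest \<Rightarrow> 'b::comm_monoid_add"
  shows "(\<Sum>q\<in>#forest_coproduct \<rho>. \<Sum>r\<in>#forest_coproduct (fst q). \<phi> (fst r) (snd r) (snd q)) =
      (\<Sum>q\<in>#forest_coproduct \<rho>. \<Sum>r\<in>#forest_coproduct (snd q). \<phi> (fst q) (fst r) (snd r))"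
proof (induction \<rho> arbitrary: \<phi> rule: forest_induct)
  case empty
  show ?case by (simp add: forest_coproduct_empty)
next
  case (tree i \<rho>)
  show ?case
    using tree[of "\<lambda>u v w. \<phi> u v {#Node i w#}"]
    by (simp add: forest_coproduct_tree forest_coproduct_empty multiset.map_comp comp_def
        sum_mset.distrib add_ac)
next
  case (union \<rho> \<rho>')
  let ?C = forest_coproduct
  have "(\<Sum>q\<in>#?C (\<rho> + \<rho>'). \<Sum>r\<in>#?C (fst q). \<phi> (fst r) (snd r) (snd q)) =
      (\<Sum>q\<in>#?C \<rho>. \<Sum>q'\<in>#?C \<rho>'. \<Sum>r\<in>#?C (fst q). \<Sum>r'\<in>#?C (fst q').
        \<phi> (fst r + fst r') (snd r + snd r') (snd q + snd q'))"
    by (simp add: forest_coproduct_union sum_tensor_mult)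
  also have "\<dots> = (\<Sum>q\<in>#?C \<rho>. \<Sum>r\<in>#?C (fst q). \<Sum>q'\<in>#?C \<rho>'. \<Sum>r'\<in>#?C (fst q').
        \<phi> (fst r + fst r') (snd r + snd r') (snd q + snd q'))"
    by (subst sum_mset.swap[of _ "?C \<rho>'"]) (rule refl)
  also have "\<dots> = (\<Sum>q\<in>#?C \<rho>. \<Sum>r\<in>#?C (fst q). \<Sum>q'\<in>#?C \<rho>'. \<Sum>r'\<in>#?C (snd q').
        \<phi> (fst r + fst q') (snd r + fst r') (snd q + snd r'))"
    by (simp only: union(2)[of "\<lambda>u v w. \<phi> (fst r + u) (snd r + v) (snd q + w)" for r q])
  also have "\<dots> = (\<Sum>q\<in>#?C \<rho>. \<Sum>r\<in>#?C (snd q). \<Sum>q'\<in>#?C \<rho>'. \<Sum>r'\<in>#?C (snd q').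
        \<phi> (fst q + fst q') (fst r + fst r') (snd r + snd r'))"
    by (rule union(1)[of "\<lambda>u v w. \<Sum>q'\<in>#?C \<rho>'. \<Sum>r'\<in>#?C (snd q').
        \<phi> (u + fst q') (v + fst r') (w + snd r')"])
  also have "\<dots> = (\<Sum>q\<in>#?C \<rho>. \<Sum>q'\<in>#?C \<rho>'. \<Sum>r\<in>#?C (snd q). \<Sum>r'\<in>#?C (snd q').
        \<phi> (fst q + fst q') (fst r + fst r') (snd r + snd r'))"
    by (subst sum_mset.swap[of _ "?C \<rho>'"]) (rule refl)
  finally show ?case
    by (simp add: forest_coproduct_union sum_tensor_mult)
qed

text \<open>Meant for the counit: a union of forests is empty only if both are, so emptiness of a
  component is such a multiplicative predicate.\<close>

lemma filter_tensor_mult: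
  assumes "\<And>q r. P (fst q + fst r, snd q + snd r) \<longleftrightarrow> P q \<and> P r"
  shows "filter_mset P (tensor_mult A B) = tensor_mult (filter_mset P A) (filter_mset P B)"
proof (induction A)
  case (add a A)
  have "filter_mset P (image_mset ((+) a) B) = (if P a then image_mset ((+) a) (filter_mset P B) else {#})"
    using assms[of a] by (induction B) (auto simp: plus_prod_def)
  then show ?case
    using add by (simp add: tensor_mult_simps)
qed (simp add: tensor_mult_simps)

lemma forest_coproduct_counit:
  "filter_mset (\<lambda>q. fst q = {#}) (forest_coproduct \<rho>) = {#({#}, \<rho>)#}"
  "filter_mset (\<lambda>q. snd q = {#}) (forest_coproduct \<rho>) = {#(\<rho>, {#})#}"
proof (induction \<rho> rule: forest_induct)
  case empty
  show "filter_mset (\<lambda>q. fst q = {#}) (forest_coproduct {#}) = {#({#}, {#})#}"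
    "filter_mset (\<lambda>q. snd q = {#}) (forest_coproduct {#}) = {#({#}, {#})#}"
    by (simp_all add: forest_coproduct_empty)
next
  case (tree i \<rho>)
  then show "filter_mset (\<lambda>q. fst q = {#}) (forest_coproduct {#Node i \<rho>#}) = {#({#}, {#Node i \<rho>#})#}"
    "filter_mset (\<lambda>q. snd q = {#}) (forest_coproduct {#Node i \<rho>#}) = {#({#Node i \<rho>#}, {#})#}"
    by (simp_all add: forest_coproduct_tree filter_mset_image_mset)
next
  case (union \<rho> \<rho>')
  then show "filter_mset (\<lambda>q. fst q = {#}) (forest_coproduct (\<rho> + \<rho>')) = {#({#}, \<rho> + \<rho>')#}"
    "filter_mset (\<lambda>q. snd q = {#}) (forest_coproduct (\<rho> + \<rho>')) = {#(\<rho> + \<rho>', {#})#}"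
    by (simp_all add: forest_coproduct_union filter_tensor_mult) (simp_all add: tensor_mult_def)
qed

lemma forest_coproduct_deg:
  "q \<in># forest_coproduct \<rho> \<Longrightarrow> forest_deg (fst q) + forest_deg (snd q) = forest_deg \<rho>"
proof (induction \<rho> arbitrary: q rule: forest_induct)
  case (tree i \<rho>)
  then show ?case
    by (auto simp: forest_coproduct_tree tree_deg_Node simp del: tree_deg.simps)
next
  case (union \<rho> \<rho>')
  from union.prems show ?case
    by (auto simp: forest_coproduct_union tensor_mult_def dest!: union.IH)
qed (simp add: forest_coproduct_empty)

lemma graded_bialgebra_forests:
  "graded_bialgebra forest_deg ({#} :: 'l forest) (\<lambda>\<rho> \<rho>'. {#\<rho> + \<rho>'#}) forest_coproduct"
proof
  fix \<rho> \<rho>' :: "'l forest" and \<phi> :: "'l forest \<Rightarrow> 'l forest \<Rightarrow> real"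
  show "(\<Sum>z\<in>#{#\<rho> + \<rho>'#}. \<Sum>q\<in>#forest_coproduct z. \<phi> (fst q) (snd q)) =
      (\<Sum>q\<in>#forest_coproduct \<rho>. \<Sum>r\<in>#forest_coproduct \<rho>'.
        \<Sum>u\<in>#{#fst q + fst r#}. \<Sum>v\<in>#{#snd q + snd r#}. \<phi> u v)"
    by (simp add: forest_coproduct_union sum_tensor_mult)
qed (simp add: forest_deg_eq_0, simp, erule forest_coproduct_deg, simp,
    rule forest_coproduct_counit, rule forest_coproduct_counit, rule forest_coproduct_coassoc)

lemma group_character_group: "group (character_group n :: ('l forest \<Rightarrow> real) monoid)"
proof -
  have "(character_group n :: ('l forest \<Rightarrow> real) monoid) =
      graded_bialgebra.characters forest_deg {#} (\<lambda>\<rho> \<rho>'. {#\<rho> + \<rho>'#}) forest_coproduct n"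
    unfolding graded_bialgebra.characters_def[OF graded_bialgebra_forests] character_group_def
    by (simp only: case_prod_unfold image_mset_single sum_mset.singleton)
  then show ?thesis
    using graded_bialgebra.group_characters[OF graded_bialgebra_forests, of n] by metis
qed

section \<open>The shuffle algebra of words with deconcatenation\<close>

primrec deconcat :: "'a list \<Rightarrow> ('a list \<times> 'a list) multiset"
  where
    "deconcat [] = {#([], [])#}"
  | "deconcat (x # w) = add_mset ([], x # w) (image_mset (\<lambda>q. (x # fst q, snd q)) (deconcat w))"

lemma splits_Cons:
  "{q. fst q @ snd q = x # w} = insert ([], x # w) ((\<lambda>q. (x # fst q, snd q)) ` {q. fst q @ snd q = w})"
proof (intro Set.set_eqI iffI)
  fix q assume "q \<in> {q. fst q @ snd q = x # w}"
  then show "q \<in> insert ([], x # w) ((\<lambda>q. (x # fst q, snd q)) ` {q. fst q @ snd q = w})"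
    by (cases q; cases "fst q") (auto simp: image_iff)
qed auto

lemma finite_splits: "finite {q. fst q @ snd q = w}"
proof (induction w)
  case Nil
  have "{q. fst q @ snd q = []} \<subseteq> {([], [])}" by auto
  then show ?case by (rule finite_subset) simp
qed (simp add: splits_Cons)

text \<open>\<open>pi_group\<close> sums over the set of splittings, the bialgebra over a multiset.
  They agree because a splitting is determined by its prefix and so is listed only once.\<close>

lemma sum_deconcat:
  fixes \<phi> :: "'a list \<Rightarrow> 'a list \<Rightarrow> 'b::comm_monoid_add"
  shows "(\<Sum>(u, v) | u @ v = w. \<phi> u v) = (\<Sum>q\<in>#deconcat w. \<phi> (fst q) (snd q))"
proof -
  have "(\<Sum>q | fst q @ snd q = w. \<phi> (fst q) (snd q)) = (\<Sum>q\<in>#deconcat w. \<phi> (fst q) (snd q))"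
  proof (induction w arbitrary: \<phi>)
    case Nil
    have "{q. fst q @ snd q = []} = {([]::'a list, [])}" by auto
    then show ?case by (simp only: deconcat.simps) simp
  next
    case (Cons x w)
    have inj: "inj_on (\<lambda>q. (x # fst q, snd q)) {q. fst q @ snd q = w}"
      by (auto simp: inj_on_def prod_eq_iff)
    have "(\<Sum>q | fst q @ snd q = x # w. \<phi> (fst q) (snd q)) =
        \<phi> [] (x # w) + (\<Sum>q | fst q @ snd q = w. \<phi> (x # fst q) (snd q))"
      unfolding splits_Cons using finite_splits[of w]
      by (subst sum.insert) (auto simp: sum.reindex[OF inj])
    also have "\<dots> = (\<Sum>q\<in>#deconcat (x # w). \<phi> (fst q) (snd q))"
      unfolding Cons.IH[of "\<lambda>u v. \<phi> (x # u) v"] by (simp add: multiset.map_comp comp_def)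
    finally show ?case .
  qed
  then show ?thesis by (simp only: case_prod_unfold)
qed

lemma shuffle_mset_Nil2 [simp]: "shuffle_mset xs [] = {#xs#}"
  by (cases xs) simp_all

lemma mset_shuffle_mset: "z \<in># shuffle_mset xs ys \<Longrightarrow> mset z = mset xs + mset ys"
  by (induction xs ys arbitrary: z rule: shuffle_mset.induct) auto

text \<open>A splitting of a shuffle has an empty left part, or its left part starts with the first
  letter of one of the two words. Removing that letter is the recursion of the shuffle, and \<phi>
  absorbs it in its left argument.\<close>

lemma deconcat_shuffle:
  fixes \<phi> :: "'a list \<Rightarrow> 'a list \<Rightarrow> 'b::comm_monoid_add"
  shows "(\<Sum>z\<in>#shuffle_mset xs ys. \<Sum>q\<in>#deconcat z. \<phi> (fst q) (snd q)) =
    (\<Sum>q\<in>#deconcat xs. \<Sum>r\<in>#deconcat ys.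
      \<Sum>u\<in>#shuffle_mset (fst q) (fst r). \<Sum>v\<in>#shuffle_mset (snd q) (snd r). \<phi> u v)"
proof (induction xs ys arbitrary: \<phi> rule: shuffle_mset.induct)
  case (3 x xs y ys)
  show ?case
    using "3.IH"(1)[of "\<lambda>u v. \<phi> (x # u) v"] "3.IH"(2)[of "\<lambda>u v. \<phi> (y # u) v"]
    by (simp add: multiset.map_comp comp_def sum_mset.distrib add_ac)
qed simp_all

lemma word_deg_simps [simp]:
  "word_deg \<nu> [] = 0"
  "word_deg \<nu> (k # w) = tree_deg (\<nu> k) + word_deg \<nu> w"
  "word_deg \<nu> (u @ v) = word_deg \<nu> u + word_deg \<nu> v"
  by (simp_all add: word_deg_def)

lemma word_deg_mset: "word_deg \<nu> w = (\<Sum>k\<in>#mset w. tree_deg (\<nu> k))"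
  by (induction w) auto

lemma word_deg_eq_0: "word_deg \<nu> w = 0 \<longleftrightarrow> w = []"
  by (cases w) simp_all

lemma deconcat_append: "q \<in># deconcat w \<Longrightarrow> fst q @ snd q = w"
  by (induction w arbitrary: q) auto

lemma graded_bialgebra_words:
  fixes \<nu> :: "'k \<Rightarrow> 'l rtree"
  shows "graded_bialgebra (word_deg \<nu>) [] shuffle_mset deconcat"
proof
  fix x y z :: "'k list" and q
  show "word_deg \<nu> x = 0 \<longleftrightarrow> x = []" by (rule word_deg_eq_0)
  show "z \<in># shuffle_mset x y \<Longrightarrow> word_deg \<nu> z = word_deg \<nu> x + word_deg \<nu> y"
    by (simp add: word_deg_mset mset_shuffle_mset)
  show "q \<in># deconcat x \<Longrightarrow> word_deg \<nu> (fst q) + word_deg \<nu> (snd q) = word_deg \<nu> x"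
    by (simp flip: word_deg_simps(3) add: deconcat_append)
  show "filter_mset (\<lambda>q. fst q = []) (deconcat x) = {#([], x)#}"
    by (cases x) (simp_all add: filter_mset_image_mset)
  show "filter_mset (\<lambda>q. snd q = []) (deconcat x) = {#(x, [])#}"
    by (induction x) (simp_all add: filter_mset_image_mset)
  show "(\<Sum>q\<in>#deconcat x. \<Sum>r\<in>#deconcat (fst q). \<phi> (fst r) (snd r) (snd q)) =
      (\<Sum>q\<in>#deconcat x. \<Sum>r\<in>#deconcat (snd q). \<phi> (fst q) (fst r) (snd r))"
    for \<phi> :: "'k list \<Rightarrow> 'k list \<Rightarrow> 'k list \<Rightarrow> real"
  proof (induction x arbitrary: \<phi>)
    case (Cons a x)
    show ?case
      using Cons.IH[of "\<lambda>u v w. \<phi> (a # u) v w"]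
      by (simp add: multiset.map_comp comp_def sum_mset.distrib add_ac)
  qed simp
qed (simp, rule deconcat_shuffle)

lemma group_pi_group:
  fixes \<nu> :: "'k \<Rightarrow> 'l rtree"
  shows "group (pi_group \<nu> n)"
proof -
  have "(h u * h v = (\<Sum>w\<in>#shuffle_mset u v. h w)) \<longleftrightarrow> ((\<Sum>w\<in>#shuffle_mset u v. h w) = h u * h v)"
    for h :: "'k list \<Rightarrow> real" and u v
    by (rule eq_commute)
  then have "pi_group \<nu> n = graded_bialgebra.characters (word_deg \<nu>) [] shuffle_mset deconcat n"
    unfolding graded_bialgebra.characters_def[OF graded_bialgebra_words] pi_group_def
    by (simp only: sum_deconcat)
  then show ?thesis
    using graded_bialgebra.group_characters[OF graded_bialgebra_words, of \<nu> n] by metis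
qed

section \<open>Coefficients of Grossman--Larson products\<close>

lemma lookup_pm_scale [simp]: "Poly_Mapping.lookup (pm_scale c a) \<rho> = c * Poly_Mapping.lookup a \<rho>"
  unfolding pm_scale_def by (simp add: Poly_Mapping.map.rep_eq when_def)

lemma tree_deg_map [simp]: "tree_deg (map_rtree f t) = tree_deg t"
  by (induction t) (simp add: multiset.map_comp comp_def cong: image_mset_cong)

lemma forest_deg_map [simp]: "forest_deg (image_mset (map_rtree f) N) = forest_deg N"
  by (simp add: forest_deg_def multiset.map_comp comp_def)

lemma forest_vertices_simps [simp]:
  "forest_vertices {#} = {}"
  "forest_vertices (add_mset t N) = set_rtree t \<union> forest_vertices N"
  "forest_vertices (N + N') = forest_vertices N \<union> forest_vertices N'"
  by (auto simp: forest_vertices_def)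

lemma set_rtree_Node: "set_rtree (Node v N) = insert v (forest_vertices N)"
  by (simp add: forest_vertices_def)

lemma finite_set_rtree [simp]: "finite (set_rtree t)"
  by (induction t) auto

lemma finite_forest_vertices [simp]: "finite (forest_vertices N)"
  by (simp add: forest_vertices_def)

text \<open>The vertex set forgets multiplicities. Applied to the branches of a tree with distinct
  vertices, the bound shows that the root pair does not recur below.\<close>

lemma card_forest_vertices: "card (forest_vertices N) \<le> forest_deg N"
proof (induction N rule: forest_induct)
  case (tree v N)
  then show ?case
    by (simp add: set_rtree_Node tree_deg_Node card_insert_if del: tree_deg.simps rtree.set)
next
  case (union N N')
  then show ?case
    using card_Un_le[of "forest_vertices N" "forest_vertices N'"] by simp
qed simp

text \<open>The lower bound \<open>m\<close> on the identifiers strengthens the induction: a root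
  takes \<open>m\<close> itself with its branches above, and the second part of a union takes
  identifiers larger than those of the first.\<close>

lemma ex_distinguished:
  "\<exists>N. distinguished N \<rho> \<and> (\<forall>v\<in>forest_vertices N. m \<le> fst v)"
proof (induction \<rho> arbitrary: m rule: forest_induct)
  case empty
  show ?case by (rule exI[of _ "{#}"]) (simp add: distinguished_def)
next
  case (tree i \<rho>)
  obtain N where N: "distinguished N \<rho>" "\<And>v. v \<in> forest_vertices N \<Longrightarrow> Suc m \<le> fst v"
    using tree[of "Suc m"] by blast
  then have "(m, i) \<notin> forest_vertices N" by fastforce
  with N show ?case
    by (intro exI[of _ "{#Node (m, i) N#}"])
      (auto simp: distinguished_def set_rtree_Node tree_deg_Node Suc_le_eq less_imp_le
        simp del: tree_deg.simps rtree.set)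
next
  case (union \<rho> \<rho>')
  obtain N where N: "distinguished N \<rho>" "\<And>v. v \<in> forest_vertices N \<Longrightarrow> m \<le> fst v"
    using union.IH(1)[of m] by blast
  define m' where "m' = Suc (Max (insert m (fst ` forest_vertices N)))"
  obtain N' where N': "distinguished N' \<rho>'" "\<And>v. v \<in> forest_vertices N' \<Longrightarrow> m' \<le> fst v"
    using union.IH(2)[of m'] by blast
  have lt: "fst v < m'" if "v \<in> forest_vertices N" for v
    unfolding m'_def less_Suc_eq_le using that by (intro Max_ge) auto
  have "m \<le> m'"
    unfolding m'_def by (intro le_SucI Max_ge) auto
  moreover have "forest_vertices N \<inter> forest_vertices N' = {}"
    using lt N'(2) by fastforce
  ultimately show ?case
    using N N' by (intro exI[of _ "N + N'"])
      (fastforce simp: distinguished_def card_Un_disjoint)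
qed

lemma graft_singleton:
  "graft [\<tau>] \<phi> N = (case \<phi> 0 of None \<Rightarrow> add_mset \<tau> (image_mset (attach (\<lambda>_. {#})) N)
    | Some v \<Rightarrow> image_mset (attach (\<lambda>u. if u = v then {#\<tau>#} else {#})) N)"
proof -
  have "{k. k < length [\<tau>] \<and> \<phi> k = x} = (if x = \<phi> 0 then {0} else {})" for x
    by auto
  then have "{#[\<tau>] ! k. k \<in># mset_set {k. k < length [\<tau>] \<and> \<phi> k = x}#} = (if x = \<phi> 0 then {#\<tau>#} else {#})" for x
    by simp
  then show ?thesis
    unfolding graft_def Let_def by (simp only:) (simp split: option.split)
qed

lemma attach_notin: "v \<notin> set_rtree t \<Longrightarrow> attach (\<lambda>u. if u = v then M else {#}) t = map_rtree snd t"
  by (induction t) (auto intro!: image_mset_cong)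

lemma attach_empty: "attach (\<lambda>_. {#}) = map_rtree snd"
proof
  show "attach (\<lambda>_. {#}) t = map_rtree snd t" for t :: "(nat \<times> 'l) rtree"
    by (induction t) (auto intro!: image_mset_cong)
qed

lemma attach_bullet:
  "attach (\<lambda>u. if u = v then {#\<tau>#} else {#}) t = bullet i \<Longrightarrow> v \<notin> set_rtree t"
  by (cases t) (auto split: if_splits)

text \<open>The copy of \<rho> with identifiers comes from a choice operator, so callers only learn
  that it is \<open>distinguished\<close>. A map on the single position 0 is its value: the first
  summand is the extra root, the others are the vertices.\<close>

lemma gl_forest_singleton:
  obtains N where "distinguished N \<rho>"
    "\<And>\<rho>'. Poly_Mapping.lookup (gl_forest {#\<tau>#} \<rho>) \<rho>' =
      (if add_mset \<tau> \<rho> = \<rho>' then 1 else 0) +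
      (\<Sum>v\<in>forest_vertices N.
        if image_mset (attach (\<lambda>u. if u = v then {#\<tau>#} else {#})) N = \<rho>' then 1 else 0)"
proof
  define N where "N = (SOME N. distinguished N \<rho>)"
  show N: "distinguished N \<rho>"
    unfolding N_def using ex_distinguished by (metis someI)
  have \<tau>s: "(SOME \<tau>s. mset \<tau>s = {#\<tau>#}) = [\<tau>]"
    by (rule some_equality) auto
  let ?V = "insert None (Some ` forest_vertices N)"
  have bij: "bij_betw (\<lambda>x. restrict (\<lambda>_. x) {..<1::nat}) ?V ({..<1} \<rightarrow>\<^sub>E ?V)"
    by (rule bij_betwI[where g = "\<lambda>\<phi>. \<phi> 0"]) (auto simp: PiE_def extensional_def fun_eq_iff)
  have "gl_forest {#\<tau>#} \<rho> = (\<Sum>\<phi>\<in>{..<1} \<rightarrow>\<^sub>E ?V. Poly_Mapping.single (graft [\<tau>] \<phi> N) 1)"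
    unfolding gl_forest_def Let_def \<tau>s N_def[symmetric] by simp
  also have "\<dots> = (\<Sum>x\<in>?V. Poly_Mapping.single (graft [\<tau>] (restrict (\<lambda>_. x) {..<1::nat}) N) 1)"
    by (rule sum.reindex_bij_betw[OF bij, symmetric])
  finally show "Poly_Mapping.lookup (gl_forest {#\<tau>#} \<rho>) \<rho>' =
      (if add_mset \<tau> \<rho> = \<rho>' then 1 else 0) +
      (\<Sum>v\<in>forest_vertices N.
        if image_mset (attach (\<lambda>u. if u = v then {#\<tau>#} else {#})) N = \<rho>' then 1 else 0)" for \<rho>'
    using N by (simp add: lookup_add lookup_sum lookup_single when_def graft_singleton
        sum.reindex attach_empty distinguished_def image_iff)
qed

text \<open>Grafting onto a vertex makes a tree with at least two vertices, so only the extra root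
  can lead to a forest of single vertices.\<close>

lemma gl_forest_bullets:
  "Poly_Mapping.lookup (gl_forest {#\<tau>#} \<rho>) (image_mset bullet M) =
    (if add_mset \<tau> \<rho> = image_mset bullet M then 1 else 0)"
proof -
  obtain N where N: "Poly_Mapping.lookup (gl_forest {#\<tau>#} \<rho>) (image_mset bullet M) =
      (if add_mset \<tau> \<rho> = image_mset bullet M then 1 else 0) +
      (\<Sum>v\<in>forest_vertices N.
        if image_mset (attach (\<lambda>u. if u = v then {#\<tau>#} else {#})) N = image_mset bullet M then 1 else 0)"
    by (rule gl_forest_singleton) blast
  have "image_mset (attach (\<lambda>u. if u = v then {#\<tau>#} else {#})) N \<noteq> image_mset bullet M"
    if v: "v \<in> forest_vertices N" for v
  proof
    assume eq: "image_mset (attach (\<lambda>u. if u = v then {#\<tau>#} else {#})) N = image_mset bullet M"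
    obtain t where t: "t \<in># N" "v \<in> set_rtree t"
      using v by (auto simp: forest_vertices_def)
    then have "attach (\<lambda>u. if u = v then {#\<tau>#} else {#}) t \<in># image_mset bullet M"
      unfolding eq[symmetric] by simp
    then show False
      using t(2) attach_bullet by fastforce
  qed
  then show ?thesis
    unfolding N by simp
qed

text \<open>The target is one tree, so either \<rho> is empty and \<tau> itself is the target, or
  \<rho> is one tree and \<tau> is grafted to one of its vertices. A vertex below the root would
  acquire a branch and exceed depth 2, hence only the root counts, and it counts once.\<close>

lemma gl_forest_tree:
  "Poly_Mapping.lookup (gl_forest {#\<tau>#} \<rho>) {#Node i (image_mset bullet M)#} =
    (if \<rho> = {#} \<and> \<tau> = Node i (image_mset bullet M) \<or>
        (\<exists>\<rho>'. \<rho> = {#Node i \<rho>'#} \<and> add_mset \<tau> \<rho>' = image_mset bullet M) then 1 else 0)"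
proof -
  let ?\<tau>' = "Node i (image_mset bullet M)"
  let ?at = "\<lambda>v. attach (\<lambda>u. if u = v then {#\<tau>#} else {#})"
  obtain N where N: "distinguished N \<rho>" "Poly_Mapping.lookup (gl_forest {#\<tau>#} \<rho>) {#?\<tau>'#} =
      (if add_mset \<tau> \<rho> = {#?\<tau>'#} then 1 else 0) +
      (\<Sum>v\<in>forest_vertices N. if image_mset (?at v) N = {#?\<tau>'#} then 1 else 0)"
    by (rule gl_forest_singleton) blast
  have \<rho>: "image_mset (map_rtree snd) N = \<rho>" and card: "card (forest_vertices N) = forest_deg \<rho>"
    using N(1) by (auto simp: distinguished_def)
  show ?thesis
  proof (cases "size \<rho> = 1")
    case False
    then have "size N \<noteq> 1"
      using \<rho> by auto
    then have "image_mset (?at v) N \<noteq> {#?\<tau>'#}" for v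
      by (metis size_image_mset size_single)
    then show ?thesis
      using False by (auto simp: N(2))
  next
    case True
    then obtain w where w: "\<rho> = {#w#}"
      using size_1_singleton_mset by blast
    then obtain t where t: "N = {#t#}" "map_rtree snd t = w"
      using \<rho> msed_map_invR[of "map_rtree snd" N w "{#}"] by auto
    obtain v0 N' where v0: "t = Node v0 N'" by (cases t)
    define \<rho>' where "\<rho>' = image_mset (map_rtree snd) N'"
    have w': "w = Node (snd v0) \<rho>'"
      using t(2) by (auto simp: v0 \<rho>'_def)
    \<comment> \<open>The whole tree has \<open>Suc (forest_deg N')\<close> distinct vertices and
      the branches supply at most \<open>forest_deg N'\<close>, so the root pair is new and is a
      separate summand.\<close>
    have "card (insert v0 (forest_vertices N')) = Suc (forest_deg N')"
      using card by (simp add: t(1) v0 w w' \<rho>'_def set_rtree_Node tree_deg_Node del: tree_deg.simps rtree.set)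
    then have v0_notin: "v0 \<notin> forest_vertices N'"
      using card_forest_vertices[of N'] by (auto simp: card_insert_if split: if_splits)
    have "image_mset (?at v0) N' = \<rho>'"
      unfolding \<rho>'_def using v0_notin
      by (intro image_mset_cong attach_notin) (auto simp: forest_vertices_def)
    then have root: "?at v0 t = Node (snd v0) (add_mset \<tau> \<rho>')"
      by (simp add: v0)
    have other: "?at v t \<noteq> ?\<tau>'" if v: "v \<in> forest_vertices N'" for v
    proof
      assume "?at v t = ?\<tau>'"
      moreover have "v \<noteq> v0" using v v0_notin by auto
      ultimately have eq: "image_mset (?at v) N' = image_mset bullet M"
        by (auto simp: v0)
      obtain t' where t': "t' \<in># N'" "v \<in> set_rtree t'"
        using v by (auto simp: forest_vertices_def)
      then have "?at v t' \<in># image_mset bullet M"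
        unfolding eq[symmetric] by simp
      then show False
        using t'(2) attach_bullet by fastforce
    qed
    have "(\<Sum>v\<in>forest_vertices N. if image_mset (?at v) N = {#?\<tau>'#} then 1 else 0 :: real) =
        (\<Sum>v\<in>insert v0 (forest_vertices N'). if ?at v t = ?\<tau>' then 1 else 0)"
      by (simp add: t(1) v0 set_rtree_Node del: rtree.set)
    also have "\<dots> = (if ?at v0 t = ?\<tau>' then 1 else 0)"
      using v0_notin other by simp
    finally show ?thesis
      unfolding N(2) by (auto simp: w w' root)
  qed
qed

section \<open>Coefficients of products of letters\<close>

lemma gl_word_Nil: "gl_word [] = Poly_Mapping.single {#} 1"
  by (simp add: gl_word_def)

lemma lookup_gl_word_Cons:
  "Poly_Mapping.lookup (gl_word (\<tau> # \<tau>s)) \<rho>' =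
    (\<Sum>\<rho>\<in>Poly_Mapping.keys (gl_word \<tau>s).
      Poly_Mapping.lookup (gl_word \<tau>s) \<rho> * Poly_Mapping.lookup (gl_forest {#\<tau>#} \<rho>) \<rho>')"
  by (simp add: gl_word_def gl_mult_def lookup_sum)

lemma sum_keys_delta:
  fixes b :: "'a \<Rightarrow>\<^sub>0 real"
  shows "(\<Sum>\<rho>\<in>Poly_Mapping.keys b. Poly_Mapping.lookup b \<rho> * (if \<rho> = \<rho>0 then 1 else 0)) = Poly_Mapping.lookup b \<rho>0"
  by (simp add: in_keys_iff if_distrib[of "\<lambda>x. _ * x"] sum.delta cong: if_cong)

lemma add_mset_eq_image_bullet:
  "add_mset \<tau> \<rho> = image_mset bullet M \<longleftrightarrow> (\<exists>m\<in>#M. \<tau> = bullet m \<and> \<rho> = image_mset bullet (M - {#m#}))"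
proof
  assume "add_mset \<tau> \<rho> = image_mset bullet M"
  then obtain m M' where "M = add_mset m M'" "bullet m = \<tau>" "image_mset bullet M' = \<rho>"
    using msed_map_invR[of bullet M \<tau> \<rho>] by metis
  then show "\<exists>m\<in>#M. \<tau> = bullet m \<and> \<rho> = image_mset bullet (M - {#m#})" by auto
next
  assume "\<exists>m\<in>#M. \<tau> = bullet m \<and> \<rho> = image_mset bullet (M - {#m#})"
  then obtain m where "m \<in># M" "\<tau> = bullet m" "\<rho> = image_mset bullet (M - {#m#})" by blast
  moreover from this obtain M' where "M = add_mset m M'"
    by (meson multi_member_split)
  ultimately show "add_mset \<tau> \<rho> = image_mset bullet M" by simp
qed

text \<open>The first letter must be one of the single vertices and is placed beside the rest. The
  product of the remaining letters then has to contribute the forest without that vertex, so at most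
  one term of the sum survives.\<close>

lemma gl_word_bullets:
  "Poly_Mapping.lookup (gl_word \<tau>s) (image_mset bullet M) = (if mset \<tau>s = image_mset bullet M then 1 else 0)"
proof (induction \<tau>s arbitrary: M)
  case (Cons \<tau> \<tau>s)
  show ?case
  proof (cases "\<exists>m\<in>#M. \<tau> = bullet m")
    case True
    then obtain m where m: "m \<in># M" "\<tau> = bullet m" by blast
    then have "(add_mset \<tau> \<rho> = image_mset bullet M) \<longleftrightarrow> \<rho> = image_mset bullet (M - {#m#})" for \<rho>
      by (auto simp: add_mset_eq_image_bullet)
    then show ?thesis
      by (simp add: lookup_gl_word_Cons gl_forest_bullets sum_keys_delta Cons.IH)
  next
    case False
    then show ?thesis
      by (auto simp: lookup_gl_word_Cons gl_forest_bullets add_mset_eq_image_bullet)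
  qed
qed (auto simp: gl_word_Nil lookup_one when_def)

text \<open>Letters are multiplied on from the left, so the last letter is the base tree and every
  earlier one has to become a leaf of its root. Each step has only one possible predecessor, which
  excludes multiplicities.\<close>

lemma gl_word_tree:
  "Poly_Mapping.lookup (gl_word \<tau>s) {#Node i (image_mset bullet M)#} =
    (if \<tau>s \<noteq> [] \<and> tree_label (last \<tau>s) = i \<and>
      mset (butlast \<tau>s) + branches (last \<tau>s) = image_mset bullet M then 1 else 0)"
proof (induction \<tau>s arbitrary: M)
  case (Cons \<tau> \<tau>s)
  show ?case
  proof (cases "\<tau>s = []")
    case True
    have "Poly_Mapping.lookup (gl_word [\<tau>]) {#Node i (image_mset bullet M)#} =
        (if \<tau> = Node i (image_mset bullet M) then 1 else 0)"
      by (simp add: lookup_gl_word_Cons gl_word_Nil gl_forest_tree)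
    then show ?thesis
      using True by (cases \<tau>) auto
  next
    case False
    let ?b = "gl_word \<tau>s"
    \<comment> \<open>A nonempty word never produces the empty forest; this removes the alternative
      of \<open>gl_forest_tree\<close> in which \<tau> is the whole target.\<close>
    have b0: "Poly_Mapping.lookup ?b {#} = 0"
      using gl_word_bullets[of \<tau>s "{#}"] False by simp
    have "Poly_Mapping.lookup (gl_word (\<tau> # \<tau>s)) {#Node i (image_mset bullet M)#} =
        (\<Sum>\<rho>\<in>Poly_Mapping.keys ?b. Poly_Mapping.lookup ?b \<rho> *
          (if \<exists>\<rho>'. \<rho> = {#Node i \<rho>'#} \<and> add_mset \<tau> \<rho>' = image_mset bullet M then 1 else 0))"
      unfolding lookup_gl_word_Cons
      by (rule sum.cong[OF refl]) (use b0 in \<open>auto simp: gl_forest_tree\<close>)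
    also have "\<dots> = (if mset (butlast (\<tau> # \<tau>s)) + branches (last (\<tau> # \<tau>s)) = image_mset bullet M \<and>
        tree_label (last (\<tau> # \<tau>s)) = i then 1 else 0)"
    proof (cases "\<exists>m\<in>#M. \<tau> = bullet m")
      case True
      then obtain m where m: "m \<in># M" "\<tau> = bullet m" by blast
      then have "(\<exists>\<rho>'. \<rho> = {#Node i \<rho>'#} \<and> add_mset \<tau> \<rho>' = image_mset bullet M) \<longleftrightarrow>
          \<rho> = {#Node i (image_mset bullet (M - {#m#}))#}" for \<rho>
        by (auto simp: add_mset_eq_image_bullet)
      moreover have "add_mset \<tau> \<rho> = image_mset bullet M \<longleftrightarrow> \<rho> = image_mset bullet (M - {#m#})" for \<rho>
        using m by (auto simp: add_mset_eq_image_bullet)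
      ultimately show ?thesis
        using False by (auto simp: sum_keys_delta Cons.IH)
    next
      case no: False
      then have "add_mset \<tau> \<rho> \<noteq> image_mset bullet M" for \<rho>
        by (auto simp: add_mset_eq_image_bullet)
      then show ?thesis
        using False by simp
    qed
    finally show ?thesis by auto
  qed
qed (simp add: gl_word_Nil lookup_one when_def)

section \<open>Chen's relation on trees of depth at most 2\<close>

lemma finite_mset_lists: "finite {w. mset w = M}"
  by (metis ex_mset mset_eq_finite)

lemma finite_mset_splits: "finite {p. fst p + snd p = (M :: 'a multiset)}"
proof (rule finite_subset)
  let ?U = "\<Union>w\<in>{w. mset w = M}. {q. fst q @ snd q = w}"
  show "{p. fst p + snd p = M} \<subseteq> (\<lambda>q. (mset (fst q), mset (snd q))) ` ?U"
  proof
    fix p assume p: "p \<in> {p. fst p + snd p = M}"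
    obtain u v where "mset u = fst p" "mset v = snd p" by (metis ex_mset)
    with p show "p \<in> (\<lambda>q. (mset (fst q), mset (snd q))) ` ?U"
      by (intro image_eqI[of _ _ "(u, v)"]) auto
  qed
  show "finite ((\<lambda>q. (mset (fst q), mset (snd q))) ` ?U)"
    by (intro finite_imageI finite_UN_I finite_mset_lists finite_splits)
qed

lemma forest_sigma_add:
  fixes \<tau> :: "'a rtree"
  shows "forest_sigma (add_mset \<tau> \<rho>) = Suc (count \<rho> \<tau>) * tree_sigma \<tau> * forest_sigma \<rho>"
proof -
  define g :: "'a forest \<Rightarrow> 'a rtree \<Rightarrow> nat"
    where "g \<rho>' \<tau>' = fact (count \<rho>' \<tau>') * tree_sigma \<tau>' ^ count \<rho>' \<tau>'" for \<rho>' \<tau>'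
  let ?S = "insert \<tau> (set_mset \<rho>)"
  have eq: "forest_sigma \<rho>' = prod (g \<rho>') ?S" if "set_mset \<rho>' \<subseteq> ?S" for \<rho>'
    unfolding forest_sigma_def g_def using that
    by (intro prod.mono_neutral_left) (auto simp: not_in_iff)
  have "forest_sigma (add_mset \<tau> \<rho>) = g (add_mset \<tau> \<rho>) \<tau> * prod (g (add_mset \<tau> \<rho>)) (?S - {\<tau>})"
    by (subst eq) (auto simp: prod.remove[of ?S \<tau>])
  also have "prod (g (add_mset \<tau> \<rho>)) (?S - {\<tau>}) = prod (g \<rho>) (?S - {\<tau>})"
    by (intro prod.cong) (auto simp: g_def)
  also have "g (add_mset \<tau> \<rho>) \<tau> = Suc (count \<rho> \<tau>) * tree_sigma \<tau> * g \<rho> \<tau>"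
    by (simp add: g_def algebra_simps)
  also have "\<dots> * prod (g \<rho>) (?S - {\<tau>}) = Suc (count \<rho> \<tau>) * tree_sigma \<tau> * forest_sigma \<rho>"
    by (subst eq[of \<rho>]) (auto simp: prod.remove[of ?S \<tau>])
  finally show ?thesis .
qed

lemma forest_sigma_empty [simp]: "forest_sigma {#} = 1"
  by (simp add: forest_sigma_def)

abbreviation bullets :: "'l multiset \<Rightarrow> 'l forest"
  where "bullets M \<equiv> image_mset bullet M"

lemma forest_deg_bullets [simp]: "forest_deg (bullets M) = size M"
  by (induction M) auto

text \<open>These are exactly the trees of depth at most 2, see \<open>tree_depth_le_2\<close>; for
  \<open>M = {#}\<close> it is a single vertex.\<close>

definition corolla :: "'l \<Rightarrow> 'l multiset \<Rightarrow> 'l rtree"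
  where "corolla i M = Node i (bullets M)"

lemma forest_sigma_bullets_add:
  "forest_sigma (bullets (add_mset i M)) = Suc (count M i) * forest_sigma (bullets M)"
proof -
  have "count (bullets M) (bullet i) = count M i"
    by (induction M) auto
  then show ?thesis
    by (simp add: forest_sigma_add)
qed

text \<open>The weight kills the splittings whose left part lacks \<open>i\<close>; from the others
  one copy of \<open>i\<close> can be removed on the left. This serves the induction that adds one
  vertex to \<open>M\<close>.\<close>

lemma sum_count_fst_splits:
  fixes \<psi> :: "'a multiset \<times> 'a multiset \<Rightarrow> real"
  shows "(\<Sum>p | fst p + snd p = add_mset i M. real (count (fst p) i) * \<psi> p) =
    (\<Sum>p | fst p + snd p = M. real (Suc (count (fst p) i)) * \<psi> (add_mset i (fst p), snd p))"
proof -
  let ?S = "{p. fst p + snd p = M}" and ?f = "\<lambda>p. (add_mset i (fst p), snd p)"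
  have inj: "inj_on ?f ?S" by (auto simp: inj_on_def prod_eq_iff)
  have "(\<Sum>p | fst p + snd p = add_mset i M. real (count (fst p) i) * \<psi> p) =
      (\<Sum>p\<in>?f ` ?S. real (count (fst p) i) * \<psi> p)"
  proof (rule sum.mono_neutral_right[OF finite_mset_splits])
    show "?f ` ?S \<subseteq> {p. fst p + snd p = add_mset i M}" by auto
    show "\<forall>p\<in>{p. fst p + snd p = add_mset i M} - ?f ` ?S. real (count (fst p) i) * \<psi> p = 0"
    proof
      fix p assume p: "p \<in> {p. fst p + snd p = add_mset i M} - ?f ` ?S"
      have "i \<notin># fst p"
      proof
        assume "i \<in># fst p"
        then obtain N1 where "fst p = add_mset i N1" by (meson multi_member_split)
        then have "p \<in> ?f ` ?S"
          using p by (intro image_eqI[of _ _ "(N1, snd p)"]) (auto simp: prod_eq_iff)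
        with p show False by simp
      qed
      then show "real (count (fst p) i) * \<psi> p = 0"
        by (simp add: not_in_iff)
    qed
  qed
  then show "(\<Sum>p | fst p + snd p = add_mset i M. real (count (fst p) i) * \<psi> p) =
      (\<Sum>p | fst p + snd p = M. real (Suc (count (fst p) i)) * \<psi> (add_mset i (fst p), snd p))"
    by (simp add: sum.reindex[OF inj])
qed

lemma sum_mset_splits_swap:
  "(\<Sum>p | fst p + snd p = M. \<psi> p) = (\<Sum>p | fst p + snd p = (M :: 'a multiset). \<psi> (snd p, fst p))"
  by (rule sum.reindex_bij_witness[where i = prod.swap and j = prod.swap]) (auto simp: add.commute)

lemma sum_count_snd_splits:
  fixes \<psi> :: "'a multiset \<times> 'a multiset \<Rightarrow> real"
  shows "(\<Sum>p | fst p + snd p = add_mset i M. real (count (snd p) i) * \<psi> p) =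
    (\<Sum>p | fst p + snd p = M. real (Suc (count (snd p) i)) * \<psi> (fst p, add_mset i (snd p)))"
proof -
  have "(\<Sum>p | fst p + snd p = add_mset i M. real (count (snd p) i) * \<psi> p) =
      (\<Sum>p | fst p + snd p = add_mset i M. real (count (fst p) i) * \<psi> (snd p, fst p))"
    by (subst sum_mset_splits_swap) simp
  also have "\<dots> = (\<Sum>p | fst p + snd p = M. real (Suc (count (fst p) i)) * \<psi> (snd p, add_mset i (fst p)))"
    by (subst sum_count_fst_splits) simp
  also have "\<dots> = (\<Sum>p | fst p + snd p = M. real (Suc (count (snd p) i)) * \<psi> (fst p, add_mset i (snd p)))"
    by (subst sum_mset_splits_swap) simp
  finally show ?thesis .
qed

text \<open>Each single vertex goes left or right, so a splitting of \<open>M\<close> occurs as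
  often as the product of the binomial coefficients of its multiplicities. The symmetry factor of
  \<open>bullets M\<close> is the product of the factorials of the multiplicities, so dividing by it
  leaves the reciprocals of the two smaller symmetry factors.\<close>

lemma sum_coproduct_bullets:
  fixes \<phi> :: "'l forest \<Rightarrow> 'l forest \<Rightarrow> real"
  shows "(\<Sum>q\<in>#forest_coproduct (bullets M). \<phi> (fst q) (snd q)) / forest_sigma (bullets M) =
    (\<Sum>p | fst p + snd p = M. \<phi> (bullets (fst p)) (bullets (snd p)) /
      (real (forest_sigma (bullets (fst p))) * real (forest_sigma (bullets (snd p)))))"
proof (induction M arbitrary: \<phi>)
  case empty
  have "{p. fst p + snd p = ({#} :: 'l multiset)} = {({#}, {#})}" by auto
  then show ?case by (simp only:) (simp add: forest_coproduct_empty)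
next
  case (add i M)
  let ?s = "\<lambda>M. real (forest_sigma (bullets M))"
  let ?r = "\<lambda>p. \<phi> (bullets (fst p)) (bullets (snd p)) / (?s (fst p) * ?s (snd p))"
  have s_add: "?s (add_mset i N) = real (Suc (count N i)) * ?s N" for N
    by (simp only: forest_sigma_bullets_add of_nat_mult)
  have "bullets (add_mset i M) = {#bullet i#} + bullets M" by simp
  then have "(\<Sum>q\<in>#forest_coproduct (bullets (add_mset i M)). \<phi> (fst q) (snd q)) =
      (\<Sum>q\<in>#forest_coproduct (bullets M). \<phi> (add_mset (bullet i) (fst q)) (snd q)) +
      (\<Sum>q\<in>#forest_coproduct (bullets M). \<phi> (fst q) (add_mset (bullet i) (snd q)))"
    by (simp only: forest_coproduct_union sum_tensor_mult)
      (simp add: forest_coproduct_tree forest_coproduct_empty)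
  then have "(\<Sum>q\<in>#forest_coproduct (bullets (add_mset i M)). \<phi> (fst q) (snd q)) / ?s M =
      (\<Sum>p | fst p + snd p = M. \<phi> (bullets (add_mset i (fst p))) (bullets (snd p)) / (?s (fst p) * ?s (snd p))) +
      (\<Sum>p | fst p + snd p = M. \<phi> (bullets (fst p)) (bullets (add_mset i (snd p))) / (?s (fst p) * ?s (snd p)))"
    using add.IH[of "\<lambda>u v. \<phi> (add_mset (bullet i) u) v"] add.IH[of "\<lambda>u v. \<phi> u (add_mset (bullet i) v)"]
    by (simp add: add_divide_distrib)
  also have "\<dots> = (\<Sum>p | fst p + snd p = M. real (Suc (count (fst p) i)) * ?r (add_mset i (fst p), snd p)) +
      (\<Sum>p | fst p + snd p = M. real (Suc (count (snd p) i)) * ?r (fst p, add_mset i (snd p)))"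
    by (intro arg_cong2[where f="(+)"] sum.cong refl)
      (simp_all only: fst_conv snd_conv s_add, simp_all add: mult.left_commute mult.assoc del: of_nat_Suc)
  also have "\<dots> = (\<Sum>p | fst p + snd p = add_mset i M. real (count (fst p) i) * ?r p) +
      (\<Sum>p | fst p + snd p = add_mset i M. real (count (snd p) i) * ?r p)"
    by (simp only: sum_count_fst_splits sum_count_snd_splits)
  \<comment> \<open>The two counts add up to \<open>count M i + 1\<close> for every splitting, which
    is the factor by which the symmetry factor grows.\<close>
  also have "\<dots> = (\<Sum>p | fst p + snd p = add_mset i M. real (count (fst p + snd p) i) * ?r p)"
    by (simp only: sum.distrib[symmetric] count_union of_nat_add distrib_right)
  also have "\<dots> = real (Suc (count M i)) * (\<Sum>p | fst p + snd p = add_mset i M. ?r p)"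
    unfolding sum_distrib_left by (intro sum.cong refl) (simp only: mem_Collect_eq, simp)
  finally have sum: "(\<Sum>q\<in>#forest_coproduct (bullets (add_mset i M)). \<phi> (fst q) (snd q)) / ?s M =
      real (Suc (count M i)) * (\<Sum>p | fst p + snd p = add_mset i M. ?r p)" .
  have "(\<Sum>q\<in>#forest_coproduct (bullets (add_mset i M)). \<phi> (fst q) (snd q)) / ?s (add_mset i M) =
      (\<Sum>q\<in>#forest_coproduct (bullets (add_mset i M)). \<phi> (fst q) (snd q)) / ?s M / real (Suc (count M i))"
    by (simp only: s_add divide_divide_eq_left mult.commute)
  then show ?case
    by (simp only: sum) (simp del: of_nat_Suc)
qed

text \<open>After normalisation by symmetry factors, the group law on corollas has unit coefficients
  indexed by the splittings of the leaves. The first summand comes from the term with the whole tree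
  on the left, where \<open>b\<close> is evaluated at the empty forest.\<close>

lemma character_mult_corolla:
  fixes a b :: "'l forest \<Rightarrow> real"
  assumes "size M < n" and "b {#} = 1"
  shows "(a \<otimes>\<^bsub>character_group n\<^esub> b) {#corolla i M#} / forest_sigma (bullets M) =
    a {#corolla i M#} / forest_sigma (bullets M) +
    (\<Sum>p | fst p + snd p = M. a (bullets (fst p)) / forest_sigma (bullets (fst p)) *
      (b {#corolla i (snd p)#} / forest_sigma (bullets (snd p))))"
proof -
  have "(a \<otimes>\<^bsub>character_group n\<^esub> b) {#corolla i M#} =
      a {#corolla i M#} + (\<Sum>q\<in>#forest_coproduct (bullets M). a (fst q) * b {#Node i (snd q)#})"
    using assms by (simp add: character_group_def corolla_def tree_deg_Node forest_coproduct_tree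
        multiset.map_comp comp_def case_prod_unfold del: tree_deg.simps)
  then show ?thesis
    using sum_coproduct_bullets[of "\<lambda>u v. a u * b {#Node i v#}" M]
    by (simp add: add_divide_distrib corolla_def)
qed

lemma size_le_forest_deg: "size \<rho> \<le> forest_deg \<rho>"
  by (induction \<rho>) (auto simp: Suc_le_eq add_less_le_mono add_strict_increasing)

lemma tree_deg_le_forest_deg: "\<tau> \<in># \<rho> \<Longrightarrow> tree_deg \<tau> \<le> forest_deg \<rho>"
  by (induction \<rho>) auto

text \<open>Forests of degree at most n have at most n trees, all of degree at most n, and a tree of
  degree at most n + 1 is a label with a forest of degree at most n; hence the joint induction. As
  sums over infinite sets are 0, finiteness gives the sums over trees and forests their
  meaning.\<close>

lemma finite_trees_forests:
  "finite {\<tau> :: 'l::finite rtree. tree_deg \<tau> \<le> n} \<and> finite {\<rho> :: 'l forest. forest_deg \<rho> \<le> n}"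
proof (induction n)
  have forests: "finite {\<rho> :: 'l forest. forest_deg \<rho> \<le> n}" if fin: "finite {\<tau> :: 'l rtree. tree_deg \<tau> \<le> n}" for n
  proof (rule finite_subset)
    show "{\<rho> :: 'l forest. forest_deg \<rho> \<le> n} \<subseteq> mset ` {\<tau>s. set \<tau>s \<subseteq> {\<tau>. tree_deg \<tau> \<le> n} \<and> length \<tau>s \<le> n}"
    proof
      fix \<rho> :: "'l forest" assume \<rho>: "\<rho> \<in> {\<rho>. forest_deg \<rho> \<le> n}"
      obtain \<tau>s where \<tau>s: "\<rho> = mset \<tau>s" by (metis ex_mset)
      have "set \<tau>s \<subseteq> {\<tau>. tree_deg \<tau> \<le> n}" "length \<tau>s \<le> n"
        using \<rho> tree_deg_le_forest_deg[of _ \<rho>] size_le_forest_deg[of \<rho>] by (force simp: \<tau>s)+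
      then show "\<rho> \<in> mset ` {\<tau>s. set \<tau>s \<subseteq> {\<tau>. tree_deg \<tau> \<le> n} \<and> length \<tau>s \<le> n}"
        using \<tau>s by blast
    qed
    show "finite (mset ` {\<tau>s. set \<tau>s \<subseteq> {\<tau> :: 'l rtree. tree_deg \<tau> \<le> n} \<and> length \<tau>s \<le> n})"
      using fin by (intro finite_imageI finite_lists_length_le)
  qed
  {
    case 0
    have "{\<tau> :: 'l rtree. tree_deg \<tau> \<le> 0} = {}" by simp
    then have "finite {\<tau> :: 'l rtree. tree_deg \<tau> \<le> 0}" by (simp only: finite.emptyI)
    then show ?case using forests by blast
  next
    case (Suc n)
    have "{\<tau> :: 'l rtree. tree_deg \<tau> \<le> Suc n} \<subseteq> (\<lambda>(i, \<rho>). Node i \<rho>) ` (UNIV \<times> {\<rho>. forest_deg \<rho> \<le> n})"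
    proof
      fix \<tau> :: "'l rtree" assume "\<tau> \<in> {\<tau>. tree_deg \<tau> \<le> Suc n}"
      then show "\<tau> \<in> (\<lambda>(i, \<rho>). Node i \<rho>) ` (UNIV \<times> {\<rho>. forest_deg \<rho> \<le> n})"
        by (cases \<tau>) (auto simp: tree_deg_Node simp del: tree_deg.simps)
    qed
    then have "finite {\<tau> :: 'l rtree. tree_deg \<tau> \<le> Suc n}"
      by (rule finite_subset) (use Suc in auto)
    then show ?case using forests by blast
  }
qed

lemma length_le_word_deg: "length w \<le> word_deg \<nu> w"
  by (induction w) (auto simp: Suc_le_eq add_strict_increasing)

lemma finite_words: "finite {w :: 'k::finite list. word_deg \<nu> w \<le> n}"
proof (rule finite_subset)
  show "{w. word_deg \<nu> w \<le> n} \<subseteq> {w. set w \<subseteq> UNIV \<and> length w \<le> n}"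
    using length_le_word_deg order_trans by fastforce
qed (rule finite_lists_length_le, simp)

lemma isomorphic_at_coefficient:
  fixes \<nu> :: "'k::finite \<Rightarrow> 'l::finite rtree"
  assumes "isomorphic_at \<nu> n a h" and "forest_deg \<rho> \<le> n"
  shows "a \<rho> / forest_sigma \<rho> =
    (\<Sum>w | word_deg \<nu> w \<le> n. h w * Poly_Mapping.lookup (gl_word (map \<nu> w)) \<rho>)"
proof -
  have "a \<rho> / forest_sigma \<rho> = (\<Sum>\<rho>' | forest_deg \<rho>' \<le> n. a \<rho>' / forest_sigma \<rho>' when \<rho>' = \<rho>)"
    using assms(2) finite_trees_forests[where 'l='l, of n] by (simp add: when_def)
  also have "\<dots> = Poly_Mapping.lookup
      (\<Sum>\<rho>' | forest_deg \<rho>' \<le> n. Poly_Mapping.single \<rho>' (a \<rho>' / real (forest_sigma \<rho>'))) \<rho>"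
    by (simp add: lookup_sum lookup_single)
  also have "\<dots> = (\<Sum>w | word_deg \<nu> w \<le> n. h w * Poly_Mapping.lookup (gl_word (map \<nu> w)) \<rho>)"
    using assms(1) by (simp add: isomorphic_at_def lookup_sum)
  finally show ?thesis .
qed

text \<open>This tree has two roles: it is the only one of depth at most 2 that can arise when the
  single vertices \<open>M\<close> multiply \<tau> from the left, and it indexes the derivative of
  \<open>f_tree f \<tau>\<close> in the directions \<open>M\<close>.\<close>

definition root_graft :: "'l rtree \<Rightarrow> 'l multiset \<Rightarrow> 'l rtree"
  where "root_graft \<tau> M = Node (tree_label \<tau>) (branches \<tau> + bullets M)"

lemma root_graft_simps:
  "root_graft (root_graft \<tau> M) M' = root_graft \<tau> (M + M')"
  "root_graft (corolla i M) M' = corolla i (M + M')"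
  by (simp_all add: root_graft_def corolla_def add.assoc)

lemma tree_deg_root_graft: "tree_deg (root_graft \<tau> M) = tree_deg \<tau> + size M"
  by (cases \<tau>) (simp add: root_graft_def tree_deg_Node del: tree_deg.simps)

lemma bullets_union_eq:
  assumes "\<rho> + bullets N = bullets M"
  obtains N' where "\<rho> = bullets N'" "M = N' + N"
proof -
  have "\<rho> = bullets (image_mset tree_label \<rho>)"
  proof -
    have "\<tau> = bullet (tree_label \<tau>)" if "\<tau> \<in># \<rho>" for \<tau>
    proof -
      have "\<tau> \<in># bullets M" unfolding assms[symmetric] using that by simp
      then show ?thesis by auto
    qed
    then show ?thesis
      by (simp add: multiset.map_comp comp_def flip: multiset.map_id0 cong: image_mset_cong)
  qed
  moreover have "image_mset tree_label (\<rho> + bullets N) = image_mset tree_label (bullets M)"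
    by (simp only: assms)
  ultimately show thesis
    by (intro that[of "image_mset tree_label \<rho>"]) (simp_all add: multiset.map_comp comp_def)
qed

text \<open>Lets a splitting of the letters grafted to the root be read as a splitting of the leaves
  of the resulting corolla.\<close>

lemma root_graft_eq_corolla:
  "root_graft \<tau> (N + N') = corolla i M \<longleftrightarrow> (\<exists>M'. M = N + M' \<and> root_graft \<tau> N' = corolla i M')"
proof
  assume "root_graft \<tau> (N + N') = corolla i M"
  then have "tree_label \<tau> = i" "(branches \<tau> + bullets N') + bullets N = bullets M"
    by (auto simp: root_graft_def corolla_def ac_simps)
  moreover from this(2) obtain M' where "branches \<tau> + bullets N' = bullets M'" "M = M' + N"
    by (rule bullets_union_eq)
  ultimately show "\<exists>M'. M = N + M' \<and> root_graft \<tau> N' = corolla i M'"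
    by (auto simp: root_graft_def corolla_def ac_simps)
qed (auto simp: root_graft_def corolla_def ac_simps)

text \<open>\<open>deg_\<nu>\<close> makes the natural subtraction
  \<open>n - tree_deg (\<nu> k)\<close> genuine. By injectivity of \<nu> the letters with one-vertex
  trees are exactly those in the range of \<iota>.\<close>

locale letters =
  fixes \<nu> :: "'k::finite \<Rightarrow> 'd::finite rtree" and \<iota> :: "'d \<Rightarrow> 'k" and n :: nat
  assumes inj_\<nu>: "inj \<nu>" and \<nu>_\<iota>: "\<nu> (\<iota> i) = bullet i" and deg_\<nu>: "tree_deg (\<nu> k) \<le> n"
begin

definition bullets_coeff :: "('k list \<Rightarrow> real) \<Rightarrow> 'd multiset \<Rightarrow> real"
  where "bullets_coeff h M = (\<Sum>is | mset is = M. h (map \<iota> is))"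

text \<open>For \<tau> of depth at most 2 this is what the isomorphism assigns to the coordinate at
  \<tau> divided by its symmetry factor. The words are those of the approximations along
  \<open>Z\<close>. For deeper \<tau> the number only appears multiplied by
  \<open>f_tree f \<tau>\<close>, which is 0.\<close>

definition tree_coeff :: "('k list \<Rightarrow> real) \<Rightarrow> 'd rtree \<Rightarrow> real"
  where "tree_coeff h \<tau> = (\<Sum>(is, k) | root_graft (\<nu> k) (mset is) = \<tau>. h (map \<iota> is @ [k]))"

lemma map_\<nu>_\<iota>: "map \<nu> (map \<iota> is) = map bullet is"
  by (simp add: \<nu>_\<iota>)

text \<open>Inclusion in \<open>bullets M\<close> instead of equality lets the induction drop
  letters and covers both a whole word and a word without its last letter.\<close>

lemma eq_map_\<iota>: "mset (map \<nu> w) \<subseteq># bullets M \<Longrightarrow> w = map \<iota> (map (tree_label \<circ> \<nu>) w)"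
proof (induction w arbitrary: M)
  case (Cons k w)
  then have "\<nu> k \<in># bullets M"
    using mset_subset_eqD by fastforce
  then have "\<nu> k = \<nu> (\<iota> (tree_label (\<nu> k)))"
    by (auto simp: \<nu>_\<iota>)
  then have "k = \<iota> (tree_label (\<nu> k))"
    using inj_\<nu> by (simp add: inj_eq)
  moreover have "mset (map \<nu> w) \<subseteq># bullets M"
    using Cons.prems by (metis list.simps(9) mset.simps(2) mset_subset_eq_insertD subset_mset.less_imp_le)
  ultimately show ?case
    using Cons.IH by simp
qed simp

lemma inj_\<iota>: "inj \<iota>"
  by (rule injI) (metis \<nu>_\<iota> rtree.inject)

lemma word_deg_\<iota>: "word_deg \<nu> (map \<iota> is) = length is"
  by (induction "is") (simp_all add: \<nu>_\<iota>)

lemma finite_graft_words: "finite {q. root_graft (\<nu> (snd q)) (mset (fst q)) = \<tau>}"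
proof (rule finite_subset)
  show "{q. root_graft (\<nu> (snd q)) (mset (fst q)) = \<tau>} \<subseteq>
      {is. set is \<subseteq> UNIV \<and> length is \<le> tree_deg \<tau>} \<times> UNIV"
    by (auto simp: tree_deg_root_graft)
  show "finite ({is. set is \<subseteq> (UNIV :: 'd set) \<and> length is \<le> tree_deg \<tau>} \<times> (UNIV :: 'k set))"
    by (intro finite_cartesian_product finite_lists_length_le) auto
qed

lemma isomorphic_at_bullets:
  assumes iso: "isomorphic_at \<nu> n a h" and "size M \<le> n"
  shows "a (bullets M) / forest_sigma (bullets M) = bullets_coeff h M"
proof -
  have "{w. word_deg \<nu> w \<le> n \<and> mset (map \<nu> w) = bullets M} = map \<iota> ` {is. mset is = M}" (is "?L = ?R")
  proof
    show "?R \<subseteq> ?L"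
      using assms(2) by (auto simp: word_deg_\<iota> multiset.map_comp comp_def \<nu>_\<iota>)
    show "?L \<subseteq> ?R"
    proof
      fix w assume w: "w \<in> ?L"
      let ?is = "map (tree_label \<circ> \<nu>) w"
      have "w = map \<iota> ?is"
        using w by (intro eq_map_\<iota>[of _ M]) simp
      moreover have "mset ?is = M"
      proof -
        have "mset ?is = image_mset tree_label (mset (map \<nu> w))"
          by (simp add: multiset.map_comp)
        also have "\<dots> = M"
          using w by (simp add: multiset.map_comp comp_def)
        finally show ?thesis .
      qed
      ultimately show "w \<in> ?R" by blast
    qed
  qed
  moreover have "a (bullets M) / forest_sigma (bullets M) =
      (\<Sum>w | word_deg \<nu> w \<le> n \<and> mset (map \<nu> w) = bullets M. h w)"
    unfolding isomorphic_at_coefficient[OF iso, of "bullets M", unfolded forest_deg_bullets, OF assms(2)]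
    by (rule sum.mono_neutral_cong_right) (auto simp: finite_words gl_word_bullets)
  moreover have "inj_on (map \<iota>) {is. mset is = M}"
    using inj_\<iota> by (auto intro: inj_on_subset[OF inj_mapI])
  ultimately show ?thesis
    by (simp add: bullets_coeff_def sum.reindex)
qed

lemma isomorphic_at_corolla:
  assumes iso: "isomorphic_at \<nu> n a h" and "size M < n"
  shows "a {#corolla i M#} / forest_sigma (bullets M) = tree_coeff h (corolla i M)"
proof -
  have deg: "forest_deg {#corolla i M#} \<le> n"
    using assms(2) by (simp add: corolla_def tree_deg_Node del: tree_deg.simps)
  have sigma: "forest_sigma {#corolla i M#} = forest_sigma (bullets M)"
    by (simp add: forest_sigma_add corolla_def tree_sigma_Node del: tree_sigma.simps)
  let ?P = "\<lambda>w. w \<noteq> [] \<and> tree_label (\<nu> (last w)) = i \<and>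
    mset (map \<nu> (butlast w)) + branches (\<nu> (last w)) = bullets M"
  let ?f = "\<lambda>q. map \<iota> (fst q) @ [snd q]"
  let ?S = "{q. root_graft (\<nu> (snd q)) (mset (fst q)) = corolla i M}"
  have "{w. word_deg \<nu> w \<le> n \<and> ?P w} = ?f ` ?S" (is "?L = ?R")
  proof
    show "?R \<subseteq> ?L"
    proof
      fix w assume "w \<in> ?R"
      then obtain js k where w: "w = map \<iota> js @ [k]" and eq: "root_graft (\<nu> k) (mset js) = corolla i M"
        by auto
      have "tree_deg (\<nu> k) + size (mset js) = tree_deg (corolla i M)"
        unfolding eq[symmetric] by (simp add: tree_deg_root_graft)
      then have "word_deg \<nu> w \<le> n"
        using deg by (simp add: w word_deg_\<iota>)
      then show "w \<in> ?L"
        using eq by (auto simp: w root_graft_def corolla_def multiset.map_comp comp_def \<nu>_\<iota> ac_simps)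
    qed
    show "?L \<subseteq> ?R"
    proof
      fix w assume w: "w \<in> ?L"
      then obtain u k where u: "w = u @ [k]" by (cases w rule: rev_cases) auto
      have eq: "mset (map \<nu> u) + branches (\<nu> k) = bullets M"
        using w by (simp add: u)
      then have "mset (map \<nu> u) \<subseteq># bullets M"
        by (metis mset_subset_eq_add_left)
      then obtain js where js: "u = map \<iota> js"
        using eq_map_\<iota> by blast
      then have "mset (map \<nu> u) = bullets (mset js)"
        by (metis map_\<nu>_\<iota> mset_map)
      then have "root_graft (\<nu> k) (mset js) = corolla i M"
        using w eq by (simp add: u root_graft_def corolla_def ac_simps)
      then show "w \<in> ?R"
        by (intro image_eqI[of _ _ "(js, k)"]) (simp_all add: u js)
    qed
  qed
  moreover have "a {#corolla i M#} / forest_sigma (bullets M) = (\<Sum>w | word_deg \<nu> w \<le> n \<and> ?P w. h w)"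
    unfolding sigma[symmetric] isomorphic_at_coefficient[OF iso deg]
    by (rule sum.mono_neutral_cong_right)
      (auto simp: finite_words gl_word_tree corolla_def last_map map_butlast)
  moreover have "inj_on ?f ?S"
    using inj_\<iota> by (auto simp: inj_on_def prod_eq_iff inj_map_eq_map)
  ultimately show ?thesis
    by (simp add: tree_coeff_def sum.reindex case_prod_unfold)
qed

text \<open>A cut behind the last letter \<open>k\<close> leaves nothing on the right; every other
  cut leaves \<open>k\<close> at the end of the right part and cuts the letters in front of
  it.\<close>

lemma mult_snoc:
  assumes h: "h (map \<iota> js @ [k]) = (\<Sum>(u, v) | u @ v = map \<iota> js @ [k]. h1 u * h2 v)"
    and "h2 [] = (1 :: real)"
  shows "h (map \<iota> js @ [k]) = h1 (map \<iota> js @ [k]) +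
    (\<Sum>q | fst q @ snd q = js. h1 (map \<iota> (fst q)) * h2 (map \<iota> (snd q) @ [k]))"
proof -
  let ?f = "\<lambda>q. (map \<iota> (fst q), map \<iota> (snd q) @ [k])"
  have eq: "{(u, v). u @ v = map \<iota> js @ [k]} = insert (map \<iota> js @ [k], []) (?f ` {q. fst q @ snd q = js})" (is "?L = ?R")
  proof
    show "?R \<subseteq> ?L" by auto
    show "?L \<subseteq> ?R"
    proof
      fix p assume "p \<in> ?L"
      then obtain u v where p: "p = (u, v)" "u @ v = map \<iota> js @ [k]" by auto
      show "p \<in> ?R"
      proof (cases v rule: rev_cases)
        case Nil
        then show ?thesis using p by simp
      next
        case (snoc v' k')
        then have "map \<iota> js = u @ v'" "k' = k" using p by (auto simp flip: append_assoc)
        then obtain a b where "js = a @ b" "map \<iota> a = u" "map \<iota> b = v'"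
          by (metis map_eq_append_conv)
        then show ?thesis
          using p snoc \<open>k' = k\<close> by (intro insertI2 image_eqI[of _ _ "(a, b)"]) auto
      qed
    qed
  qed
  have inj: "inj_on ?f {q. fst q @ snd q = js}"
    using inj_\<iota> by (auto simp: inj_on_def prod_eq_iff inj_map_eq_map)
  show ?thesis
    unfolding h eq using assms(2) finite_splits[of js]
    by (subst sum.insert) (auto simp: sum.reindex[OF inj])
qed

text \<open>The counterpart of \<open>character_mult_corolla\<close> on the side of words, with the
  same index set. Cutting a word amounts to splitting the leaves first, then ordering the left ones
  and choosing a word for the right ones.\<close>

lemma tree_coeff_mult:
  assumes h: "\<And>w. word_deg \<nu> w \<le> n \<Longrightarrow> h w = (\<Sum>(u, v) | u @ v = w. h1 u * h2 v)"
    and "size M < n" and "h2 [] = 1"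
  shows "tree_coeff h (corolla i M) = tree_coeff h1 (corolla i M) + (\<Sum>p | fst p + snd p = M. bullets_coeff h1 (fst p) * tree_coeff h2 (corolla i (snd p)))"
proof -
  let ?Q = "\<lambda>\<tau>. {q. root_graft (\<nu> (snd q)) (mset (fst q)) = \<tau>}"
  let ?\<tau> = "corolla i M"
  have deg: "word_deg \<nu> (map \<iota> (fst q) @ [snd q]) \<le> n" if "q \<in> ?Q ?\<tau>" for q
  proof -
    have "tree_deg (\<nu> (snd q)) + size (mset (fst q)) = tree_deg ?\<tau>"
      using that tree_deg_root_graft[of "\<nu> (snd q)" "mset (fst q)"] by simp
    then show ?thesis
      using assms(2) by (simp add: word_deg_\<iota> corolla_def tree_deg_Node del: tree_deg.simps)
  qed
  let ?A = "SIGMA q : ?Q ?\<tau>. {r. fst r @ snd r = fst q}"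
  let ?B = "SIGMA p : {p. fst p + snd p = M}. {js. mset js = fst p} \<times> ?Q (corolla i (snd p))"
  have "tree_coeff h ?\<tau> = (\<Sum>q\<in>?Q ?\<tau>. h1 (map \<iota> (fst q) @ [snd q]) +
      (\<Sum>r | fst r @ snd r = fst q. h1 (map \<iota> (fst r)) * h2 (map \<iota> (snd r) @ [snd q])))"
    unfolding tree_coeff_def case_prod_unfold
    by (intro sum.cong refl mult_snoc h assms(3)) (use deg in simp)
  also have "\<dots> = tree_coeff h1 ?\<tau> + (\<Sum>(q, r)\<in>?A. h1 (map \<iota> (fst r)) * h2 (map \<iota> (snd r) @ [snd q]))"
    by (subst sum.distrib, subst sum.Sigma)
      (auto simp: tree_coeff_def case_prod_unfold finite_graft_words finite_splits)
  also have "(\<Sum>(q, r)\<in>?A. h1 (map \<iota> (fst r)) * h2 (map \<iota> (snd r) @ [snd q])) =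
      (\<Sum>(p, js, q)\<in>?B. h1 (map \<iota> js) * h2 (map \<iota> (fst q) @ [snd q]))"
  \<comment> \<open>The splitting of the leaves is recovered from a cut word as the labels of the
    left piece and the rest of \<open>M\<close>; conversely the pieces are concatenated.\<close>
  proof (rule sum.reindex_bij_witness[of _
        "\<lambda>(p, js, q). ((js @ fst q, snd q), (js, fst q))"
        "\<lambda>(q, r). ((mset (fst r), M - mset (fst r)), fst r, (snd r, snd q))"])
    fix x assume "x \<in> ?A"
    then obtain k u v where x: "x = ((u @ v, k), (u, v))" "root_graft (\<nu> k) (mset u + mset v) = corolla i M"
      by (cases x) auto
    then obtain M' where "M = mset u + M'" "root_graft (\<nu> k) (mset v) = corolla i M'"
      by (auto simp: root_graft_eq_corolla)
    then show "(case x of (q, r) \<Rightarrow> ((mset (fst r), M - mset (fst r)), fst r, (snd r, snd q))) \<in> ?B"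
      by (simp add: x(1))
    show "(case case x of (q, r) \<Rightarrow> ((mset (fst r), M - mset (fst r)), fst r, (snd r, snd q)) of
        (p, js, q) \<Rightarrow> ((js @ fst q, snd q), (js, fst q))) = x"
      by (simp add: x(1))
    show "(case case x of (q, r) \<Rightarrow> ((mset (fst r), M - mset (fst r)), fst r, (snd r, snd q)) of
        (p, js, q) \<Rightarrow> h1 (map \<iota> js) * h2 (map \<iota> (fst q) @ [snd q])) =
        (case x of (q, r) \<Rightarrow> h1 (map \<iota> (fst r)) * h2 (map \<iota> (snd r) @ [snd q]))"
      by (simp add: x(1))
  next
    fix y assume "y \<in> ?B"
    then obtain M' js v k where y: "y = ((mset js, M'), js, (v, k))" "mset js + M' = M"
      "root_graft (\<nu> k) (mset v) = corolla i M'"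
      by (cases y) auto
    then have "root_graft (\<nu> k) (mset js + mset v) = corolla i M"
      by (auto simp: root_graft_eq_corolla)
    then show "(case y of (p, js, q) \<Rightarrow> ((js @ fst q, snd q), (js, fst q))) \<in> ?A"
      by (simp add: y(1))
    show "(case case y of (p, js, q) \<Rightarrow> ((js @ fst q, snd q), (js, fst q)) of
        (q, r) \<Rightarrow> ((mset (fst r), M - mset (fst r)), fst r, (snd r, snd q))) = y"
      using y(2) by (auto simp: y(1))
  qed
  also have "\<dots> = (\<Sum>p | fst p + snd p = M. \<Sum>(js, q)\<in>{js. mset js = fst p} \<times> ?Q (corolla i (snd p)).
      h1 (map \<iota> js) * h2 (map \<iota> (fst q) @ [snd q]))"
    by (subst sum.Sigma) (auto simp: finite_mset_splits finite_mset_lists finite_graft_words case_prod_unfold)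
  also have "\<dots> = (\<Sum>p | fst p + snd p = M. bullets_coeff h1 (fst p) * tree_coeff h2 (corolla i (snd p)))"
    by (simp add: bullets_coeff_def tree_coeff_def sum_product sum.cartesian_product case_prod_unfold)
  finally show ?thesis .
qed

end

section \<open>Symmetry of higher derivatives and Taylor's formula\<close>

text \<open>The second difference is the increment over \<open>[0, t]\<close> of the function
  mapping \<open>s\<close> to \<open>h (x + s u + t v) - h (x + s u)\<close>. Its derivative is
  expanded to first order around \<open>x\<close> only, which makes differentiability of the first
  derivative at this one point enough.\<close>

lemma second_difference_quotient:
  fixes h :: "'a::real_normed_vector \<Rightarrow> 'b::real_normed_vector"
  assumes h: "\<And>y. h differentiable (at y)"
    and L: "((\<lambda>y. frechet_derivative h (at y) u) has_derivative L) (at x)"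
    and "0 < \<epsilon>"
  shows "\<exists>d>0. \<forall>t. 0 < t \<and> t < d \<longrightarrow>
    norm (h (x + t *\<^sub>R u + t *\<^sub>R v) - h (x + t *\<^sub>R u) - h (x + t *\<^sub>R v) + h x - t\<^sup>2 *\<^sub>R L v) \<le> \<epsilon> * t\<^sup>2"
proof -
  define B where "B = norm u + norm v + 1"
  have B: "0 < B" by (simp add: B_def add_nonneg_pos)
  define f where "f y = frechet_derivative h (at y) u" for y
  have lin: "bounded_linear L" using L by (rule has_derivative_bounded_linear)
  have "0 < \<epsilon> / (2 * B)" using assms(3) B by simp
  then obtain d where d: "0 < d"
    "\<And>y. norm (y - x) < d \<Longrightarrow> norm (f y - f x - L (y - x)) \<le> \<epsilon> / (2 * B) * norm (y - x)"
    using L unfolding has_derivative_at_alt f_def by blast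
  have "norm (h (x + t *\<^sub>R u + t *\<^sub>R v) - h (x + t *\<^sub>R u) - h (x + t *\<^sub>R v) + h x - t\<^sup>2 *\<^sub>R L v) \<le> \<epsilon> * t\<^sup>2"
    if t: "0 < t" "t < d / B" for t
  proof -
    have near: "norm (f (x + s *\<^sub>R u + r *\<^sub>R v) - f x - L (s *\<^sub>R u + r *\<^sub>R v)) \<le> \<epsilon> * t / 2"
      if s: "s \<in> {0..t}" and r: "r \<in> {0..t}" for s r
    proof -
      have "norm (s *\<^sub>R u + r *\<^sub>R v) \<le> t * norm u + t * norm v"
        using s r by (intro norm_triangle_le) (auto intro!: add_mono mult_right_mono)
      also have "\<dots> \<le> t * B" using t(1) by (simp add: B_def algebra_simps)
      finally have le: "norm (s *\<^sub>R u + r *\<^sub>R v) \<le> t * B" .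
      also have "t * B < d" using t(2) B by (simp add: field_simps)
      finally have "norm (f (x + s *\<^sub>R u + r *\<^sub>R v) - f x - L (s *\<^sub>R u + r *\<^sub>R v)) \<le>
          \<epsilon> / (2 * B) * norm (s *\<^sub>R u + r *\<^sub>R v)"
        using d(2)[of "x + s *\<^sub>R u + r *\<^sub>R v"] by (simp add: add.assoc)
      also have "\<dots> \<le> \<epsilon> / (2 * B) * (t * B)"
        using le assms(3) B by (intro mult_left_mono) auto
      also have "\<dots> = \<epsilon> * t / 2" using B by simp
      finally show ?thesis .
    qed
    \<comment> \<open>Subtracting the expected value linearly in \<open>s\<close> leaves a
      derivative of size at most \<open>\<epsilon> * t\<close>; the mean value inequality supplies
      the second factor \<open>t\<close>.\<close>
    define \<psi> where "\<psi> s = h (x + s *\<^sub>R u + t *\<^sub>R v) - h (x + s *\<^sub>R u) - (s * t) *\<^sub>R L v" for s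
    define \<psi>' where "\<psi>' s = f (x + s *\<^sub>R u + t *\<^sub>R v) - f (x + s *\<^sub>R u) - t *\<^sub>R L v" for s
    have hd: "((\<lambda>s. h (a + s *\<^sub>R u)) has_derivative (\<lambda>r. r *\<^sub>R f (a + s *\<^sub>R u))) (at s within {0..t})" for a s
    proof -
      have hD: "(h has_derivative frechet_derivative h (at y)) (at y)" for y
        using h frechet_derivative_works by blast
      have "((\<lambda>s. h (a + s *\<^sub>R u)) has_derivative (\<lambda>r. frechet_derivative h (at (a + s *\<^sub>R u)) (r *\<^sub>R u))) (at s within {0..t})"
        by (rule has_derivative_compose[OF _ hD]) (auto intro!: derivative_eq_intros)
      then show ?thesis
        by (simp add: f_def linear_cmul[OF has_derivative_linear[OF hD]])
    qed
    have der: "(\<psi> has_derivative (\<lambda>r. r *\<^sub>R \<psi>' s)) (at s within {0..t})" for s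
    proof -
      have "((\<lambda>s. h ((x + t *\<^sub>R v) + s *\<^sub>R u) - h (x + s *\<^sub>R u) - (s * t) *\<^sub>R L v) has_derivative
          (\<lambda>r. r *\<^sub>R f ((x + t *\<^sub>R v) + s *\<^sub>R u) - r *\<^sub>R f (x + s *\<^sub>R u) - (r * t) *\<^sub>R L v)) (at s within {0..t})"
        by (intro has_derivative_diff hd) (auto intro!: derivative_eq_intros)
      then show ?thesis
        by (simp add: \<psi>_def[abs_def] \<psi>'_def algebra_simps)
    qed
    have bd: "onorm (\<lambda>r. r *\<^sub>R \<psi>' s) \<le> \<epsilon> * t" if s: "s \<in> {0..t}" for s
    proof -
      have eq: "\<psi>' s = (f (x + s *\<^sub>R u + t *\<^sub>R v) - f x - L (s *\<^sub>R u + t *\<^sub>R v)) -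
          (f (x + s *\<^sub>R u + 0 *\<^sub>R v) - f x - L (s *\<^sub>R u + 0 *\<^sub>R v))"
        using linear_add[OF bounded_linear.linear[OF lin]] linear_cmul[OF bounded_linear.linear[OF lin]]
        by (simp add: \<psi>'_def)
      have "norm (\<psi>' s) \<le> \<epsilon> * t / 2 + \<epsilon> * t / 2"
        unfolding eq by (rule order_trans[OF norm_triangle_ineq4 add_mono[OF near near]]) (use s t in auto)
      then have "norm (\<psi>' s) \<le> \<epsilon> * t" by simp
      then show ?thesis
        by (intro onorm_le) (simp add: mult.commute mult_left_mono)
    qed
    have "norm (\<psi> t - \<psi> 0) \<le> \<epsilon> * t * norm (t - 0)"
      by (rule differentiable_bound[OF convex_real_interval(5) der bd]) (use t in auto)
    moreover have "\<psi> t - \<psi> 0 =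
        h (x + t *\<^sub>R u + t *\<^sub>R v) - h (x + t *\<^sub>R u) - h (x + t *\<^sub>R v) + h x - t\<^sup>2 *\<^sub>R L v"
      by (simp add: \<psi>_def power2_eq_square)
    ultimately show ?thesis
      using t(1) by (simp add: power2_eq_square mult.assoc)
  qed
  moreover have "0 < d / B" using d B by simp
  ultimately show ?thesis by blast
qed

text \<open>The second difference is symmetric in \<open>u\<close> and \<open>v\<close>, and both
  second derivatives are its limit after division by \<open>t\<^sup>2\<close>.\<close>

lemma symmetric_second_derivative:
  fixes h :: "'a::real_normed_vector \<Rightarrow> 'b::real_normed_vector"
  assumes h: "\<And>y. h differentiable (at y)"
    and u: "(\<lambda>y. frechet_derivative h (at y) u) differentiable (at x)"
    and v: "(\<lambda>y. frechet_derivative h (at y) v) differentiable (at x)"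
  shows "frechet_derivative (\<lambda>y. frechet_derivative h (at y) u) (at x) v =
    frechet_derivative (\<lambda>y. frechet_derivative h (at y) v) (at x) u"
proof -
  define L where "L = frechet_derivative (\<lambda>y. frechet_derivative h (at y) u) (at x)"
  define R where "R = frechet_derivative (\<lambda>y. frechet_derivative h (at y) v) (at x)"
  have L: "((\<lambda>y. frechet_derivative h (at y) u) has_derivative L) (at x)"
    and R: "((\<lambda>y. frechet_derivative h (at y) v) has_derivative R) (at x)"
    using u v unfolding L_def R_def by (simp_all add: frechet_derivative_works)
  have "norm (L v - R u) \<le> 2 * \<epsilon>" if \<epsilon>: "0 < \<epsilon>" for \<epsilon>
  proof -
    let ?G = "\<lambda>t. h (x + t *\<^sub>R u + t *\<^sub>R v) - h (x + t *\<^sub>R u) - h (x + t *\<^sub>R v) + h x"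
    obtain d where d: "0 < d" "\<And>t. 0 < t \<Longrightarrow> t < d \<Longrightarrow> norm (?G t - t\<^sup>2 *\<^sub>R L v) \<le> \<epsilon> * t\<^sup>2"
      using second_difference_quotient[OF h L \<epsilon>, of v] by blast
    obtain d' where d': "0 < d'" "\<And>t. 0 < t \<Longrightarrow> t < d' \<Longrightarrow>
        norm (h (x + t *\<^sub>R v + t *\<^sub>R u) - h (x + t *\<^sub>R v) - h (x + t *\<^sub>R u) + h x - t\<^sup>2 *\<^sub>R R u) \<le> \<epsilon> * t\<^sup>2"
      using second_difference_quotient[OF h R \<epsilon>, of u] by blast
    define t where "t = min d d' / 2"
    have t: "0 < t" "t < d" "t < d'" using d(1) d'(1) by (auto simp: t_def)
    have 1: "norm (?G t - t\<^sup>2 *\<^sub>R L v) \<le> \<epsilon> * t\<^sup>2" using d(2) t by blast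
    have 2: "norm (?G t - t\<^sup>2 *\<^sub>R R u) \<le> \<epsilon> * t\<^sup>2"
      using d'(2)[OF t(1,3)] by (simp add: algebra_simps)
    have "t\<^sup>2 * norm (L v - R u) = norm ((?G t - t\<^sup>2 *\<^sub>R R u) - (?G t - t\<^sup>2 *\<^sub>R L v))"
      using t(1) by (simp add: scaleR_diff_right[symmetric])
    also have "\<dots> \<le> \<epsilon> * t\<^sup>2 + \<epsilon> * t\<^sup>2"
      by (rule order_trans[OF norm_triangle_ineq4 add_mono[OF 2 1]])
    finally have "t\<^sup>2 * norm (L v - R u) \<le> t\<^sup>2 * (2 * \<epsilon>)" by (simp add: algebra_simps)
    then show ?thesis using t(1) by simp
  qed
  then have "norm (L v - R u) \<le> 0"
    using field_le_epsilon[of "norm (L v - R u)" 0] by (metis add_0 field_sum_of_halves mult_2 half_gt_zero)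
  then show ?thesis by (simp add: L_def R_def)
qed

text \<open>The differentiability part of \<open>is_lip\<close> with the order as a parameter; it
  asks for existence of the derivatives, not for continuity of those of order
  \<open>n\<close>.\<close>

definition n_differentiable :: "nat \<Rightarrow> ('a::real_normed_vector \<Rightarrow> 'b::real_normed_vector) \<Rightarrow> bool"
  where "n_differentiable n h \<longleftrightarrow> (\<forall>vs x. length vs < n \<longrightarrow> nth_deriv h vs differentiable (at x))"

lemma nth_deriv_append: "nth_deriv h (us @ vs) = nth_deriv (nth_deriv h vs) us"
  by (induction us) simp_all

text \<open>The head of the list is the derivative taken last, so \<open>v\<close> moves outwards by
  exchanging it with one neighbour at a time.\<close>

lemma nth_deriv_move_to_front:
  assumes "n_differentiable n h" and "length us + length vs < n"
  shows "nth_deriv h (us @ v # vs) = nth_deriv h (v # us @ vs)"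
  using assms(2)
proof (induction us)
  case (Cons u us)
  have diff: "nth_deriv h ws differentiable (at x)" if "length ws < n" for ws x
    using assms(1) that by (simp add: n_differentiable_def)
  have "nth_deriv h (u # us @ v # vs) = nth_deriv h (u # v # us @ vs)"
    using Cons by simp
  also have "\<dots> = nth_deriv h (v # u # us @ vs)"
  proof
    fix x
    show "nth_deriv h (u # v # us @ vs) x = nth_deriv h (v # u # us @ vs) x"
      using symmetric_second_derivative[of "nth_deriv h (us @ vs)" u x v]
        diff[of "us @ vs"] diff[of "u # us @ vs"] diff[of "v # us @ vs"] Cons.prems by simp
  qed
  finally show ?case by simp
qed simp

lemma nth_deriv_mset_cong:
  assumes "n_differentiable n h" and "mset us = mset vs" and "length us \<le> n"
  shows "nth_deriv h us = nth_deriv h vs"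
  using assms(2,3)
proof (induction us arbitrary: vs)
  case (Cons u us)
  then have "u \<in> set vs" by (metis list.set_intros(1) mset_eq_setD)
  then obtain as bs where vs: "vs = as @ u # bs" by (meson split_list)
  have len: "length us = length as + length bs"
    using mset_eq_length[OF Cons.prems(1)] by (simp add: vs)
  have "nth_deriv h us = nth_deriv h (as @ bs)"
    using Cons.prems by (intro Cons.IH) (simp_all add: vs)
  then have "nth_deriv h (u # us) = nth_deriv h (u # as @ bs)" by simp
  also have "\<dots> = nth_deriv h vs"
    unfolding vs using Cons.prems(2) len by (intro nth_deriv_move_to_front[OF assms(1), symmetric]) simp
  finally show ?case .
qed simp

lemma n_differentiable_nth_deriv:
  "n_differentiable n h \<Longrightarrow> length vs + m \<le> n \<Longrightarrow> n_differentiable m (nth_deriv h vs)"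
  by (simp add: n_differentiable_def flip: nth_deriv_append)

lemma part_deriv_append: "part_deriv h (is @ js) = part_deriv (part_deriv h js) is"
  by (simp add: part_deriv_def nth_deriv_append)

lemma part_deriv_mset_cong:
  "n_differentiable n h \<Longrightarrow> mset is = mset js \<Longrightarrow> length is \<le> n \<Longrightarrow> part_deriv h is = part_deriv h js"
  unfolding part_deriv_def by (rule nth_deriv_mset_cong) simp_all

lemma n_differentiable_part_deriv:
  "n_differentiable n h \<Longrightarrow> length is + m \<le> n \<Longrightarrow> n_differentiable m (part_deriv h is)"
  unfolding part_deriv_def by (rule n_differentiable_nth_deriv) simp_all

section \<open>Taylor's formula with coefficients that satisfy shuffle relations\<close>

lemma sum_lists_Suc:
  fixes c :: "'a::finite list \<Rightarrow> 'b::comm_monoid_add"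
  shows "(\<Sum>w | length w = Suc q. c w) = (\<Sum>i\<in>UNIV. \<Sum>w | length w = q. c (i # w))"
proof -
  have "{w :: 'a list. length w = Suc q} = (\<lambda>(i, w). i # w) ` (UNIV \<times> {w. length w = q})"
    by (auto simp: length_Suc_conv image_iff)
  moreover have "inj_on (\<lambda>(i, w). i # w) (UNIV \<times> {w :: 'a list. length w = q})"
    by (auto simp: inj_on_def)
  ultimately show ?thesis
    by (simp add: sum.reindex sum.cartesian_product case_prod_unfold)
qed

lemma finite_lists_of_length_le: "finite {w :: 'a::finite list. length w \<le> q}"
  using finite_lists_length_le[of "UNIV :: 'a set" q] by simp

text \<open>A word of length q + 1 arises by inserting a letter into a word of length q, once for
  each of its q + 1 positions. This is the source of the factorials in Taylor's formula.\<close>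

lemma sum_shuffle_letter:
  fixes c :: "'a::finite list \<Rightarrow> 'b::real_vector"
  shows "(\<Sum>i\<in>UNIV. \<Sum>w | length w = q. \<Sum>u\<in>#shuffle_mset [i] w. c u) =
    real (Suc q) *\<^sub>R (\<Sum>u | length u = Suc q. c u)"
proof (induction q arbitrary: c)
  case 0
  show ?case by (simp add: sum_lists_Suc)
next
  case (Suc q)
  have "(\<Sum>i\<in>UNIV. \<Sum>w | length w = Suc q. \<Sum>u\<in>#shuffle_mset [i] w. c u) =
      (\<Sum>i\<in>UNIV. \<Sum>y\<in>UNIV. \<Sum>w | length w = q. c (i # y # w)) +
      (\<Sum>i\<in>UNIV. \<Sum>y\<in>UNIV. \<Sum>w | length w = q. \<Sum>u\<in>#shuffle_mset [i] w. c (y # u))"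
    by (simp add: sum_lists_Suc multiset.map_comp comp_def sum.distrib)
  also have "(\<Sum>i\<in>UNIV. \<Sum>y\<in>UNIV. \<Sum>w | length w = q. \<Sum>u\<in>#shuffle_mset [i] w. c (y # u)) =
      (\<Sum>y\<in>UNIV. \<Sum>i\<in>UNIV. \<Sum>w | length w = q. \<Sum>u\<in>#shuffle_mset [i] w. c (y # u))"
    by (rule sum.swap)
  also have "\<dots> = real (Suc q) *\<^sub>R (\<Sum>u | length u = Suc (Suc q). c u)"
    unfolding Suc.IH[of "\<lambda>u. c (y # u)" for y] by (simp only: sum_lists_Suc[of _ "Suc q"] scaleR_sum_right)
  also have "(\<Sum>i\<in>UNIV. \<Sum>y\<in>UNIV. \<Sum>w | length w = q. c (i # y # w)) = (\<Sum>u | length u = Suc (Suc q). c u)"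
    by (simp add: sum_lists_Suc)
  finally show ?case
    by (simp only: of_nat_Suc[of "Suc q"] scaleR_left_distrib scaleR_one)
qed

text \<open>If \<open>z\<close> satisfies the shuffle relations with \<open>z [] = 1\<close> and
  \<open>h\<close> is q times differentiable, this is the q-th derivative of \<open>h\<close> at
  \<open>x\<close> applied to q copies of the vector of the numbers \<open>z [i]\<close>, divided by
  q!. It is used through the recursion \<open>taylor_term_Suc\<close>.\<close>

definition taylor_term ::
    "('d::finite list \<Rightarrow> real) \<Rightarrow> nat \<Rightarrow> (real^'d \<Rightarrow> 'b::real_normed_vector) \<Rightarrow> real^'d \<Rightarrow> 'b"
  where "taylor_term z q h x = (\<Sum>w | length w = q. z w *\<^sub>R part_deriv h w x)"

text \<open>Partial derivatives commute, so all words in the shuffle of \<open>[i]\<close> and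
  \<open>w\<close> carry the same derivative and their coefficients add up to
  \<open>z [i] * z w\<close>; \<open>sum_shuffle_letter\<close> counts how often each word
  arises.\<close>

lemma taylor_term_Suc:
  assumes h: "n_differentiable (Suc q) h"
    and z: "\<And>i w. length w = q \<Longrightarrow> z [i] * z w = (\<Sum>u\<in>#shuffle_mset [i] w. z u)"
  shows "real (Suc q) *\<^sub>R taylor_term z (Suc q) h x =
    (\<Sum>i\<in>UNIV. z [i] *\<^sub>R taylor_term z q (part_deriv h [i]) x)"
proof -
  have eq: "(z [i] * z w) *\<^sub>R part_deriv h (w @ [i]) x = (\<Sum>u\<in>#shuffle_mset [i] w. z u *\<^sub>R part_deriv h u x)"
    if w: "length w = q" for i w
  proof -
    have "(\<Sum>u\<in>#shuffle_mset [i] w. z u *\<^sub>R part_deriv h u x) =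
        (\<Sum>u\<in>#shuffle_mset [i] w. z u *\<^sub>R part_deriv h (w @ [i]) x)"
    proof (intro sum_mset_cong)
      fix u assume "u \<in># shuffle_mset [i] w"
      then have "mset u = mset (w @ [i])" by (simp add: mset_shuffle_mset)
      moreover from mset_eq_length[OF this] have "length u \<le> Suc q" using w by simp
      ultimately have "part_deriv h u = part_deriv h (w @ [i])"
        by (rule part_deriv_mset_cong[OF h])
      then show "z u *\<^sub>R part_deriv h u x = z u *\<^sub>R part_deriv h (w @ [i]) x" by simp
    qed
    also have "\<dots> = (\<Sum>u\<in>#shuffle_mset [i] w. z u) *\<^sub>R part_deriv h (w @ [i]) x"
    proof -
      have "(\<Sum>u\<in>#A. z u *\<^sub>R v) = (\<Sum>u\<in>#A. z u) *\<^sub>R v" for A and v :: 'b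
        by (induction A) (auto simp: scaleR_left_distrib)
      then show ?thesis .
    qed
    finally show ?thesis using z[OF w] by simp
  qed
  have "(\<Sum>i\<in>UNIV. z [i] *\<^sub>R taylor_term z q (part_deriv h [i]) x) =
      (\<Sum>i\<in>UNIV. \<Sum>w | length w = q. (z [i] * z w) *\<^sub>R part_deriv h (w @ [i]) x)"
    by (simp add: taylor_term_def scaleR_sum_right part_deriv_append)
  also have "\<dots> = (\<Sum>i\<in>UNIV. \<Sum>w | length w = q. \<Sum>u\<in>#shuffle_mset [i] w. z u *\<^sub>R part_deriv h u x)"
    by (intro sum.cong refl eq) simp
  also have "\<dots> = real (Suc q) *\<^sub>R taylor_term z (Suc q) h x"
    unfolding taylor_term_def by (rule sum_shuffle_letter)
  finally show ?thesis by simp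
qed

lemma vec_sum_axis: "(\<chi> i. z i) = (\<Sum>i\<in>UNIV. z i *\<^sub>R (axis i 1 :: real^'d::finite))"
  by (simp add: vec_eq_iff axis_def if_distrib[of "\<lambda>x. _ * x"] cong: if_cong)

text \<open>The remainder is differentiated along the segment from \<open>x\<close> to \<open>x + (z [i])\<^sub>i\<close>, which lowers
  the order by one.\<close>

lemma taylor_remainder:
  fixes h :: "real^'d::finite \<Rightarrow> 'b::real_normed_vector"
  assumes "n_differentiable r h"
    and "\<And>w x y. length w = r \<Longrightarrow> norm (part_deriv h w x - part_deriv h w y) \<le> C * norm (x - y) powr \<kappa>"
    and z: "\<And>i w. length w < r \<Longrightarrow> z [i] * z w = (\<Sum>u\<in>#shuffle_mset [i] w. z u)" and z0: "z [] = 1"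
    and N: "\<And>i. \<bar>z [i]\<bar> \<le> N" and C: "0 \<le> C" and \<kappa>: "0 < \<kappa>" and s: "s \<in> {0..1}"
  shows "norm (h (x + s *\<^sub>R (\<chi> i. z [i])) - (\<Sum>q\<le>r. s ^ q *\<^sub>R taylor_term z q h x)) \<le>
    C * (real CARD('d) * N) ^ r * (real CARD('d) * N) powr \<kappa>"
  using assms(1-3) s
proof (induction r arbitrary: h s)
  case 0
  let ?z = "\<chi> i. z [i]"
  have N0: "0 \<le> N" using N[of undefined] by linarith
  have "norm ?z \<le> (\<Sum>i\<in>UNIV. \<bar>?z $ i\<bar>)" by (rule norm_le_l1_cart)
  also have "\<dots> \<le> real CARD('d) * N"
    using N by (simp add: sum_bounded_above)
  finally have "s * norm ?z \<le> 1 * (real CARD('d) * N)"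
    using 0 by (intro mult_mono) auto
  then have le: "norm ((x + s *\<^sub>R ?z) - x) powr \<kappa> \<le> (real CARD('d) * N) powr \<kappa>"
    using 0 \<kappa> by (intro powr_mono2) auto
  have "norm (part_deriv h [] (x + s *\<^sub>R ?z) - part_deriv h [] x) \<le> C * norm ((x + s *\<^sub>R ?z) - x) powr \<kappa>"
    by (rule 0(2)) simp
  also have "\<dots> \<le> C * (real CARD('d) * N) powr \<kappa>"
    by (rule mult_left_mono[OF le C])
  finally show ?case
    by (simp add: taylor_term_def z0 part_deriv_def)
next
  case (Suc r)
  let ?z = "\<chi> i. z [i]"
  have N0: "0 \<le> N" using N[of undefined] by linarith
  let ?K = "C * (real CARD('d) * N) ^ r * (real CARD('d) * N) powr \<kappa>"
  define R where "R s = h (x + s *\<^sub>R ?z) - (\<Sum>q\<le>Suc r. s ^ q *\<^sub>R taylor_term z q h x)" for s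
  \<comment> \<open>These are the remainders of order \<open>r\<close> of the partial derivatives.
    Differentiating \<open>s ^ q\<close> brings down the factor \<open>q\<close> that
    \<open>taylor_term_Suc\<close> absorbs, so the derivative of \<open>R\<close> is the sum of
    \<open>z [i] *\<^sub>R R' i\<close>. The mean value inequality needs their bound along the whole
    segment, hence the parameter \<open>s\<close> in the induction.\<close>
  define R' where "R' i s = part_deriv h [i] (x + s *\<^sub>R ?z) -
    (\<Sum>q\<le>r. s ^ q *\<^sub>R taylor_term z q (part_deriv h [i]) x)" for i s
  have R': "norm (R' i s) \<le> ?K" if s: "s \<in> {0..1}" for i s
    unfolding R'_def
  proof (rule Suc.IH[OF _ _ _ s])
    show "n_differentiable r (part_deriv h [i])"
      by (rule n_differentiable_part_deriv[OF Suc.prems(1)]) simp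
    show "norm (part_deriv (part_deriv h [i]) w x - part_deriv (part_deriv h [i]) w y) \<le> C * norm (x - y) powr \<kappa>"
      if "length w = r" for w x y
      using Suc.prems(2)[of "w @ [i]" x y] that by (simp add: part_deriv_append)
  qed (use Suc.prems(3) in auto)
  have der: "(R has_derivative (\<lambda>t. t *\<^sub>R (\<Sum>i\<in>UNIV. z [i] *\<^sub>R R' i s))) (at s within {0..1})" for s
  proof -
    have hD: "(h has_derivative frechet_derivative h (at y)) (at y)" for y
      using Suc.prems(1)[unfolded n_differentiable_def, rule_format, of "[]" y]
      by (simp add: frechet_derivative_works)
    note lin = has_derivative_linear[OF hD]
    have "((\<lambda>s. h (x + s *\<^sub>R ?z)) has_derivative (\<lambda>t. frechet_derivative h (at (x + s *\<^sub>R ?z)) (t *\<^sub>R ?z)))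
        (at s within {0..1})"
      by (rule has_derivative_compose[OF _ hD]) (auto intro!: derivative_eq_intros)
    moreover have "frechet_derivative h (at y) (t *\<^sub>R ?z) = t *\<^sub>R (\<Sum>i\<in>UNIV. z [i] *\<^sub>R part_deriv h [i] y)" for t y
      by (simp add: vec_sum_axis linear_cmul[OF lin] linear_sum[OF lin] part_deriv_def)
    ultimately have h': "((\<lambda>s. h (x + s *\<^sub>R ?z)) has_derivative
        (\<lambda>t. t *\<^sub>R (\<Sum>i\<in>UNIV. z [i] *\<^sub>R part_deriv h [i] (x + s *\<^sub>R ?z)))) (at s within {0..1})"
      by simp
    have "((\<lambda>s. \<Sum>q\<le>Suc r. s ^ q *\<^sub>R taylor_term z q h x) has_derivative
        (\<lambda>t. \<Sum>q\<le>Suc r. (real q * t * s ^ (q - 1)) *\<^sub>R taylor_term z q h x)) (at s within {0..1})"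
      by (intro has_derivative_sum) (auto intro!: derivative_eq_intros simp: mult_ac)
    moreover have "(\<Sum>q\<le>Suc r. (real q * t * s ^ (q - 1)) *\<^sub>R taylor_term z q h x) =
        t *\<^sub>R (\<Sum>i\<in>UNIV. z [i] *\<^sub>R (\<Sum>q\<le>r. s ^ q *\<^sub>R taylor_term z q (part_deriv h [i]) x))" for t
    proof -
      have "(\<Sum>q\<le>Suc r. (real q * t * s ^ (q - 1)) *\<^sub>R taylor_term z q h x) =
          (\<Sum>q\<le>r. (t * s ^ q) *\<^sub>R (real (Suc q) *\<^sub>R taylor_term z (Suc q) h x))"
        unfolding sum.atMost_Suc_shift by (simp add: mult_ac del: of_nat_Suc)
      also have "\<dots> = (\<Sum>q\<le>r. (t * s ^ q) *\<^sub>R (\<Sum>i\<in>UNIV. z [i] *\<^sub>R taylor_term z q (part_deriv h [i]) x))"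
      proof (intro sum.cong refl arg_cong[where f = "scaleR _"] taylor_term_Suc)
        fix q assume "q \<in> {..r}"
        then show "n_differentiable (Suc q) h"
          using Suc.prems(1) by (auto simp: n_differentiable_def)
        show "z [i] * z w = (\<Sum>u\<in>#shuffle_mset [i] w. z u)" if "length w = q" for i w
          using that \<open>q \<in> {..r}\<close> by (intro Suc.prems(3)) auto
      qed
      also have "\<dots> = t *\<^sub>R (\<Sum>i\<in>UNIV. z [i] *\<^sub>R (\<Sum>q\<le>r. s ^ q *\<^sub>R taylor_term z q (part_deriv h [i]) x))"
        unfolding scaleR_sum_right by (subst sum.swap) (simp add: mult_ac)
      finally show ?thesis .
    qed
    ultimately have p': "((\<lambda>s. \<Sum>q\<le>Suc r. s ^ q *\<^sub>R taylor_term z q h x) has_derivative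
        (\<lambda>t. t *\<^sub>R (\<Sum>i\<in>UNIV. z [i] *\<^sub>R (\<Sum>q\<le>r. s ^ q *\<^sub>R taylor_term z q (part_deriv h [i]) x))))
        (at s within {0..1})"
      by simp
    show ?thesis
      using has_derivative_diff[OF h' p']
      by (simp add: R_def[abs_def] R'_def scaleR_diff_right sum_subtractf)
  qed
  have bd: "onorm (\<lambda>t. t *\<^sub>R (\<Sum>i\<in>UNIV. z [i] *\<^sub>R R' i s)) \<le> real CARD('d) * N * ?K" if s: "s \<in> {0..1}" for s
  proof (rule onorm_le)
    have "norm (\<Sum>i\<in>UNIV. z [i] *\<^sub>R R' i s) \<le> (\<Sum>i\<in>(UNIV::'d set). N * ?K)"
    proof (rule sum_norm_le)
      show "norm (z [i] *\<^sub>R R' i s) \<le> N * ?K" for i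
        using mult_mono[OF N[of i] R'[OF s, of i] N0] by simp
    qed
    then have "norm (\<Sum>i\<in>UNIV. z [i] *\<^sub>R R' i s) \<le> real CARD('d) * N * ?K"
      by simp
    then show "norm (t *\<^sub>R (\<Sum>i\<in>UNIV. z [i] *\<^sub>R R' i s)) \<le> real CARD('d) * N * ?K * norm t" for t
      using mult_left_mono[of _ _ "norm t"] by (simp only: norm_scaleR real_norm_def mult.commute[of _ "\<bar>t\<bar>"])
  qed
  have "norm (R s - R 0) \<le> real CARD('d) * N * ?K * norm (s - 0)"
    by (rule differentiable_bound[OF convex_real_interval(5) der bd]) (use Suc.prems(4) in auto)
  also have "\<dots> \<le> real CARD('d) * N * ?K * 1"
    using Suc.prems(4) N0 C by (intro mult_left_mono) auto
  \<comment> \<open>At \<open>s = 0\<close> only the term of order 0 remains, and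
    \<open>z [] = 1\<close> makes it \<open>h x\<close>.\<close>
  also have "R 0 = 0"
    unfolding R_def sum.atMost_Suc_shift by (simp add: taylor_term_def z0 part_deriv_def)
  finally show ?case
    by (simp add: R_def mult_ac)
qed

text \<open>Trades the extended suprema for one real constant that bounds both summands of the
  finite Lipschitz norm. The directions lie in the unit ball because \<open>multi_norm\<close> is a
  supremum over it.\<close>

lemma is_lip_bounds:
  assumes lip: "is_lip \<beta> f" and "0 < \<beta>"
  obtains L where "0 \<le> L"
    "\<And>vs x. length vs < strict_floor \<beta> \<Longrightarrow> nth_deriv f vs differentiable (at x)"
    "\<And>vs x. length vs \<le> strict_floor \<beta> \<Longrightarrow> (\<And>v. v \<in> set vs \<Longrightarrow> norm v \<le> 1) \<Longrightarrow> norm (nth_deriv f vs x) \<le> L"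
    "\<And>vs x y. length vs = strict_floor \<beta> \<Longrightarrow> (\<And>v. v \<in> set vs \<Longrightarrow> norm v \<le> 1) \<Longrightarrow>
      norm (nth_deriv f vs x - nth_deriv f vs y) \<le> L * norm (x - y) powr (\<beta> - strict_floor \<beta>)"
proof -
  let ?n = "strict_floor \<beta>"
  define S1 where "S1 = (SUP k\<in>{..?n}. SUP x. multi_norm k (\<lambda>vs. nth_deriv f vs x))"
  define S2 where "S2 = (SUP (x, y)\<in>{(x, y). x \<noteq> y}.
      multi_norm ?n (\<lambda>vs. nth_deriv f vs x - nth_deriv f vs y) / ennreal (norm (x - y) powr (\<beta> - ?n)))"
  have "S1 + S2 < \<infinity>"
    using lip by (simp add: is_lip_def lip_norm_def S1_def S2_def Let_def)
  then obtain L where L: "0 \<le> L" "S1 + S2 = ennreal L"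
    by (metis ennreal_cases infinity_ennreal_def less_irrefl)
  have S: "S1 \<le> ennreal L" "S2 \<le> ennreal L"
    using L(2) by (metis add_increasing2 order_refl zero_le) (metis add_increasing order_refl zero_le L(2))
  have mn: "ennreal (norm (A vs)) \<le> multi_norm (length vs) A" if "\<And>v. v \<in> set vs \<Longrightarrow> norm v \<le> 1"
    for vs and A :: "'a list \<Rightarrow> 'b"
    unfolding multi_norm_def by (rule SUP_upper) (use that in auto)
  show thesis
  proof
    show "nth_deriv f vs differentiable (at x)" if "length vs < ?n" for vs x
      using lip that by (simp add: is_lip_def)
    show "norm (nth_deriv f vs x) \<le> L"
      if "length vs \<le> ?n" "\<And>v. v \<in> set vs \<Longrightarrow> norm v \<le> 1" for vs x
    proof -
      have "ennreal (norm (nth_deriv f vs x)) \<le> multi_norm (length vs) (\<lambda>vs. nth_deriv f vs x)"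
        by (rule mn[OF that(2)])
      also have "\<dots> \<le> S1"
        unfolding S1_def by (rule order_trans[OF SUP_upper[of x] SUP_upper[of "length vs"]]) (use that in auto)
      also note S(1)
      finally show ?thesis using L(1) by simp
    qed
    show "norm (nth_deriv f vs x - nth_deriv f vs y) \<le> L * norm (x - y) powr (\<beta> - ?n)"
      if "length vs = ?n" "\<And>v. v \<in> set vs \<Longrightarrow> norm v \<le> 1" for vs x y
    proof (cases "x = y")
      case True
      then show ?thesis by simp
    next
      case False
      let ?d = "norm (x - y) powr (\<beta> - ?n)"
      have d: "0 < ?d" using False by simp
      have "ennreal (norm (nth_deriv f vs x - nth_deriv f vs y)) / ennreal ?d \<le>
          multi_norm ?n (\<lambda>vs. nth_deriv f vs x - nth_deriv f vs y) / ennreal ?d"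
        using mn[where vs = vs and A = "\<lambda>vs. nth_deriv f vs x - nth_deriv f vs y", OF that(2)] that(1)
        by (intro divide_right_mono_ennreal) simp
      also have "\<dots> \<le> S2"
        unfolding S2_def by (rule SUP_upper2[of "(x, y)"]) (use False in auto)
      also note S(2)
      finally have "ennreal (norm (nth_deriv f vs x - nth_deriv f vs y) / ?d) \<le> ennreal L"
        using d by (simp add: divide_ennreal)
      then have "norm (nth_deriv f vs x - nth_deriv f vs y) / ?d \<le> L"
        using L(1) by simp
      then show ?thesis
        using d by (simp add: divide_le_eq)
    qed
  qed (fact L(1))
qed

section \<open>The sewing lemma\<close>

text \<open>Recursive form of \<open>partition_sum\<close>, suited to splitting lists. Lists with
  fewer than two points give 0, so degenerate pieces need no exception.\<close>

fun chain_sum :: "(real \<Rightarrow> real \<Rightarrow> 'b::comm_monoid_add) \<Rightarrow> real list \<Rightarrow> 'b"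
  where
    "chain_sum \<Xi> (a # b # D) = \<Xi> a b + chain_sum \<Xi> (b # D)"
  | "chain_sum \<Xi> _ = 0"

lemma partition_sum_eq: "partition_sum \<Xi> D = chain_sum \<Xi> D"
proof (induction \<Xi> D rule: chain_sum.induct)
  case (1 \<Xi> a b D)
  have "partition_sum \<Xi> (a # b # D) = \<Xi> a b + partition_sum \<Xi> (b # D)"
    by (simp add: partition_sum_def sum.lessThan_Suc_shift del: sum.lessThan_Suc)
  then show ?case using 1 by simp
qed (simp_all add: partition_sum_def)

lemma chain_sum_append: "chain_sum \<Xi> (D @ m # D') = chain_sum \<Xi> (D @ [m]) + chain_sum \<Xi> (m # D')"
  by (induction \<Xi> D rule: chain_sum.induct) (simp_all add: add.assoc)

lemma chain_sum_append2:
  "D \<noteq> [] \<Longrightarrow> D' \<noteq> [] \<Longrightarrow>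
    chain_sum \<Xi> (D @ D') = chain_sum \<Xi> D + \<Xi> (last D) (hd D') + chain_sum \<Xi> D'"
  by (induction \<Xi> D rule: chain_sum.induct; cases D') (simp_all add: add.assoc)

lemma sorted_hd_last_bounds:
  fixes D :: "'a::linorder list"
  shows "sorted_wrt (<) D \<Longrightarrow> x \<in> set D \<Longrightarrow> hd D \<le> x \<and> x \<le> last D"
proof (induction D arbitrary: x rule: induct_list012)
  case (3 a b D)
  have "b \<le> last (b # D)" using "3.IH"(2)[of b] "3.prems"(1) by simp
  moreover have "a < b" using 3 by simp
  ultimately show ?case using "3.IH"(2)[of x] "3.prems" by (cases "x = a") auto
qed auto

text \<open>A discrete intermediate value argument: cut in front of the first point after the head
  that satisfies \<open>Q\<close>; its predecessor is the head or fails \<open>Q\<close>, and so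
  satisfies \<open>P\<close>.\<close>

lemma split_by_predicates:
  assumes "2 \<le> length D" and "P (hd D)" and "Q (last D)" and "\<And>x. x \<in> set D \<Longrightarrow> P x \<or> Q x"
  shows "\<exists>U V. D = U @ V \<and> U \<noteq> [] \<and> V \<noteq> [] \<and> P (last U) \<and> Q (hd V)"
  using assms
proof (induction D rule: induct_list012)
  case (3 x y D)
  show ?case
  proof (cases "Q y")
    case True
    then show ?thesis
      using 3 by (intro exI[of _ "[x]"] exI[of _ "y # D"]) simp
  next
    case False
    then have "D \<noteq> []" "P y"
      using "3.prems" by auto
    then obtain U V where "y # D = U @ V" "U \<noteq> []" "V \<noteq> []" "P (last U)" "Q (hd V)"
      using "3.IH"(2) "3.prems" by (cases D) auto
    then show ?thesis
      by (intro exI[of _ "x # U"] exI[of _ V]) simp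
  qed
qed auto

text \<open>Choosing \<open>c\<close> as the last point of the partition with \<open>\<omega> a c \<le> \<omega> a b / 2\<close>, superadditivity makes
  \<open>\<omega>\<close> at most \<open>\<omega> a b / 2\<close> from the successor of \<open>c\<close> on, so the constant reproduces itself.\<close>

lemma sewing_maximal_inequality:
  fixes \<Xi> :: "real \<Rightarrow> real \<Rightarrow> 'b::real_normed_vector"
  assumes \<omega>0: "\<And>a b. 0 \<le> \<omega> a b"
    and super: "\<And>a b c. s \<le> a \<Longrightarrow> a \<le> b \<Longrightarrow> b \<le> c \<Longrightarrow> c \<le> t \<Longrightarrow> \<omega> a b + \<omega> b c \<le> \<omega> a c"
    and \<theta>: "1 < \<theta>" and C: "0 \<le> C"
    and \<Xi>0: "\<And>a. s \<le> a \<Longrightarrow> a \<le> t \<Longrightarrow> \<Xi> a a = 0"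
    and almost: "\<And>a b c. s \<le> a \<Longrightarrow> a \<le> b \<Longrightarrow> b \<le> c \<Longrightarrow> c \<le> t \<Longrightarrow>
      norm (\<Xi> a c - \<Xi> a b - \<Xi> b c) \<le> C * \<omega> a c powr \<theta>"
    and K: "K = 2 * C / (1 - 2 powr (1 - \<theta>))"
  shows "D \<noteq> [] \<Longrightarrow> sorted_wrt (<) D \<Longrightarrow> s \<le> hd D \<Longrightarrow> last D \<le> t \<Longrightarrow>
    norm (chain_sum \<Xi> D - \<Xi> (hd D) (last D)) \<le> K * \<omega> (hd D) (last D) powr \<theta>"
proof (induction "length D" arbitrary: D rule: less_induct)
  case less
  have pw: "2 powr (1 - \<theta>) < (1::real)"
    using \<theta> powr_less_mono[of "1 - \<theta>" 0 2] by simp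
  have K0: "0 \<le> K" using C pw by (simp add: K)
  \<comment> \<open>\<open>K\<close> solves the fixed point equation of the induction: two halves,
    each with at most half the mass, give \<open>K * 2 powr (1 - \<theta>)\<close> together, and the
    two defects below give \<open>2 * C\<close>.\<close>
  have "K * (1 - 2 powr (1 - \<theta>)) = 2 * C"
    using pw \<theta> by (simp add: K)
  then have Keq: "K * 2 powr (1 - \<theta>) + 2 * C = K"
    by (simp add: algebra_simps)
  define a b where "a = hd D" and "b = last D"
  have set_D: "a \<le> x \<and> x \<le> b" if "x \<in> set D" for x
    using sorted_hd_last_bounds[OF less.prems(2) that] by (simp add: a_def b_def)
  show ?case
  proof (cases "length D = 1")
    case True
    then obtain x where "D = [x]" by (cases D) auto
    then show ?thesis using less.prems K0 by (simp add: \<Xi>0)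
  next
    case False
    then have len: "2 \<le> length D"
      using less.prems(1) by (cases D) (auto simp: Suc_le_eq)
    have ab: "s \<le> a" "b \<le> t" using less.prems(3,4) by (auto simp: a_def b_def)
    have "a \<in> set D" "b \<in> set D" using less.prems(1) by (simp_all add: a_def b_def)
    then have "a \<le> b" using set_D by blast
    have \<omega>_refl: "\<omega> x x = 0" if "s \<le> x" "x \<le> t" for x
      using super[of x x x] \<omega>0[of x x] that by simp
    define m where "m = \<omega> a b"
    have m0: "0 \<le> m" by (simp add: m_def \<omega>0)
    have "\<exists>U V. D = U @ V \<and> U \<noteq> [] \<and> V \<noteq> [] \<and> \<omega> a (last U) \<le> m / 2 \<and> \<omega> (hd V) b \<le> m / 2"
    proof (rule split_by_predicates[OF len])
      show "\<omega> a (hd D) \<le> m / 2" "\<omega> (last D) b \<le> m / 2"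
        using \<omega>_refl ab \<open>a \<le> b\<close> m0 by (simp_all flip: a_def b_def)
      show "\<omega> a x \<le> m / 2 \<or> \<omega> x b \<le> m / 2" if "x \<in> set D" for x
        using super[of a x b] set_D[OF that] ab by (auto simp: m_def)
    qed
    then obtain U V where UV: "D = U @ V" "U \<noteq> []" "V \<noteq> []"
      and half: "\<omega> a (last U) \<le> m / 2" "\<omega> (hd V) b \<le> m / 2" by blast
    define c c' where "c = last U" and "c' = hd V"
    have hU: "hd U = a" and lV: "last V = b" using UV by (simp_all add: a_def b_def)
    have cD: "c \<in> set U" "c' \<in> set V" using UV by (simp_all add: c_def c'_def)
    then have cc: "a \<le> c" "c \<le> c'" "c' \<le> b"
      using set_D[of c] set_D[of c'] less.prems(2) by (auto simp: UV(1) sorted_wrt_append less_imp_le)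
    have IH_U: "norm (chain_sum \<Xi> U - \<Xi> a c) \<le> K * \<omega> a c powr \<theta>"
      using less.hyps[of U] UV less.prems(2,3) cc ab by (auto simp: sorted_wrt_append hU c_def)
    have IH_V: "norm (chain_sum \<Xi> V - \<Xi> c' b) \<le> K * \<omega> c' b powr \<theta>"
      using less.hyps[of V] UV less.prems(2,3) cc ab by (auto simp: sorted_wrt_append lV c'_def)
    have half_powr: "(m / 2) powr \<theta> = m powr \<theta> * 2 powr (1 - \<theta>) / 2"
      using m0 by (simp add: powr_divide powr_diff)
    have b1: "K * \<omega> a c powr \<theta> \<le> K * (m powr \<theta> * 2 powr (1 - \<theta>) / 2)"
      unfolding half_powr[symmetric] using half(1) K0 \<theta> \<omega>0
      by (intro mult_left_mono powr_mono2) (auto simp: c_def)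
    have b2: "K * \<omega> c' b powr \<theta> \<le> K * (m powr \<theta> * 2 powr (1 - \<theta>) / 2)"
      unfolding half_powr[symmetric] using half(2) K0 \<theta> \<omega>0
      by (intro mult_left_mono powr_mono2) (auto simp: c'_def)
    have b3: "norm (\<Xi> a c' - \<Xi> a c - \<Xi> c c') \<le> C * m powr \<theta>"
    proof -
      have "\<omega> a c' \<le> m"
        using super[of a c' b] \<omega>0[of c' b] cc ab by (simp add: m_def)
      then have "C * \<omega> a c' powr \<theta> \<le> C * m powr \<theta>"
        using C \<theta> \<omega>0 by (intro mult_left_mono powr_mono2) auto
      then show ?thesis
        using almost[of a c c'] cc ab by simp
    qed
    have b4: "norm (\<Xi> a b - \<Xi> a c' - \<Xi> c' b) \<le> C * m powr \<theta>"
      using almost[of a c' b] cc ab by (simp add: m_def)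
    have norm4: "norm (w + x - y - z) \<le> norm w + norm x + norm y + norm z" for w x y z :: 'b
      using norm_triangle_ineq4[of "w + x - y" z] norm_triangle_ineq4[of "w + x" y] norm_triangle_ineq[of w x]
      by linarith
    \<comment> \<open>Inserting \<open>c'\<close> into the interval and then \<open>c\<close> in
      front of it produces two defects; the step from \<open>c\<close> to its successor
      \<open>c'\<close> is kept as it is.\<close>
    have "chain_sum \<Xi> D - \<Xi> a b = (chain_sum \<Xi> U - \<Xi> a c) + (chain_sum \<Xi> V - \<Xi> c' b) -
        (\<Xi> a c' - \<Xi> a c - \<Xi> c c') - (\<Xi> a b - \<Xi> a c' - \<Xi> c' b)"
      using UV by (simp add: chain_sum_append2 c_def c'_def)
    then have "norm (chain_sum \<Xi> D - \<Xi> a b) \<le> norm (chain_sum \<Xi> U - \<Xi> a c) + norm (chain_sum \<Xi> V - \<Xi> c' b) +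
        norm (\<Xi> a c' - \<Xi> a c - \<Xi> c c') + norm (\<Xi> a b - \<Xi> a c' - \<Xi> c' b)"
      by (simp only: norm4)
    also have "\<dots> \<le> K * (m powr \<theta> * 2 powr (1 - \<theta>) / 2) + K * (m powr \<theta> * 2 powr (1 - \<theta>) / 2) +
        C * m powr \<theta> + C * m powr \<theta>"
      using IH_U IH_V b1 b2 b3 b4 by linarith
    also have "\<dots> = (K * 2 powr (1 - \<theta>) + 2 * C) * m powr \<theta>"
      by (simp add: algebra_simps)
    finally show ?thesis
      by (simp only: Keq m_def a_def b_def)
  qed
qed

text \<open>The maximal inequality is applied in each cell of the coarse list \<open>D\<close>,
  where \<open>D'\<close> induces a finer list; \<open>B\<close> is the bound for one cell.\<close>

lemma chain_sum_refine:
  fixes \<Xi> :: "real \<Rightarrow> real \<Rightarrow> 'b::real_normed_vector"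
  assumes max: "\<And>D. D \<noteq> [] \<Longrightarrow> sorted_wrt (<) D \<Longrightarrow> s \<le> hd D \<Longrightarrow> last D \<le> t \<Longrightarrow>
    norm (chain_sum \<Xi> D - \<Xi> (hd D) (last D)) \<le> B (hd D) (last D)"
  shows "D \<noteq> [] \<Longrightarrow> D' \<noteq> [] \<Longrightarrow> sorted_wrt (<) D \<Longrightarrow> sorted_wrt (<) D' \<Longrightarrow> hd D = hd D' \<Longrightarrow>
    last D = last D' \<Longrightarrow> set D \<subseteq> set D' \<Longrightarrow> s \<le> hd D \<Longrightarrow> last D \<le> t \<Longrightarrow>
    norm (chain_sum \<Xi> D' - chain_sum \<Xi> D) \<le> chain_sum B D"
proof (induction D arbitrary: D' rule: induct_list012)
  case (2 a)
  then have "hd D' = a" "last D' = a" by auto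
  with 2 have "D' = [a]"
    by (cases D') (auto split: if_splits dest: last_in_set)
  then show ?case by simp
next
  case (3 a b D)
  have "b \<in> set D'" using "3.prems" by simp
  then obtain A R where D': "D' = A @ b # R" by (meson split_list)
  have "A \<noteq> []" using "3.prems" D' by auto
  then have hA: "hd A = a" using "3.prems"(5) D' by simp
  have A_less: "x < b" if "x \<in> set A" for x
    using "3.prems"(4) that by (auto simp: D' sorted_wrt_append)
  have "last (b # R) \<le> t"
    using "3.prems" D' by simp
  moreover have "b \<le> last (b # R)"
    using "3.prems"(4) by (auto simp: D' sorted_wrt_append less_imp_le)
  ultimately have bt: "b \<le> t" by simp
  have "a < b" using "3.prems"(3) by simp
  have "norm (chain_sum \<Xi> (A @ [b]) - \<Xi> a b) \<le> B a b"
    using max[of "A @ [b]"] hA \<open>A \<noteq> []\<close> "3.prems"(4,8) bt by (auto simp: D' sorted_wrt_append)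
  moreover have "norm (chain_sum \<Xi> (b # R) - chain_sum \<Xi> (b # D)) \<le> chain_sum B (b # D)"
  proof (rule "3.IH"(2))
    show "set (b # D) \<subseteq> set (b # R)"
      using "3.prems"(3,7) A_less by (fastforce simp: D')
  qed (use "3.prems" D' \<open>a < b\<close> in \<open>auto simp: sorted_wrt_append\<close>)
  moreover have "chain_sum \<Xi> D' - chain_sum \<Xi> (a # b # D) =
      (chain_sum \<Xi> (A @ [b]) - \<Xi> a b) + (chain_sum \<Xi> (b # R) - chain_sum \<Xi> (b # D))"
    by (simp add: D' chain_sum_append[of \<Xi> A b R])
  ultimately have "norm (chain_sum \<Xi> D' - chain_sum \<Xi> (a # b # D)) \<le> B a b + chain_sum B (b # D)"
    by (metis norm_triangle_le add_mono)
  then show ?case by simp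
qed simp

lemma chain_sum_superadditive:
  fixes \<omega> :: "real \<Rightarrow> real \<Rightarrow> real"
  assumes \<omega>0: "\<And>a b. 0 \<le> \<omega> a b"
    and super: "\<And>a b c. s \<le> a \<Longrightarrow> a \<le> b \<Longrightarrow> b \<le> c \<Longrightarrow> c \<le> t \<Longrightarrow> \<omega> a b + \<omega> b c \<le> \<omega> a c"
  shows "D \<noteq> [] \<Longrightarrow> sorted_wrt (<) D \<Longrightarrow> s \<le> hd D \<Longrightarrow> last D \<le> t \<Longrightarrow>
    chain_sum \<omega> D \<le> \<omega> (hd D) (last D)"
proof (induction D rule: induct_list012)
  case (3 a b D)
  have "b \<le> last (b # D)"
    using "3.prems"(2) by (auto simp: less_imp_le)
  then show ?case
    using 3 super[of a b "last (b # D)"] by auto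
qed (use \<omega>0 in auto)

lemma ex_partition_mesh:
  assumes "s < t" and "0 < \<delta>"
  shows "\<exists>D. is_partition s t D \<and> mesh D < \<delta>"
proof -
  obtain N :: nat where N: "(t - s) / \<delta> < real N"
    using reals_Archimedean2 by blast
  have "0 < (t - s) / \<delta>" using assms by simp
  then have N0: "0 < real N" using N by linarith
  then have "0 < N" by simp
  define x where "x k = s + real k * ((t - s) / real N)" for k
  define D where "D = map x [0..<Suc N]"
  have mono: "x j < x k" if "j < k" for j k
    using that assms(1) N0 by (simp add: x_def divide_strict_right_mono mult_strict_right_mono)
  have nth: "D ! k = x k" if "k \<le> N" for k
    unfolding D_def using that by (subst nth_map) (auto simp del: upt_Suc)
  have len: "length D = Suc N" by (simp add: D_def)
  have "is_partition s t D"
    unfolding is_partition_def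
  proof (intro conjI)
    show "D \<noteq> []" using len by auto
    then show "hd D = s" "last D = t"
      using nth[of 0] nth[of N] N0 by (simp_all add: hd_conv_nth last_conv_nth len x_def)
    show "sorted_wrt (<) D"
      unfolding sorted_wrt_iff_nth_less len using nth mono by simp
  qed
  moreover have "mesh D < \<delta>"
  proof -
    have "D ! Suc k - D ! k < \<delta>" if "k < N" for k
    proof -
      have "x (Suc k) - x k = (t - s) / real N"
        by (simp add: x_def distrib_right add_divide_distrib)
      also have "\<dots> < \<delta>"
        using N N0 assms(2) by (simp add: field_simps)
      finally show ?thesis
        using that nth[of k] nth[of "Suc k"] by simp
    qed
    then show ?thesis
      using \<open>0 < N\<close> unfolding mesh_def len by (subst Max_less_iff) auto
  qed
  ultimately show ?thesis by blast
qed

text \<open>Refining a partition of small mesh changes the sum little: of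
  \<open>\<omega> powr \<theta>\<close>, one power of \<omega> adds up to at most
  \<open>\<omega> s t\<close> by superadditivity and the power \<open>\<theta> - 1\<close> is small
  on short intervals. Two partitions are compared through their common refinement, and completeness
  yields the limit.\<close>

theorem sewing:
  fixes \<Xi> :: "real \<Rightarrow> real \<Rightarrow> 'b::banach"
  assumes "s < t"
    and \<omega>0: "\<And>a b. 0 \<le> \<omega> a b"
    and super: "\<And>a b c. s \<le> a \<Longrightarrow> a \<le> b \<Longrightarrow> b \<le> c \<Longrightarrow> c \<le> t \<Longrightarrow> \<omega> a b + \<omega> b c \<le> \<omega> a c"
    and small: "\<And>\<epsilon>. 0 < \<epsilon> \<Longrightarrow> \<exists>\<delta>>0. \<forall>a b. s \<le> a \<longrightarrow> a \<le> b \<longrightarrow> b \<le> t \<longrightarrow> b - a < \<delta> \<longrightarrow> \<omega> a b \<le> \<epsilon>"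
    and \<theta>: "1 < \<theta>" and C: "0 \<le> C"
    and \<Xi>0: "\<And>a. s \<le> a \<Longrightarrow> a \<le> t \<Longrightarrow> \<Xi> a a = 0"
    and almost: "\<And>a b c. s \<le> a \<Longrightarrow> a \<le> b \<Longrightarrow> b \<le> c \<Longrightarrow> c \<le> t \<Longrightarrow>
      norm (\<Xi> a c - \<Xi> a b - \<Xi> b c) \<le> C * \<omega> a c powr \<theta>"
  shows "\<exists>I. (partition_sum \<Xi> \<longlongrightarrow> I) (mesh_to_0 s t)"
proof -
  define K where "K = 2 * C / (1 - 2 powr (1 - \<theta>))"
  have pw: "2 powr (1 - \<theta>) < (1::real)"
    using \<theta> powr_less_mono[of "1 - \<theta>" 0 2] by simp
  have K0: "0 \<le> K" using C pw by (simp add: K_def)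
  note max = sewing_maximal_inequality[OF \<omega>0 super \<theta> C \<Xi>0 almost K_def]
  have fine: "\<exists>\<delta>>0. \<forall>D D'. is_partition s t D \<and> mesh D < \<delta> \<and> is_partition s t D' \<and> set D \<subseteq> set D' \<longrightarrow>
      norm (partition_sum \<Xi> D' - partition_sum \<Xi> D) \<le> \<epsilon>" if \<epsilon>: "0 < \<epsilon>" for \<epsilon>
  proof -
    \<comment> \<open>The 1 keeps \<open>M\<close> positive when \<open>K * \<omega> s t\<close>
      vanishes; \<eta> below is chosen so that
      \<open>K * \<omega> s t * \<eta> powr (\<theta> - 1)\<close> is at most \<epsilon>.\<close>
    define M where "M = K * \<omega> s t + 1"
    have M: "0 < M" using K0 \<omega>0[of s t] by (simp add: M_def add_nonneg_pos)
    define \<eta> where "\<eta> = (\<epsilon> / M) powr (1 / (\<theta> - 1))"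
    have \<eta>: "0 < \<eta>" using \<epsilon> M by (simp add: \<eta>_def)
    have \<eta>_powr: "\<eta> powr (\<theta> - 1) = \<epsilon> / M"
      using \<epsilon> M \<theta> by (simp add: \<eta>_def powr_powr)
    obtain \<delta> where \<delta>: "0 < \<delta>" "\<And>a b. s \<le> a \<Longrightarrow> a \<le> b \<Longrightarrow> b \<le> t \<Longrightarrow> b - a < \<delta> \<Longrightarrow> \<omega> a b \<le> \<eta>"
      using small[OF \<eta>] by blast
    have "norm (partition_sum \<Xi> D' - partition_sum \<Xi> D) \<le> \<epsilon>"
      if D: "is_partition s t D" and mesh: "mesh D < \<delta>" and D': "is_partition s t D'" and sub: "set D \<subseteq> set D'" for D D'
    proof -
      have bounds: "s \<le> D ! k \<and> D ! k \<le> D ! Suc k \<and> D ! Suc k \<le> t \<and> D ! Suc k - D ! k < \<delta>"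
        if k: "k < length D - 1" for k
      proof -
        have "k < length D" using k by simp
        have sorted: "D ! i < D ! j" if "i < j" "j < length D" for i j
          using D that by (simp add: is_partition_def sorted_wrt_iff_nth_less)
        have "D ! 0 = s" "D ! (length D - 1) = t"
          using D by (auto simp: is_partition_def hd_conv_nth last_conv_nth)
        moreover have "D ! 0 \<le> D ! k"
          using sorted[of 0 k] \<open>k < length D\<close> by (cases "k = 0") (auto simp: less_imp_le)
        moreover have "D ! Suc k \<le> D ! (length D - 1)"
          using sorted[of "Suc k" "length D - 1"] k by (cases "Suc k = length D - 1") (auto simp: less_imp_le)
        moreover have "D ! k < D ! Suc k" using sorted[of k "Suc k"] k by simp
        moreover have "D ! Suc k - D ! k \<le> mesh D"
          unfolding mesh_def using k by (intro Max_ge) auto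
        ultimately show ?thesis using mesh by auto
      qed
      have "norm (chain_sum \<Xi> D' - chain_sum \<Xi> D) \<le> chain_sum (\<lambda>u v. K * \<omega> u v powr \<theta>) D"
        by (rule chain_sum_refine[of s t]) (use D D' sub max in \<open>auto simp: is_partition_def\<close>)
      also have "\<dots> = (\<Sum>k<length D - 1. K * \<omega> (D ! k) (D ! Suc k) powr \<theta>)"
        by (simp add: partition_sum_def flip: partition_sum_eq)
      also have "\<dots> \<le> (\<Sum>k<length D - 1. K * (\<omega> (D ! k) (D ! Suc k) * \<eta> powr (\<theta> - 1)))"
      proof (intro sum_mono mult_left_mono K0)
        fix k assume "k \<in> {..<length D - 1}"
        then have "\<omega> (D ! k) (D ! Suc k) \<le> \<eta>"
          using bounds[of k] \<delta>(2) by auto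
        then have "\<omega> (D ! k) (D ! Suc k) * \<omega> (D ! k) (D ! Suc k) powr (\<theta> - 1) \<le>
            \<omega> (D ! k) (D ! Suc k) * \<eta> powr (\<theta> - 1)"
          using \<theta> \<omega>0 by (intro mult_left_mono powr_mono2) auto
        then show "\<omega> (D ! k) (D ! Suc k) powr \<theta> \<le> \<omega> (D ! k) (D ! Suc k) * \<eta> powr (\<theta> - 1)"
          using \<omega>0 by (simp add: powr_mult_base)
      qed
      also have "\<dots> = K * chain_sum \<omega> D * (\<epsilon> / M)"
        by (simp add: \<eta>_powr partition_sum_def sum_distrib_left sum_distrib_right sum_divide_distrib mult.assoc
            flip: partition_sum_eq)
      also have "\<dots> \<le> K * \<omega> s t * (\<epsilon> / M)"
        using chain_sum_superadditive[of \<omega> s t D, OF \<omega>0 super] D K0 \<epsilon> M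
        by (intro mult_right_mono mult_left_mono) (auto simp: is_partition_def)
      also have "\<dots> \<le> M * (\<epsilon> / M)"
        using \<epsilon> M by (intro mult_right_mono) (auto simp: M_def)
      also have "\<dots> = \<epsilon>" using M by simp
      finally show ?thesis by (simp add: partition_sum_eq)
    qed
    then show ?thesis using \<delta>(1) by blast
  qed
  have cauchy: "\<exists>\<delta>>0. \<forall>D D'. is_partition s t D \<and> mesh D < \<delta> \<and> is_partition s t D' \<and> mesh D' < \<delta> \<longrightarrow>
      dist (partition_sum \<Xi> D) (partition_sum \<Xi> D') < \<epsilon>" if \<epsilon>: "0 < \<epsilon>" for \<epsilon>
  proof -
    have "0 < \<epsilon> / 3" using \<epsilon> by simp
    from fine[OF this] obtain \<delta> where \<delta>: "0 < \<delta>"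
      "\<And>D D'. is_partition s t D \<Longrightarrow> mesh D < \<delta> \<Longrightarrow> is_partition s t D' \<Longrightarrow> set D \<subseteq> set D' \<Longrightarrow>
        norm (partition_sum \<Xi> D' - partition_sum \<Xi> D) \<le> \<epsilon> / 3"
      by blast
    have "dist (partition_sum \<Xi> D) (partition_sum \<Xi> D') < \<epsilon>"
      if D: "is_partition s t D" "mesh D < \<delta>" and D': "is_partition s t D'" "mesh D' < \<delta>" for D D'
    proof -
      define E where "E = sorted_list_of_set (set D \<union> set D')"
      have E: "set E = set D \<union> set D'" "sorted_wrt (<) E"
        by (simp_all add: E_def)
      have range: "s \<le> x \<and> x \<le> t" if "is_partition s t D" "x \<in> set D" for x D
        using sorted_hd_last_bounds[of D x] that by (auto simp: is_partition_def)
      have ne: "E \<noteq> []" using E(1) D(1) by (auto simp: is_partition_def)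
      have "s \<in> set D" "t \<in> set D"
        using D(1) hd_in_set last_in_set unfolding is_partition_def by metis+
      then have mem: "s \<in> set E" "t \<in> set E"
        by (simp_all add: E(1))
      have rE: "s \<le> x \<and> x \<le> t" if "x \<in> set E" for x
        using that range[OF D(1)] range[OF D'(1)] by (auto simp: E(1))
      have "hd E = s"
        using sorted_hd_last_bounds[OF E(2) mem(1)] rE[of "hd E"] ne by (simp add: antisym)
      moreover have "last E = t"
        using sorted_hd_last_bounds[OF E(2) mem(2)] rE[of "last E"] ne by (simp add: antisym)
      ultimately have "is_partition s t E"
        using ne E(2) by (simp add: is_partition_def)
      then have "norm (partition_sum \<Xi> E - partition_sum \<Xi> D) \<le> \<epsilon> / 3"
        "norm (partition_sum \<Xi> E - partition_sum \<Xi> D') \<le> \<epsilon> / 3"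
        using \<delta>(2) D D' E(1) by auto
      then have "norm (partition_sum \<Xi> D - partition_sum \<Xi> D') \<le> \<epsilon> / 3 + \<epsilon> / 3"
        using norm_triangle_ineq4[of "partition_sum \<Xi> E - partition_sum \<Xi> D'" "partition_sum \<Xi> E - partition_sum \<Xi> D"]
        by simp
      then show ?thesis using \<epsilon> by (simp add: dist_norm)
    qed
    then show ?thesis using \<delta>(1) by blast
  qed
  have "\<forall>n. \<exists>D. is_partition s t D \<and> mesh D < 1 / real (Suc n)"
    using ex_partition_mesh[OF assms(1)] by simp
  then obtain P where P: "\<And>n. is_partition s t (P n)" "\<And>n. mesh (P n) < 1 / real (Suc n)"
    by metis
  have P_small: "\<exists>N. \<forall>n\<ge>N. mesh (P n) < \<delta>" if \<delta>: "0 < \<delta>" for \<delta>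
  proof -
    obtain N where N: "1 / real (Suc N) < \<delta>" using \<delta> by (rule nat_approx_posE)
    have "mesh (P n) < \<delta>" if "N \<le> n" for n
    proof -
      have "1 / real (Suc n) \<le> 1 / real (Suc N)" using that by (simp add: frac_le)
      then show ?thesis using P(2)[of n] N by linarith
    qed
    then show ?thesis by blast
  qed
  have "Cauchy (\<lambda>n. partition_sum \<Xi> (P n))"
  proof (rule metric_CauchyI)
    fix \<epsilon> :: real assume "0 < \<epsilon>"
    from cauchy[OF this] P_small P(1) show "\<exists>N. \<forall>m\<ge>N. \<forall>n\<ge>N. dist (partition_sum \<Xi> (P m)) (partition_sum \<Xi> (P n)) < \<epsilon>"
      by meson
  qed
  then obtain I where I: "(\<lambda>n. partition_sum \<Xi> (P n)) \<longlonglongrightarrow> I"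
    using Cauchy_convergent convergent_def by blast
  have "(partition_sum \<Xi> \<longlongrightarrow> I) (mesh_to_0 s t)"
  proof (rule tendstoI)
    fix \<epsilon> :: real assume \<epsilon>: "0 < \<epsilon>"
    then have e2: "0 < \<epsilon> / 2" by simp
    obtain \<delta> where \<delta>: "0 < \<delta>" "\<And>D D'. is_partition s t D \<Longrightarrow> mesh D < \<delta> \<Longrightarrow> is_partition s t D' \<Longrightarrow> mesh D' < \<delta> \<Longrightarrow>
        dist (partition_sum \<Xi> D) (partition_sum \<Xi> D') < \<epsilon> / 2"
      using cauchy[OF e2] by blast
    obtain N1 where N1: "\<And>n. N1 \<le> n \<Longrightarrow> mesh (P n) < \<delta>" using P_small[OF \<delta>(1)] by blast
    obtain N2 where N2: "\<And>n. N2 \<le> n \<Longrightarrow> dist (partition_sum \<Xi> (P n)) I < \<epsilon> / 2"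
      using metric_LIMSEQ_D[OF I e2] by blast
    define m where "m = max N1 N2"
    have "dist (partition_sum \<Xi> D) I < \<epsilon>" if "is_partition s t D" "mesh D < \<delta>" for D
    proof -
      have "dist (partition_sum \<Xi> D) (partition_sum \<Xi> (P m)) < \<epsilon> / 2"
        using \<delta>(2)[OF that P(1) N1[of m]] by (simp add: m_def)
      moreover have "dist (partition_sum \<Xi> (P m)) I < \<epsilon> / 2"
        using N2[of m] by (simp add: m_def)
      ultimately show ?thesis using dist_triangle[of "partition_sum \<Xi> D" I "partition_sum \<Xi> (P m)"] by linarith
    qed
    then show "\<forall>\<^sub>F D in mesh_to_0 s t. dist (partition_sum \<Xi> D) I < \<epsilon>"
      unfolding mesh_to_0_def using \<delta>(1)
      by (intro eventually_INF1[of \<delta>]) (auto simp: eventually_principal)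
  qed
  then show ?thesis by blast
qed

section \<open>Controls from finite variation\<close>

text \<open>Interpolation between variations: of the exponent \<open>r + p\<close>, the part
  \<open>r\<close> is bounded by the oscillation \<eta> and the part \<open>p\<close> is
  summed.\<close>

lemma chain_sum_mono_powr:
  fixes q :: "real \<Rightarrow> real \<Rightarrow> real"
  assumes "\<And>a b. 0 \<le> q a b" and "0 \<le> r" and "\<And>a b. a \<in> set D \<Longrightarrow> b \<in> set D \<Longrightarrow> a < b \<Longrightarrow> q a b \<le> \<eta>"
    and "sorted_wrt (<) D"
  shows "chain_sum (\<lambda>a b. q a b powr (r + p)) D \<le> \<eta> powr r * chain_sum (\<lambda>a b. q a b powr p) D"
  using assms(3,4)
proof (induction D rule: induct_list012)
  case (3 a b D)
  have "q a b powr (r + p) \<le> \<eta> powr r * q a b powr p"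
    unfolding powr_add using "3.prems" assms(1,2) by (intro mult_right_mono powr_mono2) auto
  moreover have "chain_sum (\<lambda>a b. q a b powr (r + p)) (b # D) \<le> \<eta> powr r * chain_sum (\<lambda>a b. q a b powr p) (b # D)"
    by (rule "3.IH"(2)) (use "3.prems" in auto)
  ultimately show ?case by (simp add: distrib_left)
qed simp_all

text \<open>The variation is a supremum over partitions of all of \<open>[0, T]\<close>. An
  increasing list inside is completed by the endpoints, which only adds nonnegative terms.\<close>

lemma chain_sum_bound_partition:
  assumes q: "\<And>a b. 0 \<le> (q a b :: real)" and "0 < T"
    and M: "\<And>D. is_partition 0 T D \<Longrightarrow> chain_sum q D \<le> M"
    and D: "sorted_wrt (<) D" "set D \<subseteq> {0..T}"
  shows "chain_sum q D \<le> M"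
proof (cases "D = []")
  case True
  have "chain_sum q D \<le> chain_sum q [0, T]" using True q by simp
  also have "\<dots> \<le> M" using assms(2) by (intro M) (simp add: is_partition_def)
  finally show ?thesis .
next
  case False
  define D1 where "D1 = (if hd D = 0 then D else 0 # D)"
  define D2 where "D2 = (if last D1 = T then D1 else D1 @ [T])"
  have bounds: "0 \<le> x" "x \<le> T" if "x \<in> set D" for x using D(2) that by auto
  have hdD: "hd D < x \<or> x = hd D" if "x \<in> set D" for x
    using sorted_hd_last_bounds[OF D(1) that] by auto
  have D1: "D1 \<noteq> []" "hd D1 = 0" "sorted_wrt (<) D1" "set D1 \<subseteq> {0..T}" "last D1 = last D"
    using False D bounds(1)[of "hd D"] hdD assms(2) by (auto simp: D1_def) (use bounds in fastforce)
  have "chain_sum q D \<le> chain_sum q D1"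
    using q False by (cases D) (auto simp: D1_def)
  also have "\<dots> \<le> chain_sum q D2"
    using q D1(1) by (auto simp: D2_def chain_sum_append2)
  also have "\<dots> \<le> M"
  proof (rule M)
    have "x < T" if "x \<in> set D1" "last D1 \<noteq> T" for x
      using sorted_hd_last_bounds[OF D1(3) that(1)] D1(1,4) last_in_set[OF D1(1)] that(2) by fastforce
    then show "is_partition 0 T D2"
      using D1 by (auto simp: is_partition_def D2_def sorted_wrt_append)
  qed
  finally show ?thesis .
qed

text \<open>The \<open>p'\<close>-variation for \<open>p' > p\<close> is small on short intervals because the oscillation is, which
  avoids proving the continuity of the \<open>p\<close>-variation.\<close>

lemma ex_control:
  fixes q :: "real \<Rightarrow> real \<Rightarrow> real"
  assumes q: "\<And>a b. 0 \<le> q a b" and q_refl: "\<And>a. 0 \<le> a \<Longrightarrow> a \<le> T \<Longrightarrow> q a a = 0"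
    and "0 < T" and p: "0 < p" "p < p'"
    and M: "\<And>D. is_partition 0 T D \<Longrightarrow> chain_sum (\<lambda>a b. q a b powr p) D \<le> M"
    and small: "\<And>\<epsilon>. 0 < \<epsilon> \<Longrightarrow> \<exists>\<delta>>0. \<forall>a b. 0 \<le> a \<longrightarrow> a \<le> b \<longrightarrow> b \<le> T \<longrightarrow> b - a < \<delta> \<longrightarrow> q a b \<le> \<epsilon>"
  obtains \<omega> where "\<And>a b. 0 \<le> \<omega> a b"
    "\<And>a b c. 0 \<le> a \<Longrightarrow> a \<le> b \<Longrightarrow> b \<le> c \<Longrightarrow> c \<le> T \<Longrightarrow> \<omega> a b + \<omega> b c \<le> \<omega> a c"
    "\<And>\<epsilon>. 0 < \<epsilon> \<Longrightarrow> \<exists>\<delta>>0. \<forall>a b. 0 \<le> a \<longrightarrow> a \<le> b \<longrightarrow> b \<le> T \<longrightarrow> b - a < \<delta> \<longrightarrow> \<omega> a b \<le> \<epsilon>"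
    "\<And>a b. 0 \<le> a \<Longrightarrow> a \<le> b \<Longrightarrow> b \<le> T \<Longrightarrow> q a b powr p' \<le> \<omega> a b"
proof -
  let ?c = "chain_sum (\<lambda>a b. q a b powr p')"
  \<comment> \<open>The lists need not contain \<open>a\<close> or \<open>b\<close>, so
    \<open>P a b\<close> grows with the interval, and the empty list keeps the supremum
    nonnegative.\<close>
  define P where "P a b = {D. sorted_wrt (<) D \<and> set D \<subseteq> {a..b}}" for a b :: real
  define \<omega> where "\<omega> a b = (if 0 \<le> a \<and> a \<le> b \<and> b \<le> T then SUP D\<in>P a b. ?c D else 0)" for a b
  have bound: "chain_sum (\<lambda>a b. q a b powr p) D \<le> M" if "D \<in> P a b" "0 \<le> a" "b \<le> T" for D a b
    by (rule chain_sum_bound_partition[OF _ assms(3) M]) (use that in \<open>auto simp: P_def\<close>)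
  have M0: "0 \<le> M" using bound[of "[]" 0 T] by (simp add: P_def)
  have osc: "?c D \<le> \<eta> powr (p' - p) * M"
    if "D \<in> P a b" "0 \<le> a" "b \<le> T" "\<And>x y. a \<le> x \<Longrightarrow> x < y \<Longrightarrow> y \<le> b \<Longrightarrow> q x y \<le> \<eta>" for D a b \<eta>
  proof -
    have "?c D \<le> \<eta> powr (p' - p) * chain_sum (\<lambda>a b. q a b powr p) D"
      using chain_sum_mono_powr[of q "p' - p" D \<eta> p] q p that(1,4) by (auto simp: P_def subset_iff)
    also have "\<dots> \<le> \<eta> powr (p' - p) * M"
      by (intro mult_left_mono bound[OF that(1-3)]) simp
    finally show ?thesis .
  qed
  \<comment> \<open>A two-point list bounds \<open>q\<close> itself; this makes the sums with
    exponent \<open>p'\<close> bounded and their supremum finite.\<close>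
  have q_le: "q x y \<le> M powr (1 / p)" if "0 \<le> x" "x < y" "y \<le> T" for x y
  proof -
    have "q x y powr p \<le> M" using bound[of "[x, y]" 0 T] that by (simp add: P_def)
    then have "(q x y powr p) powr (1 / p) \<le> M powr (1 / p)"
      using p by (intro powr_mono2) auto
    then show ?thesis using p q by (simp add: powr_powr)
  qed
  have bdd: "bdd_above (?c ` P a b)" if "0 \<le> a" "b \<le> T" for a b
    by (rule bdd_aboveI2[where M = "(M powr (1 / p)) powr (p' - p) * M"], rule osc)
      (use that q_le in auto)
  have Nil: "[] \<in> P a b" for a b by (simp add: P_def)
  have upper: "?c D \<le> \<omega> a b" if "D \<in> P a b" "0 \<le> a" "a \<le> b" "b \<le> T" for D a b
    using that bdd by (auto simp: \<omega>_def intro: cSUP_upper)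
  show thesis
  proof
    show "0 \<le> \<omega> a b" for a b
    proof (cases "0 \<le> a \<and> a \<le> b \<and> b \<le> T")
      case True
      then show ?thesis using upper[OF Nil] by simp
    qed (auto simp: \<omega>_def)
    show "q a b powr p' \<le> \<omega> a b" if "0 \<le> a" "a \<le> b" "b \<le> T" for a b
    proof (cases "a = b")
      case True
      then show ?thesis using upper[OF Nil] that q_refl by simp
    next
      case False
      then show ?thesis using upper[of "[a, b]" a b] that by (simp add: P_def)
    qed
    show "\<omega> a b + \<omega> b c \<le> \<omega> a c" if abc: "0 \<le> a" "a \<le> b" "b \<le> c" "c \<le> T" for a b c
    proof -
      \<comment> \<open>Lists in adjacent intervals are joined: a shared point is kept once,
        otherwise the step across \<open>b\<close> adds a nonnegative term.\<close>
      have add: "?c D1 + ?c D2 \<le> \<omega> a c" if D1: "D1 \<in> P a b" and D2: "D2 \<in> P b c" for D1 D2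
      proof (cases "D1 = [] \<or> D2 = []")
        case True
        have "D1 \<in> P a c" "D2 \<in> P a c"
          using D1 D2 abc by (fastforce simp: P_def)+
        then have "?c D1 \<le> \<omega> a c" "?c D2 \<le> \<omega> a c" "0 \<le> \<omega> a c"
          using upper[OF Nil, of a c] abc by (auto intro!: upper)
        then show ?thesis using True by auto
      next
        case False
        then have mem: "last D1 \<in> set D1" "hd D2 \<in> set D2" by auto
        then have b: "last D1 \<le> b" "b \<le> hd D2" using D1 D2 by (auto simp: P_def)
        have less: "x \<le> last D1" "hd D2 \<le> y" if "x \<in> set D1" "y \<in> set D2" for x y
          using sorted_hd_last_bounds[of D1 x] sorted_hd_last_bounds[of D2 y] that D1 D2 by (auto simp: P_def)
        show ?thesis
        proof (cases "last D1 = hd D2")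
          case True
          obtain A m where A: "D1 = A @ [m]" using False by (cases D1 rule: rev_cases) auto
          obtain R where R: "D2 = m # R" using False True A by (cases D2) auto
          have "x < y" if "x \<in> set A" "y \<in> set D2" for x y
            using D1 less(2)[OF mem(1) that(2)] that(1) by (fastforce simp: P_def A R sorted_wrt_append)
          then have "A @ D2 \<in> P a c"
            using D1 D2 abc by (auto simp: P_def A sorted_wrt_append subset_iff)
          then have "?c (A @ m # R) \<le> \<omega> a c"
            using upper abc R by auto
          then show ?thesis
            by (simp add: A R chain_sum_append[of _ A m R])
        next
          case False
          then have "D1 @ D2 \<in> P a c"
            using D1 D2 abc less b by (fastforce simp: P_def sorted_wrt_append subset_iff)
          then have "?c (D1 @ D2) \<le> \<omega> a c" using upper abc by auto
          moreover have "?c D1 + ?c D2 \<le> ?c (D1 @ D2)"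
            using \<open>\<not> (D1 = [] \<or> D2 = [])\<close> by (simp add: chain_sum_append2)
          ultimately show ?thesis by simp
        qed
      qed
      have "(SUP D2\<in>P b c. ?c D2) \<le> \<omega> a c - ?c D1" if D1: "D1 \<in> P a b" for D1
        using add[OF D1] Nil by (intro cSUP_least) (auto simp: le_diff_eq add.commute)
      then have "?c D1 \<le> \<omega> a c - (SUP D2\<in>P b c. ?c D2)" if "D1 \<in> P a b" for D1
        using that by fastforce
      then have "(SUP D1\<in>P a b. ?c D1) \<le> \<omega> a c - (SUP D2\<in>P b c. ?c D2)"
        using Nil by (intro cSUP_least) auto
      then have "\<omega> a b \<le> \<omega> a c - \<omega> b c"
        using abc by (simp add: \<omega>_def[of a b] \<omega>_def[of b c])
      then show ?thesis by simp
    qed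
    show "\<exists>\<delta>>0. \<forall>a b. 0 \<le> a \<longrightarrow> a \<le> b \<longrightarrow> b \<le> T \<longrightarrow> b - a < \<delta> \<longrightarrow> \<omega> a b \<le> \<epsilon>" if \<epsilon>: "0 < \<epsilon>" for \<epsilon>
    proof -
      \<comment> \<open>Chosen so that \<open>\<eta> powr (p' - p) * (M + 1)\<close> equals
        \<epsilon>; the 1 covers \<open>M = 0\<close>.\<close>
      define \<eta> where "\<eta> = (\<epsilon> / (M + 1)) powr (1 / (p' - p))"
      have \<eta>: "0 < \<eta>" using \<epsilon> M0 by (simp add: \<eta>_def)
      have "\<eta> powr (p' - p) * M = \<epsilon> / (M + 1) * M"
        using \<epsilon> M0 p by (simp add: \<eta>_def powr_powr)
      also have "\<dots> \<le> \<epsilon>" using \<epsilon> M0 by (simp add: field_simps)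
      finally have \<eta>M: "\<eta> powr (p' - p) * M \<le> \<epsilon>" .
      obtain \<delta> where \<delta>: "0 < \<delta>" "\<And>a b. 0 \<le> a \<Longrightarrow> a \<le> b \<Longrightarrow> b \<le> T \<Longrightarrow> b - a < \<delta> \<Longrightarrow> q a b \<le> \<eta>"
        using small[OF \<eta>] by blast
      have "\<omega> a b \<le> \<epsilon>" if ab: "0 \<le> a" "a \<le> b" "b \<le> T" "b - a < \<delta>" for a b
      proof -
        have "?c D \<le> \<epsilon>" if "D \<in> P a b" for D
          using osc[OF that ab(1,3), of \<eta>] \<delta>(2) ab \<eta>M by fastforce
        then show ?thesis
          using ab Nil by (auto simp: \<omega>_def intro!: cSUP_least)
      qed
      then show ?thesis using \<delta>(1) by blast
    qed
  qed
qed

section \<open>Regularity of the integrands\<close>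

lemma tree_depth_le_1: "tree_depth \<tau> \<le> 1 \<longleftrightarrow> (\<exists>i. \<tau> = bullet i)"
proof -
  have pos: "0 < tree_depth \<sigma>" for \<sigma> :: "'a rtree" by (cases \<sigma>) simp
  show ?thesis
  proof (cases \<tau>)
    case (Node i \<rho>)
    have "tree_depth \<tau> \<le> 1 \<longleftrightarrow> Max (insert 0 (tree_depth ` set_mset \<rho>)) \<le> 0"
      using Node by simp
    also have "\<dots> \<longleftrightarrow> (\<forall>\<sigma>\<in>#\<rho>. tree_depth \<sigma> \<le> 0)"
      by (subst Max_le_iff) auto
    also have "\<dots> \<longleftrightarrow> \<rho> = {#}"
      using pos by (metis leD multiset_nonemptyE empty_iff set_mset_empty)
    finally show ?thesis
      using Node by simp
  qed
qed

lemma tree_depth_le_2: "tree_depth \<tau> \<le> 2 \<longleftrightarrow> (\<exists>i M. \<tau> = corolla i M)"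
proof (cases \<tau>)
  case (Node i \<rho>)
  have "tree_depth \<tau> \<le> 2 \<longleftrightarrow> (\<forall>\<sigma>\<in>#\<rho>. tree_depth \<sigma> \<le> 1)"
    using Node by simp
  also have "\<dots> \<longleftrightarrow> (\<exists>M. \<rho> = bullets M)"
  proof
    assume "\<forall>\<sigma>\<in>#\<rho>. tree_depth \<sigma> \<le> 1"
    then have "\<forall>\<sigma>\<in>#\<rho>. bullet (tree_label \<sigma>) = \<sigma>"
      by (metis tree_depth_le_1 rtree.sel(1))
    then have "\<rho> = bullets (image_mset tree_label \<rho>)"
      by (simp add: multiset.map_comp comp_def cong: image_mset_cong)
    then show "\<exists>M. \<rho> = bullets M" by blast
  qed (auto simp: tree_depth_le_1)
  finally show ?thesis
    using Node by (auto simp: corolla_def)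
qed

lemma tree_deg_corolla: "tree_deg (corolla i M) = Suc (size M)"
  by (simp add: corolla_def tree_deg_Node del: tree_deg.simps)

text \<open>The order of the leaves picked by the choice operator may be replaced by any other,
  because the derivatives involved exist and hence commute.\<close>

lemma f_tree_corolla:
  assumes "n_differentiable m (component f i)" and "length js \<le> m"
  shows "f_tree f (corolla i (mset js)) = part_deriv (component f i) js"
proof -
  have "\<not> 2 < tree_depth (corolla i (mset js))"
    unfolding not_less tree_depth_le_2 by blast
  moreover have "tree_label (corolla i (mset js)) = i"
    by (simp add: corolla_def)
  moreover have "image_mset tree_label (branches (corolla i (mset js))) = mset js"
    by (simp add: corolla_def multiset.map_comp comp_def)
  moreover have "part_deriv (component f i) (SOME is. mset is = mset js) = part_deriv (component f i) js"
  proof (rule part_deriv_mset_cong[OF assms(1)])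
    show eq: "mset (SOME is. mset is = mset js) = mset js"
      by (rule someI) (rule refl)
    show "length (SOME is. mset is = mset js) \<le> m"
      using mset_eq_length[OF eq] assms(2) by simp
  qed
  ultimately show ?thesis
    by (simp only: f_tree_def if_False)
qed

lemma f_tree_deep: "2 < tree_depth \<tau> \<Longrightarrow> f_tree f \<tau> = (\<lambda>x. 0)"
  by (simp add: f_tree_def)

lemma nth_deriv_zero: "nth_deriv (\<lambda>x. 0) vs = (\<lambda>x. 0)"
  by (induction vs) simp_all

lemma part_deriv_zero: "part_deriv (\<lambda>x. 0) w = (\<lambda>x. 0)"
  by (simp add: part_deriv_def nth_deriv_zero)

lemma n_differentiable_zero: "n_differentiable m (\<lambda>x. 0)"
  by (simp add: n_differentiable_def nth_deriv_zero)

text \<open>Differentiating adds leaves to the root, so the derivatives in the approximations along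
  \<open>Z\<close> are again indexed by trees. For deeper \<tau> both sides vanish, as added leaves
  do not lower the depth. For a corolla, the degree condition keeps the number of derivatives at
  most \<open>m\<close>.\<close>

lemma part_deriv_f_tree:
  assumes f: "\<And>i. n_differentiable m (component f i)" and "tree_deg \<tau> + length js \<le> Suc m"
  shows "part_deriv (f_tree f \<tau>) js = f_tree f (root_graft \<tau> (mset js))"
proof (cases "tree_depth \<tau> \<le> 2")
  case True
  then obtain i M where \<tau>: "\<tau> = corolla i M" by (auto simp: tree_depth_le_2)
  obtain w where w: "M = mset w" by (metis ex_mset)
  have len: "length w + length js \<le> m"
    using assms(2) by (simp add: \<tau> w tree_deg_corolla)
  have "f_tree f (corolla i (mset (js @ w))) = part_deriv (component f i) (js @ w)"
    using len by (intro f_tree_corolla[OF f]) simp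
  moreover have "f_tree f \<tau> = part_deriv (component f i) w"
    unfolding \<tau> w using len by (intro f_tree_corolla[OF f]) simp
  ultimately show ?thesis
    by (simp add: \<tau> w root_graft_simps part_deriv_append add.commute)
next
  case False
  have "\<not> tree_depth (root_graft \<tau> (mset js)) \<le> 2"
  proof
    assume "tree_depth (root_graft \<tau> (mset js)) \<le> 2"
    then obtain i M where "root_graft \<tau> (mset js) = corolla i M" by (auto simp: tree_depth_le_2)
    then have "tree_label \<tau> = i" "branches \<tau> + bullets (mset js) = bullets M"
      by (auto simp: root_graft_def corolla_def)
    moreover from this(2) obtain N where "branches \<tau> = bullets N" by (rule bullets_union_eq)
    ultimately have "\<tau> = corolla i N" by (cases \<tau>) (simp add: corolla_def)
    then show False using False by (auto simp: tree_depth_le_2)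
  qed
  then show ?thesis
    using False by (simp add: f_tree_deep part_deriv_zero)
qed

text \<open>A corolla of degree k consumes k - 1 of the \<open>m\<close> derivatives. The highest
  derivative is therefore always one of order \<open>m\<close> of a component, so all integrands
  share \<open>C\<close> and \<kappa>.\<close>

lemma f_tree_regular:
  assumes f: "\<And>i. n_differentiable m (component f i)"
    and holder: "\<And>i w x y. length w = m \<Longrightarrow>
      norm (part_deriv (component f i) w x - part_deriv (component f i) w y) \<le> C * norm (x - y) powr \<kappa>"
    and "0 \<le> C" and "tree_deg \<tau> \<le> Suc m"
  shows "n_differentiable (Suc m - tree_deg \<tau>) (f_tree f \<tau>)"
    and "length w = Suc m - tree_deg \<tau> \<Longrightarrow>
      norm (part_deriv (f_tree f \<tau>) w x - part_deriv (f_tree f \<tau>) w y) \<le> C * norm (x - y) powr \<kappa>"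
proof -
  have "n_differentiable (Suc m - tree_deg \<tau>) (f_tree f \<tau>) \<and> (length w = Suc m - tree_deg \<tau> \<longrightarrow>
      norm (part_deriv (f_tree f \<tau>) w x - part_deriv (f_tree f \<tau>) w y) \<le> C * norm (x - y) powr \<kappa>)"
  proof (cases "tree_depth \<tau> \<le> 2")
    case True
    then obtain i M where \<tau>: "\<tau> = corolla i M" by (auto simp: tree_depth_le_2)
    obtain js where js: "M = mset js" by (metis ex_mset)
    have len: "length js \<le> m" "Suc m - tree_deg \<tau> = m - length js"
      using assms(4) by (simp_all add: \<tau> js tree_deg_corolla)
    have eq: "f_tree f \<tau> = part_deriv (component f i) js"
      unfolding \<tau> js using len by (intro f_tree_corolla[OF f]) simp
    have "n_differentiable (m - length js) (part_deriv (component f i) js)"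
      by (rule n_differentiable_part_deriv[OF f]) (use len in simp)
    moreover have "norm (part_deriv (part_deriv (component f i) js) w x - part_deriv (part_deriv (component f i) js) w y)
        \<le> C * norm (x - y) powr \<kappa>" if "length w = m - length js"
      using holder[of "w @ js" i x y] that len by (simp add: part_deriv_append)
    ultimately show ?thesis by (simp add: eq len(2))
  next
    case False
    then show ?thesis
      using assms(3) by (simp add: f_tree_deep part_deriv_zero n_differentiable_zero)
  qed
  then show "n_differentiable (Suc m - tree_deg \<tau>) (f_tree f \<tau>)"
    "length w = Suc m - tree_deg \<tau> \<Longrightarrow>
      norm (part_deriv (f_tree f \<tau>) w x - part_deriv (f_tree f \<tau>) w y) \<le> C * norm (x - y) powr \<kappa>"
    by blast+
qed

text \<open>The order \<open>strict_floor (\<gamma> - 1)\<close> of derivatives of \<open>f\<close>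
  may exceed the order \<open>int_part p - 1\<close> that occurs. If they agree, \<kappa> is the
  Hoelder exponent \<open>\<gamma> - int_part p\<close>; otherwise one more derivative is bounded
  and \<kappa> = 1. Either way \<open>int_part p + \<kappa>\<close> exceeds
  \<open>p\<close>.\<close>

lemma component_regular:
  fixes f :: "real^'d::finite \<Rightarrow> ((real^'d) \<Rightarrow>\<^sub>L (real^'e::finite))"
  assumes lip: "is_lip (\<gamma> - 1) f" and "p < \<gamma>" and "1 \<le> p"
  obtains \<kappa> C where "0 < \<kappa>" "p < real (int_part p) + \<kappa>" "0 \<le> C"
    "\<And>i. n_differentiable (int_part p - 1) (component f i)"
    "\<And>i w x y. length w = int_part p - 1 \<Longrightarrow>
      norm (part_deriv (component f i) w x - part_deriv (component f i) w y) \<le> C * norm (x - y) powr \<kappa>"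
proof -
  define n where "n = int_part p"
  define N where "N = strict_floor (\<gamma> - 1)"
  have n: "1 \<le> n" "real n \<le> p" "p < real n + 1"
    using assms(3) by (simp_all add: n_def int_part_def le_nat_iff; linarith)+
  have "int n < \<lceil>\<gamma>\<rceil>"
    using n(2) assms(2) by (simp add: less_ceiling_iff)
  then have nN: "n - 1 \<le> N"
    using n(1) by (simp add: N_def strict_floor_def)
  have pos: "0 < \<gamma> - 1" using assms(2,3) by simp
  obtain L where L: "0 \<le> L"
    "\<And>vs x. length vs < N \<Longrightarrow> nth_deriv f vs differentiable (at x)"
    "\<And>vs x. length vs \<le> N \<Longrightarrow> (\<And>v. v \<in> set vs \<Longrightarrow> norm v \<le> 1) \<Longrightarrow> norm (nth_deriv f vs x) \<le> L"
    "\<And>vs x y. length vs = N \<Longrightarrow> (\<And>v. v \<in> set vs \<Longrightarrow> norm v \<le> 1) \<Longrightarrow>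
      norm (nth_deriv f vs x - nth_deriv f vs y) \<le> L * norm (x - y) powr (\<gamma> - 1 - N)"
    by (rule is_lip_bounds[OF lip pos, folded N_def]) (rule that; blast)
  have comp: "nth_deriv (component f i) vs = (\<lambda>x. blinfun_apply (nth_deriv f vs x) (axis i 1))"
    if "length vs \<le> N" for i vs
    using that
  proof (induction vs)
    case Nil
    show ?case by (simp add: component_def[abs_def])
  next
    case (Cons v vs)
    have "frechet_derivative (\<lambda>y. blinfun_apply (nth_deriv f vs y) (axis i 1)) (at x) =
        (\<lambda>v. blinfun_apply (frechet_derivative (nth_deriv f vs) (at x) v) (axis i 1))" for x
    proof -
      have "(nth_deriv f vs has_derivative frechet_derivative (nth_deriv f vs) (at x)) (at x)"
        using L(2)[of vs x] Cons.prems by (simp add: frechet_derivative_works)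
      then have "((\<lambda>y. blinfun_apply (nth_deriv f vs y) (axis i 1)) has_derivative
          (\<lambda>v. blinfun_apply (frechet_derivative (nth_deriv f vs) (at x) v) (axis i 1))) (at x)"
        by (rule bounded_linear.has_derivative[OF blinfun.bounded_linear_left])
      then show ?thesis by (rule frechet_derivative_at[symmetric])
    qed
    then show ?case using Cons by simp
  qed
  have diff: "n_differentiable (n - 1) (component f i)" for i
    unfolding n_differentiable_def
  proof (intro allI impI)
    fix vs :: "(real^'d) list" and x assume vs: "length vs < n - 1"
    then have "nth_deriv f vs differentiable (at x)" using L(2) nN by simp
    then have "(\<lambda>x. blinfun_apply (nth_deriv f vs x) (axis i 1)) differentiable (at x)"
      unfolding differentiable_def using bounded_linear.has_derivative[OF blinfun.bounded_linear_left] by blast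
    then show "nth_deriv (component f i) vs differentiable (at x)"
      using comp[of vs i] vs nN by simp
  qed
  have part: "norm (part_deriv (component f i) w x - part_deriv (component f i) w y) \<le>
      norm (nth_deriv f (map (\<lambda>i. axis i 1) w) x - nth_deriv f (map (\<lambda>i. axis i 1) w) y)"
    if "length w = n - 1" for i w x y
  proof -
    let ?vs = "map (\<lambda>i. axis i 1) w :: (real^'d) list"
    have "part_deriv (component f i) w x - part_deriv (component f i) w y =
        blinfun_apply (nth_deriv f ?vs x - nth_deriv f ?vs y) (axis i 1)"
      using comp[of ?vs i] that nN by (simp add: part_deriv_def blinfun.diff_left)
    then show ?thesis
      using norm_blinfun[of "nth_deriv f ?vs x - nth_deriv f ?vs y" "axis i 1"] by simp
  qed
  have axes: "norm v \<le> 1" if "v \<in> set (map (\<lambda>i. axis i 1) w)" for v :: "real^'d" and w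
    using that by auto
  show thesis
  proof (cases "N = n - 1")
    case True
    show thesis
    proof (rule that[of "\<gamma> - real n" L])
      show "norm (part_deriv (component f i) w x - part_deriv (component f i) w y) \<le> L * norm (x - y) powr (\<gamma> - real n)"
        if w: "length w = int_part p - 1" for i w x y
      proof -
        let ?vs = "map (\<lambda>i. axis i 1) w :: (real^'d) list"
        have "norm (part_deriv (component f i) w x - part_deriv (component f i) w y) \<le>
            norm (nth_deriv f ?vs x - nth_deriv f ?vs y)"
          using w by (intro part) (simp add: n_def)
        also have "\<dots> \<le> L * norm (x - y) powr (\<gamma> - 1 - real N)"
          by (rule L(4)) (use w True axes in \<open>auto simp: n_def\<close>)
        also have "\<gamma> - 1 - real N = \<gamma> - real n"
          using True n(1) by (simp add: of_nat_diff)
        finally show ?thesis .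
      qed
    qed (use n assms(2) L(1) diff in \<open>auto simp: n_def\<close>)
  next
    case False
    then have N: "n - 1 < N" using nN by simp
    \<comment> \<open>The next derivative is bounded, so the mean value inequality applies;
      \<open>sgn v\<close> reduces its operator norm to directions in the unit ball.\<close>
    have "norm (nth_deriv f vs x - nth_deriv f vs y) \<le> L * norm (x - y)"
      if vs: "length vs = n - 1" "\<And>v. v \<in> set vs \<Longrightarrow> norm v \<le> 1" for vs x y
    proof (rule differentiable_bound[OF convex_UNIV])
      show der: "(nth_deriv f vs has_derivative frechet_derivative (nth_deriv f vs) (at z)) (at z)" for z
        using L(2)[of vs z] vs N by (simp add: frechet_derivative_works)
      show "onorm (frechet_derivative (nth_deriv f vs) (at z)) \<le> L" for z
      proof (rule onorm_le)
        fix v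
        let ?D = "frechet_derivative (nth_deriv f vs) (at z)"
        have lin: "linear ?D" using der by (rule has_derivative_linear)
        have "norm (nth_deriv f (sgn v # vs) z) \<le> L"
          by (rule L(3)) (use vs N in \<open>auto simp: norm_sgn\<close>)
        then have "norm (?D (sgn v)) \<le> L" by simp
        moreover have "?D v = norm v *\<^sub>R ?D (sgn v)"
          by (cases "v = 0") (simp_all add: sgn_div_norm linear_cmul[OF lin] linear_0[OF lin])
        ultimately show "norm (?D v) \<le> L * norm v"
          by (simp add: mult_left_mono mult.commute[of L])
      qed
    qed auto
    then have lipschitz: "norm (part_deriv (component f i) w x - part_deriv (component f i) w y) \<le> L * norm (x - y)"
      if "length w = n - 1" for i w x y
      using order_trans[OF part] axes that by (metis length_map)
    show thesis
      by (rule that[of 1 L]) (use n L(1) diff lipschitz in \<open>auto simp: n_def\<close>)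
  qed
qed

lemma sum_length_le:
  fixes c :: "'a::finite list \<Rightarrow> 'b::comm_monoid_add"
  shows "(\<Sum>l\<in>{0..m}. \<Sum>w | length w = l. c w) = (\<Sum>w | length w \<le> m. c w)"
proof -
  have "(\<Sum>w | length w \<le> m. c w) = (\<Sum>l\<in>{0..m}. \<Sum>w\<in>{w \<in> {w. length w \<le> m}. length w = l}. c w)"
    by (rule sum.group[symmetric]) (auto simp: finite_lists_of_length_le)
  also have "\<dots> = (\<Sum>l\<in>{0..m}. \<Sum>w | length w = l. c w)"
    by (intro sum.cong) auto
  finally show ?thesis ..
qed

text \<open>Groups cuts by their suffix \<open>v\<close>: in Chen's relation \<open>v\<close> stays
  with the second increment, while all prefixes \<open>u\<close> together form a Taylor
  polynomial.\<close>

lemma sum_splits_length_le: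
  fixes c :: "'a::finite list \<Rightarrow> 'a list \<Rightarrow> 'b::comm_monoid_add"
  shows "(\<Sum>w | length w \<le> m. \<Sum>q | fst q @ snd q = w. c (fst q) (snd q)) =
    (\<Sum>v | length v \<le> m. \<Sum>u | length u \<le> m - length v. c u v)"
proof -
  have "(\<Sum>w | length w \<le> m. \<Sum>q | fst q @ snd q = w. c (fst q) (snd q)) =
      (\<Sum>(w, q)\<in>(SIGMA w:{w. length w \<le> m}. {q. fst q @ snd q = w}). c (fst q) (snd q))"
    by (rule sum.Sigma) (auto simp: finite_lists_of_length_le finite_splits)
  also have "\<dots> = (\<Sum>(v, u)\<in>(SIGMA v:{v. length v \<le> m}. {u. length u \<le> m - length v}). c u v)"
    by (rule sum.reindex_bij_witness[of _ "\<lambda>(v, u). (u @ v, (u, v))" "\<lambda>(w, q). (snd q, fst q)"]) auto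
  also have "\<dots> = (\<Sum>v | length v \<le> m. \<Sum>u | length u \<le> m - length v. c u v)"
    by (rule sum.Sigma[symmetric]) (auto simp: finite_lists_of_length_le)
  finally show ?thesis .
qed

lemma shuffle_mset_map: "shuffle_mset (map f xs) (map f ys) = image_mset (map f) (shuffle_mset xs ys)"
  by (induction xs ys rule: shuffle_mset.induct) (simp_all add: multiset.map_comp comp_def)

lemma (in group) left_quotient:
  assumes "a \<in> carrier G" "b \<in> carrier G"
  shows "inv a \<otimes> b \<in> carrier G" "a \<otimes> (inv a \<otimes> b) = b"
  using assms by (simp_all add: m_assoc[symmetric])

section \<open>The first level integrals\<close>

context letters
begin

text \<open>The isomorphism is known for \<open>a\<close> and for the product, and is wanted for the
  right factor. Both group laws give the same triangular system in the number of leaves, which can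
  be solved for that factor.\<close>

lemma tree_coeff_increment:
  assumes iso: "isomorphic_at \<nu> n a h" "isomorphic_at \<nu> n (a \<otimes>\<^bsub>character_group n\<^esub> b) (h \<otimes>\<^bsub>pi_group \<nu> n\<^esub> k)"
    and "b {#} = 1" and "k [] = 1" and "h [] = 1"
  shows "size M < n \<Longrightarrow> b {#corolla i M#} / forest_sigma (bullets M) = tree_coeff k (corolla i M)"
proof (induction "size M" arbitrary: M rule: less_induct)
  case less
  let ?s = "\<lambda>M. real (forest_sigma (bullets M))"
  let ?P = "{p. fst p + snd p = M}"
  define D where "D N = b {#corolla i N#} / ?s N - tree_coeff k (corolla i N)" for N
  have "(\<Sum>p\<in>?P. a (bullets (fst p)) / ?s (fst p) * (b {#corolla i (snd p)#} / ?s (snd p))) =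
      (\<Sum>p\<in>?P. bullets_coeff h (fst p) * tree_coeff k (corolla i (snd p)))"
    using character_mult_corolla[of M n b a i, OF less.prems assms(3)]
      tree_coeff_mult[of "h \<otimes>\<^bsub>pi_group \<nu> n\<^esub> k" h k M i] less.prems assms(4)
      isomorphic_at_corolla[OF iso(1) less.prems] isomorphic_at_corolla[OF iso(2) less.prems]
    by (simp add: pi_group_def)
  moreover have "a (bullets (fst p)) / ?s (fst p) = bullets_coeff h (fst p)" if "p \<in> ?P" for p
    using that less.prems by (intro isomorphic_at_bullets[OF iso(1)]) auto
  ultimately have "(\<Sum>p\<in>?P. bullets_coeff h (fst p) * D (snd p)) = 0"
    by (simp add: D_def right_diff_distrib sum_subtractf)
  \<comment> \<open>A nonempty left part makes the right one smaller, so only the splitting with all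
    leaves on the right is left; its coefficient is \<open>h []\<close> = 1.\<close>
  moreover have "bullets_coeff h (fst p) * D (snd p) = 0" if "p \<in> ?P - {({#}, M)}" for p
  proof -
    have "fst p \<noteq> {#}" using that by (cases p) auto
    then have "size (snd p) < size M" using that by (auto simp: nonempty_has_size)
    then show ?thesis
      using less.hyps[of "snd p"] less.prems by (simp add: D_def)
  qed
  then have "(\<Sum>p\<in>?P. bullets_coeff h (fst p) * D (snd p)) = (\<Sum>p\<in>{({#}, M)}. bullets_coeff h (fst p) * D (snd p))"
    by (intro sum.mono_neutral_right finite_mset_splits) auto
  ultimately have "bullets_coeff h {#} * D M = 0" by simp
  moreover have "bullets_coeff h {#} = 1" by (simp add: bullets_coeff_def assms(5))
  ultimately show ?case by (simp add: D_def)
qed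

text \<open>A word \<open>is\<close> with last letter \<open>j\<close> belongs to exactly one tree,
  \<open>root_graft (\<nu> j) (mset is)\<close>, of degree
  \<open>tree_deg (\<nu> j) + length is\<close>. Regrouping by this tree turns one sum into the
  other; at trees deeper than 2 the coefficients may differ but are multiplied by 0.\<close>

lemma branched_sum_eq:
  fixes f :: "real^'d \<Rightarrow> ((real^'d) \<Rightarrow>\<^sub>L (real^'e::finite))"
  assumes b: "\<And>i M. size M < n \<Longrightarrow> b {#corolla i M#} / forest_sigma (bullets M) = tree_coeff k (corolla i M)"
    and f: "\<And>j js. tree_deg (\<nu> j) + length js \<le> n \<Longrightarrow>
      part_deriv (f_tree f (\<nu> j)) js = f_tree f (root_graft (\<nu> j) (mset js))"
  shows "(\<Sum>\<tau> | tree_deg \<tau> \<le> n. (b {#\<tau>#} / real (tree_sigma \<tau>)) *\<^sub>R f_tree f \<tau> x) =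
    (\<Sum>j\<in>UNIV. \<Sum>l\<in>{0..n - tree_deg (\<nu> j)}. \<Sum>is | length is = l.
      k (map \<iota> is @ [j]) *\<^sub>R part_deriv (f_tree f (\<nu> j)) is x)"
proof -
  let ?c = "\<lambda>q. k (map \<iota> (fst q) @ [snd q]) *\<^sub>R f_tree f (root_graft (\<nu> (snd q)) (mset (fst q))) x"
  let ?S = "{q. tree_deg (root_graft (\<nu> (snd q)) (mset (fst q))) \<le> n}"
  let ?Q = "\<lambda>\<tau>. {q. root_graft (\<nu> (snd q)) (mset (fst q)) = \<tau>}"
  have fin: "finite ?S"
  proof (rule finite_subset)
    show "?S \<subseteq> {is. length is \<le> n} \<times> UNIV" by (auto simp: tree_deg_root_graft)
  qed (simp add: finite_lists_of_length_le)
  have "(\<Sum>\<tau> | tree_deg \<tau> \<le> n. (b {#\<tau>#} / real (tree_sigma \<tau>)) *\<^sub>R f_tree f \<tau> x) =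
      (\<Sum>\<tau> | tree_deg \<tau> \<le> n. tree_coeff k \<tau> *\<^sub>R f_tree f \<tau> x)"
  proof (intro sum.cong refl)
    fix \<tau> :: "'d rtree" assume \<tau>: "\<tau> \<in> {\<tau>. tree_deg \<tau> \<le> n}"
    show "(b {#\<tau>#} / real (tree_sigma \<tau>)) *\<^sub>R f_tree f \<tau> x = tree_coeff k \<tau> *\<^sub>R f_tree f \<tau> x"
    proof (cases "tree_depth \<tau> \<le> 2")
      case True
      then obtain i M where "\<tau> = corolla i M" by (auto simp: tree_depth_le_2)
      then show ?thesis
        using b[of M i] \<tau>
        by (simp add: tree_deg_corolla) (simp add: corolla_def tree_sigma_Node del: tree_sigma.simps)
    qed (simp add: f_tree_deep)
  qed
  also have "\<dots> = (\<Sum>\<tau> | tree_deg \<tau> \<le> n. \<Sum>q\<in>{q \<in> ?S. root_graft (\<nu> (snd q)) (mset (fst q)) = \<tau>}. ?c q)"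
  proof (intro sum.cong refl)
    fix \<tau> :: "'d rtree" assume "\<tau> \<in> {\<tau>. tree_deg \<tau> \<le> n}"
    then have "{q \<in> ?S. root_graft (\<nu> (snd q)) (mset (fst q)) = \<tau>} = ?Q \<tau>" by auto
    moreover have "tree_coeff k \<tau> *\<^sub>R f_tree f \<tau> x = (\<Sum>q\<in>?Q \<tau>. ?c q)"
      unfolding tree_coeff_def case_prod_unfold scaleR_sum_left by (rule sum.cong) auto
    ultimately show "tree_coeff k \<tau> *\<^sub>R f_tree f \<tau> x =
        (\<Sum>q\<in>{q \<in> ?S. root_graft (\<nu> (snd q)) (mset (fst q)) = \<tau>}. ?c q)" by simp
  qed
  also have "\<dots> = (\<Sum>q\<in>?S. ?c q)"
    by (rule sum.group[OF fin]) (use finite_trees_forests in auto)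
  also have "\<dots> = (\<Sum>(j, is)\<in>(SIGMA j:UNIV. {is. length is \<le> n - tree_deg (\<nu> j)}). ?c (is, j))"
    by (rule sum.reindex_bij_witness[of _ "\<lambda>(j, is). (is, j)" "\<lambda>(is, j). (j, is)"])
      (use deg_\<nu> in \<open>auto simp: tree_deg_root_graft le_diff_conv2 add.commute\<close>)
  also have "\<dots> = (\<Sum>j\<in>UNIV. \<Sum>is | length is \<le> n - tree_deg (\<nu> j). ?c (is, j))"
    by (rule sum.Sigma[symmetric]) (auto simp: finite_lists_of_length_le)
  also have "\<dots> = (\<Sum>j\<in>UNIV. \<Sum>is | length is \<le> n - tree_deg (\<nu> j).
      k (map \<iota> is @ [j]) *\<^sub>R part_deriv (f_tree f (\<nu> j)) is x)"
    using deg_\<nu> by (intro sum.cong refl) (simp add: f le_diff_conv2 add.commute)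
  finally show ?thesis
    by (simp only: sum_length_le)
qed

section \<open>Almost additivity of the approximations along \<open>Z\<close>\<close>

definition pi_sum :: "('k list \<Rightarrow> real) \<Rightarrow> ('k \<Rightarrow> real^'d \<Rightarrow> 'b::real_normed_vector) \<Rightarrow> real^'d \<Rightarrow> 'b"
  where "pi_sum h D x = (\<Sum>j\<in>UNIV. \<Sum>w | length w \<le> n - tree_deg (\<nu> j).
    h (map \<iota> w @ [j]) *\<^sub>R part_deriv (D j) w x)"

lemma pi_approx_eq:
  "pi_approx \<nu> \<iota> n x Z g u v =
    pi_sum (group_incr (pi_group \<nu> n) Z u v) (\<lambda>j. component g j) (x u)"
  by (simp add: pi_approx_def pi_sum_def sum_length_le)

text \<open>Cuts behind the last letter cancel against \<open>pi_sum h D x\<close>. In the others, a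
  fixed right part \<open>v\<close> with last letter \<open>j\<close> leaves all prefixes up to the
  complementary length; they form the Taylor polynomial at \<open>x\<close> of the derivative along
  \<open>v\<close>, which is compared with the value at \<open>y\<close>.\<close>

lemma pi_sum_mult:
  assumes D: "\<And>j. n_differentiable (n - tree_deg (\<nu> j)) (D j)" and "k [] = 1"
  shows "pi_sum (h \<otimes>\<^bsub>pi_group \<nu> n\<^esub> k) D x - pi_sum h D x - pi_sum k D y =
    (\<Sum>j\<in>UNIV. \<Sum>v | length v \<le> n - tree_deg (\<nu> j). k (map \<iota> v @ [j]) *\<^sub>R
      ((\<Sum>q\<le>n - tree_deg (\<nu> j) - length v. taylor_term (\<lambda>w. h (map \<iota> w)) q (part_deriv (D j) v) x) -
        part_deriv (D j) v y))"
proof -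
  have "pi_sum (h \<otimes>\<^bsub>pi_group \<nu> n\<^esub> k) D x = pi_sum h D x +
      (\<Sum>j\<in>UNIV. \<Sum>w | length w \<le> n - tree_deg (\<nu> j). \<Sum>q | fst q @ snd q = w.
        (h (map \<iota> (fst q)) * k (map \<iota> (snd q) @ [j])) *\<^sub>R part_deriv (D j) (fst q @ snd q) x)"
    unfolding pi_sum_def sum.distrib[symmetric]
  proof (intro sum.cong refl)
    fix j w assume "w \<in> {w :: 'd list. length w \<le> n - tree_deg (\<nu> j)}"
    then have "word_deg \<nu> (map \<iota> w @ [j]) \<le> n"
      using deg_\<nu>[of j] by (simp add: word_deg_\<iota>)
    then have "(h \<otimes>\<^bsub>pi_group \<nu> n\<^esub> k) (map \<iota> w @ [j]) = h (map \<iota> w @ [j]) +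
        (\<Sum>q | fst q @ snd q = w. h (map \<iota> (fst q)) * k (map \<iota> (snd q) @ [j]))"
      by (intro mult_snoc assms(2)) (simp add: pi_group_def)
    then show "(h \<otimes>\<^bsub>pi_group \<nu> n\<^esub> k) (map \<iota> w @ [j]) *\<^sub>R part_deriv (D j) w x =
        h (map \<iota> w @ [j]) *\<^sub>R part_deriv (D j) w x + (\<Sum>q | fst q @ snd q = w.
          (h (map \<iota> (fst q)) * k (map \<iota> (snd q) @ [j])) *\<^sub>R part_deriv (D j) (fst q @ snd q) x)"
      by (simp add: scaleR_add_left scaleR_sum_left)
  qed
  also have "(\<Sum>j\<in>UNIV. \<Sum>w | length w \<le> n - tree_deg (\<nu> j). \<Sum>q | fst q @ snd q = w.
        (h (map \<iota> (fst q)) * k (map \<iota> (snd q) @ [j])) *\<^sub>R part_deriv (D j) (fst q @ snd q) x) =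
      (\<Sum>j\<in>UNIV. \<Sum>v | length v \<le> n - tree_deg (\<nu> j). k (map \<iota> v @ [j]) *\<^sub>R
        (\<Sum>q\<le>n - tree_deg (\<nu> j) - length v. taylor_term (\<lambda>w. h (map \<iota> w)) q (part_deriv (D j) v) x))"
    unfolding sum_splits_length_le[where c = "\<lambda>u v. (h (map \<iota> u) * k (map \<iota> v @ [j])) *\<^sub>R part_deriv (D j) (u @ v) x" for j]
    by (intro sum.cong refl)
      (simp add: taylor_term_def atMost_atLeast0 sum_length_le part_deriv_append scaleR_sum_right mult.commute)
  finally show ?thesis
    by (simp add: pi_sum_def[of k] scaleR_diff_right sum_subtractf)
qed

lemma pi_sum_almost_additive:
  assumes D: "\<And>j. n_differentiable (n - tree_deg (\<nu> j)) (D j)"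
    and holder: "\<And>j w x y. length w = n - tree_deg (\<nu> j) \<Longrightarrow>
      norm (part_deriv (D j) w x - part_deriv (D j) w y) \<le> C * norm (x - y) powr \<kappa>"
    and C: "0 \<le> C" and \<kappa>: "0 < \<kappa>"
    and h: "h \<in> carrier (pi_group \<nu> n)" and k: "k \<in> carrier (pi_group \<nu> n)" and N: "0 \<le> N"
    and hN: "\<And>w. 1 \<le> word_deg \<nu> w \<Longrightarrow> word_deg \<nu> w \<le> n \<Longrightarrow> \<bar>h w\<bar> \<le> N ^ word_deg \<nu> w"
    and kN: "\<And>w. 1 \<le> word_deg \<nu> w \<Longrightarrow> word_deg \<nu> w \<le> n \<Longrightarrow> \<bar>k w\<bar> \<le> N ^ word_deg \<nu> w"
    and y: "y = x + (\<chi> i. h [\<iota> i])"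
  shows "norm (pi_sum (h \<otimes>\<^bsub>pi_group \<nu> n\<^esub> k) D x - pi_sum h D x - pi_sum k D y) \<le>
    (\<Sum>j\<in>UNIV. \<Sum>v :: 'd list | length v \<le> n - tree_deg (\<nu> j).
      C * real CARD('d) ^ (n - tree_deg (\<nu> j) - length v) * real CARD('d) powr \<kappa>) * N powr (real n + \<kappa>)"
proof -
  let ?z = "\<lambda>w. h (map \<iota> w)"
  have h1: "h [] = 1" and h_shuffle: "\<And>u v. word_deg \<nu> u + word_deg \<nu> v \<le> n \<Longrightarrow>
      h u * h v = (\<Sum>w\<in>#shuffle_mset u v. h w)"
    using h by (auto simp: pi_group_def)
  have k1: "k [] = 1" using k by (simp add: pi_group_def)
  have bound: "norm (k (map \<iota> v @ [j]) *\<^sub>R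
      ((\<Sum>q\<le>n - tree_deg (\<nu> j) - length v. taylor_term ?z q (part_deriv (D j) v) x) - part_deriv (D j) v y)) \<le>
      C * real CARD('d) ^ (n - tree_deg (\<nu> j) - length v) * real CARD('d) powr \<kappa> * N powr (real n + \<kappa>)"
    if v: "length v \<le> n - tree_deg (\<nu> j)" for j v
  proof -
    define r where "r = n - tree_deg (\<nu> j) - length v"
    have r: "r + length v = n - tree_deg (\<nu> j)" "r + (length v + tree_deg (\<nu> j)) = n" "r < n"
      using v deg_\<nu>[of j] tree_deg_pos[of "\<nu> j"] by (auto simp: r_def simp del: tree_deg_pos)
    have n1: "1 \<le> n" using r(3) by simp
    have "norm (part_deriv (D j) v (x + 1 *\<^sub>R (\<chi> i. ?z [i])) - (\<Sum>q\<le>r. 1 ^ q *\<^sub>R taylor_term ?z q (part_deriv (D j) v) x)) \<le>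
        C * (real CARD('d) * N) ^ r * (real CARD('d) * N) powr \<kappa>"
    proof (rule taylor_remainder)
      show "n_differentiable r (part_deriv (D j) v)"
        by (rule n_differentiable_part_deriv[OF D[of j]]) (use r in simp)
      show "norm (part_deriv (part_deriv (D j) v) w x - part_deriv (part_deriv (D j) v) w y) \<le> C * norm (x - y) powr \<kappa>"
        if "length w = r" for w x y
        using holder[of "w @ v" j x y] that r(1) by (simp add: part_deriv_append)
      show "?z [i] * ?z w = (\<Sum>u\<in>#shuffle_mset [i] w. ?z u)" if "length w < r" for i w
      proof -
        have "?z [i] * ?z w = (\<Sum>u\<in>#shuffle_mset (map \<iota> [i]) (map \<iota> w). h u)"
          by (rule h_shuffle) (use that r in \<open>simp add: word_deg_\<iota> \<nu>_\<iota>\<close>)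
        then show ?thesis
          unfolding shuffle_mset_map by (simp add: multiset.map_comp comp_def)
      qed
      show "\<bar>?z [i]\<bar> \<le> N" for i
        using hN[of "[\<iota> i]"] n1 by (simp add: \<nu>_\<iota>)
    qed (use h1 C \<kappa> in auto)
    then have taylor: "norm ((\<Sum>q\<le>r. taylor_term ?z q (part_deriv (D j) v) x) - part_deriv (D j) v y) \<le>
        C * (real CARD('d) * N) ^ r * (real CARD('d) * N) powr \<kappa>"
      by (simp add: y norm_minus_commute)
    have "\<bar>k (map \<iota> v @ [j])\<bar> \<le> N ^ (length v + tree_deg (\<nu> j))"
      using kN[of "map \<iota> v @ [j]"] r tree_deg_pos[of "\<nu> j"] by (simp add: word_deg_\<iota> Suc_le_eq del: tree_deg_pos)
    then have "norm (k (map \<iota> v @ [j]) *\<^sub>R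
        ((\<Sum>q\<le>r. taylor_term ?z q (part_deriv (D j) v) x) - part_deriv (D j) v y)) \<le>
        N ^ (length v + tree_deg (\<nu> j)) * (C * (real CARD('d) * N) ^ r * (real CARD('d) * N) powr \<kappa>)"
      using taylor N by (auto intro!: mult_mono)
    \<comment> \<open>The powers of \<open>N\<close> add up to \<open>n + \<kappa>\<close> for every
      \<open>j\<close> and \<open>v\<close>: the degree of the word from \<open>k\<close>, the order
      \<open>r\<close> of the Taylor polynomial, and \<kappa> from the Hoelder bound.\<close>
    also have "\<dots> = C * real CARD('d) ^ r * real CARD('d) powr \<kappa> * (N ^ n * N powr \<kappa>)"
      unfolding r(2)[symmetric] using N by (simp add: power_mult_distrib powr_mult power_add)
    also have "N ^ n * N powr \<kappa> = N powr (real n + \<kappa>)"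
      using N by (cases "N = 0") (simp_all add: powr_add powr_realpow)
    finally show ?thesis by (simp only: r_def)
  qed
  have "norm (pi_sum (h \<otimes>\<^bsub>pi_group \<nu> n\<^esub> k) D x - pi_sum h D x - pi_sum k D y) \<le>
      (\<Sum>j\<in>UNIV. \<Sum>v :: 'd list | length v \<le> n - tree_deg (\<nu> j).
        C * real CARD('d) ^ (n - tree_deg (\<nu> j) - length v) * real CARD('d) powr \<kappa> * N powr (real n + \<kappa>))"
    unfolding pi_sum_mult[where D = D and k = k, OF D k1] by (intro sum_norm_le bound) simp
  then show ?thesis by (simp add: sum_distrib_right)
qed

section \<open>Smallness of increments in the homogeneous norm\<close>

lemma finite_word_degs: "finite {w. 1 \<le> word_deg \<nu> w \<and> word_deg \<nu> w \<le> n}"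
  by (rule finite_subset[OF _ finite_words[of \<nu> n]]) auto

lemma word_degs_nonempty: "1 \<le> n \<Longrightarrow> {w. 1 \<le> word_deg \<nu> w \<and> word_deg \<nu> w \<le> n} \<noteq> {}"
  using \<nu>_\<iota>[of undefined] by (auto intro!: exI[of _ "[\<iota> undefined]"])

lemma hom_norm_nonneg: "1 \<le> n \<Longrightarrow> 0 \<le> hom_norm (word_deg \<nu>) n a"
  unfolding hom_norm_def using word_degs_nonempty finite_word_degs
  by (subst Max_ge_iff) auto

lemma le_hom_norm_power:
  assumes "1 \<le> word_deg \<nu> w" "word_deg \<nu> w \<le> n"
  shows "\<bar>a w\<bar> \<le> hom_norm (word_deg \<nu>) n a ^ word_deg \<nu> w"
proof -
  let ?m = "word_deg \<nu> w"
  have "\<bar>a w\<bar> powr (1 / ?m) \<le> hom_norm (word_deg \<nu>) n a"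
    unfolding hom_norm_def using finite_word_degs assms by (intro Max_ge) auto
  then have "(\<bar>a w\<bar> powr (1 / ?m)) ^ ?m \<le> hom_norm (word_deg \<nu>) n a ^ ?m"
    by (intro power_mono) auto
  moreover have "(\<bar>a w\<bar> powr (1 / ?m)) ^ ?m = \<bar>a w\<bar>"
    using assms(1) by (cases "a w = 0") (simp_all add: powr_realpow[symmetric] powr_powr)
  ultimately show ?thesis by simp
qed

lemma hom_norm_le:
  assumes "1 \<le> n" and "0 \<le> \<epsilon>" and "\<And>w. 1 \<le> word_deg \<nu> w \<Longrightarrow> word_deg \<nu> w \<le> n \<Longrightarrow> \<bar>a w\<bar> \<le> \<epsilon> ^ word_deg \<nu> w"
  shows "hom_norm (word_deg \<nu>) n a \<le> \<epsilon>"
  unfolding hom_norm_def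
proof (rule Max.boundedI)
  fix y assume "y \<in> (\<lambda>i. \<bar>a i\<bar> powr (1 / word_deg \<nu> i)) ` {i. 1 \<le> word_deg \<nu> i \<and> word_deg \<nu> i \<le> n}"
  then obtain w where w: "1 \<le> word_deg \<nu> w" "word_deg \<nu> w \<le> n" and y: "y = \<bar>a w\<bar> powr (1 / word_deg \<nu> w)" by auto
  have "y \<le> (\<epsilon> ^ word_deg \<nu> w) powr (1 / word_deg \<nu> w)"
    unfolding y using assms(3)[OF w] by (intro powr_mono2) auto
  also have "\<dots> = \<epsilon>"
    using assms(2) w(1) by (cases "\<epsilon> = 0") (simp_all add: powr_realpow[symmetric] powr_powr)
  finally show "y \<le> \<epsilon>" .
qed (use word_degs_nonempty[OF assms(1)] finite_word_degs in auto)

text \<open>By Chen's relation \<open>Z b w - Z a w\<close> is the increment at \<open>w\<close>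
  plus products of \<open>Z a\<close> at a proper prefix with increments at shorter words. The
  difference is small by uniform continuity, the products by induction and boundedness of
  \<open>Z\<close> on the compact interval. The filter of pairs in \<open>[0, T]\<close> with
  \<open>b - a\<close> tending to 0 expresses uniformity.\<close>

lemma increment_small:
  assumes Z: "\<And>t. t \<in> {0..T} \<Longrightarrow> Z t \<in> carrier (pi_group \<nu> n)" and cont: "continuous_on {0..T} Z"
    and "1 \<le> word_deg \<nu> w" "word_deg \<nu> w \<le> n"
  shows "((\<lambda>(a, b). group_incr (pi_group \<nu> n) Z a b w) \<longlongrightarrow> 0)
    (inf (filtercomap (\<lambda>(a, b). b - a) (nhds 0)) (principal ({0..T} \<times> {0..T})))" (is "(_ \<longlongrightarrow> _) ?F")
  using assms(3,4)
proof (induction "length w" arbitrary: w rule: less_induct)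
  case less
  interpret group "pi_group \<nu> n" by (rule group_pi_group)
  let ?G = "pi_group \<nu> n"
  let ?Z = "group_incr ?G Z"
  have inF: "\<forall>\<^sub>F p in ?F. p \<in> {0..T} \<times> {0..T}"
    by (simp add: eventually_inf_principal)
  have cont_w: "continuous_on {0..T} (\<lambda>t. Z t u)" for u
    using cont by (rule continuous_on_product_then_coordinatewise)
  let ?S = "{q. fst q @ snd q = w} - {(w, []), ([], w)}"
  have w: "w \<noteq> []" using less.prems by auto
  have eq: "?Z a b w = (Z b w - Z a w) - (\<Sum>q\<in>?S. Z a (fst q) * ?Z a b (snd q))"
    if ab: "a \<in> {0..T}" "b \<in> {0..T}" for a b
  proof -
    let ?h = "?Z a b"
    have h: "?h \<in> carrier ?G" "Z a \<otimes>\<^bsub>?G\<^esub> ?h = Z b"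
      using left_quotient[OF Z Z] ab by (simp_all add: group_incr_def)
    have one: "Z a [] = 1" "?h [] = 1"
      using Z[OF ab(1)] h(1) by (simp_all add: pi_group_def)
    have "Z b w = (\<Sum>q | fst q @ snd q = w. Z a (fst q) * ?h (snd q))"
      using less.prems(2) unfolding h(2)[symmetric] by (simp add: pi_group_def case_prod_unfold)
    also have "\<dots> = (\<Sum>q\<in>{(w, []), ([], w)}. Z a (fst q) * ?h (snd q)) + (\<Sum>q\<in>?S. Z a (fst q) * ?h (snd q))"
      by (subst sum.subset_diff[of "{(w, []), ([], w)}"]) (auto simp: finite_splits)
    also have "(\<Sum>q\<in>{(w, []), ([], w)}. Z a (fst q) * ?h (snd q)) = Z a w + ?h w"
      using w one by simp
    finally show ?thesis by simp
  qed
  have "((\<lambda>p. Z (snd p) w - Z (fst p) w) \<longlongrightarrow> 0) ?F"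
  proof (rule tendstoI)
    fix \<epsilon> :: real assume "0 < \<epsilon>"
    then obtain \<delta> where \<delta>: "0 < \<delta>" "\<And>a b. a \<in> {0..T} \<Longrightarrow> b \<in> {0..T} \<Longrightarrow> dist b a < \<delta> \<Longrightarrow> dist (Z b w) (Z a w) < \<epsilon>"
      using compact_uniformly_continuous[OF cont_w compact_Icc, of w]
      unfolding uniformly_continuous_on_def by metis
    have "\<forall>\<^sub>F d in nhds (0::real). \<bar>d\<bar> < \<delta>"
      using \<delta>(1) by (auto simp: eventually_nhds_metric dist_real_def)
    then have "\<forall>\<^sub>F p in filtercomap (\<lambda>(a, b). b - a) (nhds 0). \<bar>snd p - fst p\<bar> < \<delta>"
      by (auto simp: eventually_filtercomap case_prod_unfold)
    then show "\<forall>\<^sub>F p in ?F. dist (Z (snd p) w - Z (fst p) w) 0 < \<epsilon>"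
      unfolding eventually_inf_principal
      by (rule eventually_mono) (use \<delta>(2) in \<open>auto simp: dist_real_def\<close>)
  qed
  moreover have "((\<lambda>p. \<Sum>q\<in>?S. Z (fst p) (fst q) * ?Z (fst p) (snd p) (snd q)) \<longlongrightarrow> 0) ?F"
  proof (rule tendsto_null_sum)
    fix q assume q: "q \<in> ?S"
    have sub: "fst q \<noteq> []" "snd q \<noteq> []" "fst q @ snd q = w" using q by (cases q; auto)+
    have deg: "1 \<le> word_deg \<nu> (snd q)" "word_deg \<nu> (snd q) \<le> n"
      using sub(2) less.prems(2) word_deg_eq_0[of \<nu> "snd q"] word_deg_simps(3)[of \<nu> "fst q" "snd q"]
      unfolding sub(3) by (simp_all add: Suc_le_eq)
    have shorter: "length (snd q) < length w"
      using sub(1)[folded length_greater_0_conv] arg_cong[OF sub(3), of length, unfolded length_append] by linarith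
    have "bounded ((\<lambda>t. Z t (fst q)) ` {0..T})"
      by (intro compact_imp_bounded compact_continuous_image cont_w compact_Icc)
    then obtain B where B: "\<And>t. t \<in> {0..T} \<Longrightarrow> norm (Z t (fst q)) \<le> B"
      unfolding bounded_iff by (metis image_eqI)
    show "((\<lambda>p. Z (fst p) (fst q) * ?Z (fst p) (snd p) (snd q)) \<longlongrightarrow> 0) ?F"
    proof (rule lim_null_mult_left_bounded)
      show "\<forall>\<^sub>F p in ?F. norm (Z (fst p) (fst q)) \<le> B"
        using inF by (rule eventually_mono) (use B in auto)
      show "((\<lambda>p. ?Z (fst p) (snd p) (snd q)) \<longlongrightarrow> 0) ?F"
        using less.hyps[OF shorter deg] by (simp add: case_prod_unfold)
    qed
  qed
  ultimately have "((\<lambda>p. (Z (snd p) w - Z (fst p) w) -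
      (\<Sum>q\<in>?S. Z (fst p) (fst q) * ?Z (fst p) (snd p) (snd q))) \<longlongrightarrow> 0 - 0) ?F"
    by (rule tendsto_diff)
  moreover have "\<forall>\<^sub>F p in ?F. (Z (snd p) w - Z (fst p) w) -
      (\<Sum>q\<in>?S. Z (fst p) (fst q) * ?Z (fst p) (snd p) (snd q)) =
      (case p of (a, b) \<Rightarrow> ?Z a b w)"
    using inF by (rule eventually_mono) (auto simp: eq)
  ultimately show ?case
    unfolding diff_0_right by (rule Lim_transform_eventually)
qed

lemma hom_norm_increment_small:
  assumes "\<And>t. t \<in> {0..T} \<Longrightarrow> Z t \<in> carrier (pi_group \<nu> n)" and "continuous_on {0..T} Z"
    and "1 \<le> n" and "0 < \<epsilon>"
  shows "\<exists>\<delta>>0. \<forall>a b. 0 \<le> a \<longrightarrow> a \<le> b \<longrightarrow> b \<le> T \<longrightarrow> b - a < \<delta> \<longrightarrow>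
    hom_norm (word_deg \<nu>) n (group_incr (pi_group \<nu> n) Z a b) \<le> \<epsilon>"
proof -
  let ?F = "inf (filtercomap (\<lambda>(a, b). b - a) (nhds 0)) (principal ({0..T} \<times> {0..T}))"
  let ?W = "{w. 1 \<le> word_deg \<nu> w \<and> word_deg \<nu> w \<le> n}"
  have "\<forall>\<^sub>F p in ?F. \<forall>w\<in>?W. \<bar>group_incr (pi_group \<nu> n) Z (fst p) (snd p) w\<bar> < \<epsilon> ^ word_deg \<nu> w"
  proof (rule eventually_ball_finite[OF finite_word_degs], rule ballI)
    fix w assume "w \<in> ?W"
    then have "((\<lambda>(a, b). group_incr (pi_group \<nu> n) Z a b w) \<longlongrightarrow> 0) ?F"
      using increment_small[OF assms(1,2)] by simp
    from tendstoD[OF this, of "\<epsilon> ^ word_deg \<nu> w"]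
    show "\<forall>\<^sub>F p in ?F. \<bar>group_incr (pi_group \<nu> n) Z (fst p) (snd p) w\<bar> < \<epsilon> ^ word_deg \<nu> w"
      using assms(4) by (simp add: case_prod_unfold)
  qed
  then have "\<forall>\<^sub>F p in ?F. hom_norm (word_deg \<nu>) n (group_incr (pi_group \<nu> n) Z (fst p) (snd p)) \<le> \<epsilon>"
  proof (rule eventually_mono)
    fix p assume "\<forall>w\<in>?W. \<bar>group_incr (pi_group \<nu> n) Z (fst p) (snd p) w\<bar> < \<epsilon> ^ word_deg \<nu> w"
    then show "hom_norm (word_deg \<nu>) n (group_incr (pi_group \<nu> n) Z (fst p) (snd p)) \<le> \<epsilon>"
      using assms(3,4) by (intro hom_norm_le) (auto intro: less_imp_le)
  qed
  then obtain Q where Q: "\<forall>\<^sub>F d in nhds 0. Q d"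
    "\<And>a b. Q (b - a) \<Longrightarrow> a \<in> {0..T} \<Longrightarrow> b \<in> {0..T} \<Longrightarrow>
      hom_norm (word_deg \<nu>) n (group_incr (pi_group \<nu> n) Z a b) \<le> \<epsilon>"
    by (auto simp: eventually_inf_principal eventually_filtercomap case_prod_unfold)
  then obtain \<delta> where "0 < \<delta>" "\<And>d :: real. \<bar>d\<bar> < \<delta> \<Longrightarrow> Q d"
    by (auto simp: eventually_nhds_metric dist_real_def)
  then show ?thesis
    using Q(2) by (intro exI[of _ \<delta>]) auto
qed

end

theorem proposition18:
  fixes \<gamma> p T s t :: real
    and X :: "real \<Rightarrow> 'd::finite forest \<Rightarrow> real"
    and f :: "real^'d \<Rightarrow> ((real^'d) \<Rightarrow>\<^sub>L (real^'e::finite))"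
    and B :: "'d rtree set"
    and \<nu> :: "'k::finite \<Rightarrow> 'd rtree"
    and \<iota> :: "'d \<Rightarrow> 'k"
    and Z :: "real \<Rightarrow> 'k list \<Rightarrow> real"
    and g :: "real^'d \<Rightarrow> ((real^'k) \<Rightarrow>\<^sub>L (real^'e))"
  assumes "\<gamma> > p" and "p \<ge> 1" and "T > 0"
    and "branched_rough_path p T X"
    and "is_lip (\<gamma> - 1) f"
    and "freely_generates_gl B"
    and "bij_betw \<nu> UNIV {\<tau> \<in> B. tree_deg \<tau> \<le> int_part p}"
    and "\<And>i. \<nu> (\<iota> i) = bullet i"
    and "isomorphic_pi_rough_path \<nu> p T X Z"
    and "\<And>k. component g k = f_tree f (\<nu> k)"
    and "0 \<le> s" and "s < t" and "t \<le> T"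
  shows "\<exists>I. has_branched_integral p X f s t I \<and> has_pi_integral \<nu> \<iota> p (base_path X) Z g s t I"
proof -
  define n where "n = int_part p"
  let ?C = "character_group n" and ?P = "pi_group \<nu> n"
  let ?Z = "group_incr ?P Z" and ?x = "base_path X" and ?D = "\<lambda>j. f_tree f (\<nu> j)"
  have n: "1 \<le> n" "real n \<le> p"
    using assms(2) by (simp_all add: n_def int_part_def le_nat_iff)
  have deg_\<nu>: "tree_deg (\<nu> k) \<le> n" for k
    using assms(7) by (auto simp: bij_betw_def n_def)
  interpret letters \<nu> \<iota> n
    using assms(7,8) deg_\<nu> by unfold_locales (auto simp: bij_betw_def)
  interpret C: group ?C by (rule group_character_group)
  interpret P: group ?P by (rule group_pi_group)

  \<comment> \<open>Group-valued increments\<close>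
  have X: "X u \<in> carrier ?C" if "u \<in> {0..T}" for u
    using assms(4) that by (simp add: branched_rough_path_def rough_path_in_def n_def)
  have Z: "Z u \<in> carrier ?P" if "u \<in> {0..T}" for u
    using assms(9) that
    by (auto simp: isomorphic_pi_rough_path_def pi_rough_path_def rough_path_in_def n_def)
  have Z_cont: "continuous_on {0..T} Z"
    and Z_var: "p_var (\<lambda>u v. hom_norm (word_deg \<nu>) n (?Z u v)) p T < \<infinity>"
    using assms(9)
    by (auto simp: isomorphic_pi_rough_path_def pi_rough_path_def rough_path_in_def n_def)
  have iso: "isomorphic_at \<nu> n (X u) (Z u)" if "u \<in> {0..T}" for u
    using assms(9) that by (simp add: isomorphic_pi_rough_path_def n_def)
  have unitC: "a {#} = 1" if "a \<in> carrier ?C" for a :: "'d forest \<Rightarrow> real"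
    using that by (simp add: character_group_def)
  have unitP: "h [] = 1" if "h \<in> carrier ?P" for h
    using that by (simp add: pi_group_def)
  have incr_mult: "?Z u w = ?Z u v \<otimes>\<^bsub>?P\<^esub> ?Z v w"
    if "u \<in> {0..T}" "v \<in> {0..T}" "w \<in> {0..T}" for u v w
    using Z[OF that(1)] Z[OF that(2)] Z[OF that(3)] P.left_quotient(2)[of "Z v" "Z w"]
    by (simp add: group_incr_def P.m_assoc)
  have incr_refl: "?Z u u w = 0" if "u \<in> {0..T}" "w \<noteq> []" for u w
    using Z[OF that(1)] that(2) by (simp add: group_incr_def P.l_inv) (simp add: pi_group_def)

  \<comment> \<open>Regularity of the integrands\<close>
  obtain \<kappa> L where \<kappa>: "0 < \<kappa>" "p < real n + \<kappa>" and L: "0 \<le> L"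
    and diff: "\<And>i. n_differentiable (n - 1) (component f i)"
    and holder: "\<And>i w x y. length w = n - 1 \<Longrightarrow>
      norm (part_deriv (component f i) w x - part_deriv (component f i) w y) \<le> L * norm (x - y) powr \<kappa>"
    using component_regular[OF assms(5,1,2)] unfolding n_def by metis
  have Suc_n: "Suc (n - 1) = n" using n(1) by simp
  have D_diff: "n_differentiable (n - tree_deg (\<nu> j)) (?D j)" for j
    using f_tree_regular(1)[of "n - 1" f L \<kappa> "\<nu> j"] diff holder L deg_\<nu>[of j] unfolding Suc_n by blast
  have D_holder: "norm (part_deriv (?D j) w x - part_deriv (?D j) w y) \<le> L * norm (x - y) powr \<kappa>"
    if "length w = n - tree_deg (\<nu> j)" for j w x y
    using f_tree_regular(2)[of "n - 1" f L \<kappa> "\<nu> j" w x y] diff holder L deg_\<nu>[of j] that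
    unfolding Suc_n by blast

  \<comment> \<open>Equality of the two approximations on each interval\<close>
  have approx_eq: "branched_approx n X f u v = pi_approx \<nu> \<iota> n ?x Z g u v"
    if u: "u \<in> {0..T}" and v: "v \<in> {0..T}" for u v
  proof -
    have "group_incr ?C X u v {#corolla i M#} / forest_sigma (bullets M) = tree_coeff (?Z u v) (corolla i M)"
      if "size M < n" for i M
    proof (rule tree_coeff_increment[OF iso[OF u] _ _ _ _ that])
      show "isomorphic_at \<nu> n (X u \<otimes>\<^bsub>?C\<^esub> group_incr ?C X u v) (Z u \<otimes>\<^bsub>?P\<^esub> ?Z u v)"
        using iso[OF v] C.left_quotient(2)[OF X[OF u] X[OF v]] P.left_quotient(2)[OF Z[OF u] Z[OF v]]
        by (simp add: group_incr_def)
      show "group_incr ?C X u v {#} = 1"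
        unfolding group_incr_def by (rule unitC[OF C.left_quotient(1)[OF X[OF u] X[OF v]]])
      show "?Z u v [] = 1"
        unfolding group_incr_def by (rule unitP[OF P.left_quotient(1)[OF Z[OF u] Z[OF v]]])
      show "Z u [] = 1"
        by (rule unitP[OF Z[OF u]])
    qed
    then show ?thesis
      unfolding branched_approx_def pi_approx_def assms(10)
      by (rule branched_sum_eq) (use Suc_n in \<open>auto intro!: part_deriv_f_tree[OF diff]\<close>)
  qed

  \<comment> \<open>A control for the increments of \<open>Z\<close>\<close>
  define q where "q u v = hom_norm (word_deg \<nu>) n (?Z u v)" for u v
  define p' where "p' = (p + (real n + \<kappa>)) / 2"
  have p': "p < p'" "p' < real n + \<kappa>" "0 < p'" using \<kappa> assms(2) by (auto simp: p'_def)
  have q0: "0 \<le> q u v" for u v unfolding q_def by (rule hom_norm_nonneg[OF n(1)])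
  have q_refl: "q u u = 0" if "0 \<le> u" "u \<le> T" for u
  proof -
    have "q u u \<le> 0"
      unfolding q_def
    proof (rule hom_norm_le[OF n(1)])
      fix w assume "1 \<le> word_deg \<nu> w"
      then have "w \<noteq> []" by auto
      then show "\<bar>?Z u u w\<bar> \<le> 0 ^ word_deg \<nu> w"
        using that incr_refl[of u w] by simp
    qed simp
    then show ?thesis using q0[of u u] by simp
  qed
  obtain m :: nat where m: "p_var q p T < ereal (real m)"
    using Z_var unfolding q_def[abs_def] by (metis less_PInf_Ex_of_nat less_irrefl)
  \<comment> \<open>\<open>p_var\<close> takes the root of each sum; the power \<open>p\<close>
    turns its bound into one for the sums themselves, valid for all partitions at once.\<close>
  have bound: "chain_sum (\<lambda>a b. q a b powr p) D \<le> real m powr p" if D: "is_partition 0 T D" for D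
  proof -
    let ?S = "partition_sum (\<lambda>u v. q u v powr p) D"
    have "ereal (?S powr (1 / p)) \<le> p_var q p T"
      unfolding p_var_def using D by (intro SUP_upper) simp
    then have "?S powr (1 / p) \<le> real m"
      using m by (metis ereal_less_eq(3) le_less_trans less_imp_le)
    then have "(?S powr (1 / p)) powr p \<le> real m powr p"
      using assms(2) by (intro powr_mono2) auto
    moreover have "0 \<le> ?S" by (simp add: partition_sum_def sum_nonneg)
    ultimately show ?thesis
      using assms(2) by (simp add: powr_powr partition_sum_eq)
  qed
  obtain \<omega> where \<omega>0: "\<And>a b. 0 \<le> \<omega> a b"
    and super: "\<And>a b c. 0 \<le> a \<Longrightarrow> a \<le> b \<Longrightarrow> b \<le> c \<Longrightarrow> c \<le> T \<Longrightarrow> \<omega> a b + \<omega> b c \<le> \<omega> a c"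
    and \<omega>_small: "\<And>\<epsilon>. 0 < \<epsilon> \<Longrightarrow> \<exists>\<delta>>0. \<forall>a b. 0 \<le> a \<longrightarrow> a \<le> b \<longrightarrow> b \<le> T \<longrightarrow> b - a < \<delta> \<longrightarrow> \<omega> a b \<le> \<epsilon>"
    and q_\<omega>: "\<And>a b. 0 \<le> a \<Longrightarrow> a \<le> b \<Longrightarrow> b \<le> T \<Longrightarrow> q a b powr p' \<le> \<omega> a b"
  proof (rule ex_control[of q T p p' "real m powr p"])
    show "\<exists>\<delta>>0. \<forall>a b. 0 \<le> a \<longrightarrow> a \<le> b \<longrightarrow> b \<le> T \<longrightarrow> b - a < \<delta> \<longrightarrow> q a b \<le> \<epsilon>" if "0 < \<epsilon>" for \<epsilon>
      unfolding q_def by (rule hom_norm_increment_small[OF Z Z_cont n(1) that])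
  qed (use q0 q_refl assms(2,3) p' bound in auto)

  \<comment> \<open>Sewing along \<open>Z\<close>\<close>
  define K where "K = (\<Sum>j\<in>UNIV. \<Sum>v :: 'd list | length v \<le> n - tree_deg (\<nu> j).
      L * real CARD('d) ^ (n - tree_deg (\<nu> j) - length v) * real CARD('d) powr \<kappa>)"
  let ?\<Xi> = "pi_approx \<nu> \<iota> n ?x Z g"
  have \<Xi>: "?\<Xi> u v = pi_sum (?Z u v) ?D (?x u)" for u v
    by (simp add: pi_approx_eq assms(10))
  have "\<exists>I. (partition_sum ?\<Xi> \<longlongrightarrow> I) (mesh_to_0 s t)"
  proof (rule sewing[where \<omega> = \<omega> and \<theta> = "(real n + \<kappa>) / p'" and C = K])
    show "1 < (real n + \<kappa>) / p'" using p' by simp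
    show "0 \<le> K" unfolding K_def using L by (intro sum_nonneg) auto
    show "\<omega> a b + \<omega> b c \<le> \<omega> a c" if "s \<le> a" "a \<le> b" "b \<le> c" "c \<le> t" for a b c
      using super that assms(11,13) by simp
    show "\<exists>\<delta>>0. \<forall>a b. s \<le> a \<longrightarrow> a \<le> b \<longrightarrow> b \<le> t \<longrightarrow> b - a < \<delta> \<longrightarrow> \<omega> a b \<le> \<epsilon>" if "0 < \<epsilon>" for \<epsilon>
      using \<omega>_small[OF that] assms(11,13) by (meson order_trans)
    show "?\<Xi> a a = 0" if "s \<le> a" "a \<le> t" for a
      using that assms(11,13) incr_refl[of a] by (simp add: \<Xi> pi_sum_def)
    show "norm (?\<Xi> a c - ?\<Xi> a b - ?\<Xi> b c) \<le> K * \<omega> a c powr ((real n + \<kappa>) / p')"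
      if abc: "s \<le> a" "a \<le> b" "b \<le> c" "c \<le> t" for a b c
    proof -
      have mem: "a \<in> {0..T}" "b \<in> {0..T}" "c \<in> {0..T}" using abc assms(11,13) by auto
      \<comment> \<open>By superadditivity \<omega> is at most \<open>\<omega> a c\<close> on both
        subintervals, so \<open>N\<close> bounds the homogeneous norms of both increments, and
        \<open>N powr (real n + \<kappa>)\<close> is the power of \<omega> that sewing
        requires.\<close>
      define N where "N = \<omega> a c powr (1 / p')"
      have qN: "q u v \<le> N" if "0 \<le> u" "u \<le> v" "v \<le> T" "\<omega> u v \<le> \<omega> a c" for u v
      proof -
        have "(q u v powr p') powr (1 / p') \<le> N"
          unfolding N_def using q_\<omega>[OF that(1-3)] that(4) p'(3) by (intro powr_mono2) auto
        then show ?thesis using p'(3) q0 by (simp add: powr_powr)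
      qed
      have mono: "\<omega> a b \<le> \<omega> a c" "\<omega> b c \<le> \<omega> a c"
        using super[of a b c] \<omega>0[of a b] \<omega>0[of b c] abc mem by auto
      have le: "\<bar>?Z u v w\<bar> \<le> N ^ word_deg \<nu> w"
        if "1 \<le> word_deg \<nu> w" "word_deg \<nu> w \<le> n" "q u v \<le> N" for u v w
        using le_hom_norm_power[OF that(1,2), of "?Z u v"] power_mono[OF that(3) q0, of "word_deg \<nu> w"]
        by (simp add: q_def)
      \<comment> \<open>In degree 1 the isomorphism identifies the base path with the letters
        \<iota> i of \<open>Z\<close>, so its increment is the displacement in Taylor's
        formula.\<close>
      have x: "?x b = ?x a + (\<chi> i. ?Z a b [\<iota> i])"
      proof -
        have "Z b [\<iota> i] = Z a [\<iota> i] + ?Z a b [\<iota> i]" for i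
        proof -
          have "Z b [\<iota> i] = (Z a \<otimes>\<^bsub>?P\<^esub> ?Z a b) [\<iota> i]"
            using P.left_quotient(2)[OF Z Z, of a b] mem by (simp add: group_incr_def)
          also have "\<dots> = Z a [\<iota> i] + ?Z a b [\<iota> i]"
            using mem n(1) unitP[OF Z[of a]] unitP[OF P.left_quotient(1)[OF Z Z, of a b]]
            by (simp add: pi_group_def \<nu>_\<iota> sum_deconcat group_incr_def)
          finally show ?thesis .
        qed
        moreover have "X u {#bullet i#} = Z u [\<iota> i]" if "u \<in> {0..T}" for u i
        proof -
          have "{w. mset w = {#i#}} = {[i]}" by auto
          then show ?thesis
            using isomorphic_at_bullets[OF iso[OF that], of "{#i#}"] n(1)
            by (simp add: bullets_coeff_def forest_sigma_add)
        qed
        ultimately show ?thesis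
          using mem by (simp add: base_path_def vec_eq_iff)
      qed
      have "norm (pi_sum (?Z a b \<otimes>\<^bsub>?P\<^esub> ?Z b c) ?D (?x a) -
          pi_sum (?Z a b) ?D (?x a) - pi_sum (?Z b c) ?D (?x b)) \<le>
          K * N powr (real n + \<kappa>)"
        unfolding K_def
      proof (rule pi_sum_almost_additive[OF D_diff _ L \<kappa>(1) _ _ _ _ _ x])
        show "?Z a b \<in> carrier ?P" "?Z b c \<in> carrier ?P"
          using P.left_quotient(1)[OF Z Z] mem by (simp_all add: group_incr_def)
        show "norm (part_deriv (?D j) w x - part_deriv (?D j) w y) \<le> L * norm (x - y) powr \<kappa>"
          if "length w = n - tree_deg (\<nu> j)" for j w x y
          using that by (rule D_holder)
        show "0 \<le> N" by (simp add: N_def)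
        show "\<bar>?Z a b w\<bar> \<le> N ^ word_deg \<nu> w" if "1 \<le> word_deg \<nu> w" "word_deg \<nu> w \<le> n" for w
          using that abc mem mono by (intro le qN) auto
        show "\<bar>?Z b c w\<bar> \<le> N ^ word_deg \<nu> w" if "1 \<le> word_deg \<nu> w" "word_deg \<nu> w \<le> n" for w
          using that abc mem mono by (intro le qN) auto
      qed
      then show ?thesis
        using incr_mult[OF mem] by (simp add: \<Xi> N_def powr_powr)
    qed
  qed (use assms(12) \<omega>0 in auto)
  then obtain I where I: "(partition_sum ?\<Xi> \<longlongrightarrow> I) (mesh_to_0 s t)" by blast

  \<comment> \<open>Transfer of the limit to the sums along \<open>X\<close>\<close>
  have "\<forall>\<^sub>F D in mesh_to_0 s t. partition_sum ?\<Xi> D = partition_sum (branched_approx n X f) D"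
    unfolding mesh_to_0_def
  \<comment> \<open>The mesh bound 1 is arbitrary: the sums agree on every partition of
    \<open>[s, t]\<close>.\<close>
  proof (intro eventually_INF1[of 1], simp, unfold eventually_principal, rule ballI)
    fix D assume "D \<in> {D. is_partition s t D \<and> mesh D < 1}"
    then have D: "sorted_wrt (<) D" "hd D = s" "last D = t" by (auto simp: is_partition_def)
    have "D ! k \<in> {0..T}" if "k < length D" for k
      using sorted_hd_last_bounds[OF D(1) nth_mem[OF that]] D(2,3) assms(11,13) by auto
    then show "partition_sum ?\<Xi> D = partition_sum (branched_approx n X f) D"
      unfolding partition_sum_def by (intro sum.cong refl approx_eq[symmetric]) auto
  qed
  then have "(partition_sum (branched_approx n X f) \<longlongrightarrow> I) (mesh_to_0 s t)"
    using I by (rule Lim_transform_eventually[rotated])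
  with I show ?thesis
    by (auto simp: has_branched_integral_def has_pi_integral_def n_def)
qed

end
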